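(* Let $\{\omega_m\}_{m=1}^\infty$ be a sequence of positive real numbers. If the Jacobi sequence $\{\omega_m\}_{m=1}^\infty$ has property (SC), then: (i) $X_{\mathrm{even}}$ and $X_{\mathrm{odd}}$ are extensions of $X$; (ii) $X_{\mathrm{even}}$ and $X_{\mathrm{odd}}$ are self-adjoint operators; (iii) $X_{\mathrm{even}}$ and $X_{\mathrm{odd}}$ have finite moments of all orders with respect to the state $\langle\,\cdot\,\delta_0,\delta_0\rangle$, and their Jacobi sequence is identical to $\{\omega_m\}_{m=1}^\infty$; (iv) their Stieltjes transforms at $i$, $\langle(i-X_{\mathrm{even}})^{-1}\delta_0,\delta_0\rangle$ and $\langle(i-X_{\mathrm{odd}})^{-1}\delta_0,\delta_0\rangle$, are different.
   Context: $\ell_2(\mathbb{N})$, $\mathbb{N}=\{0,1,2,\dots\}$, has standard orthonormal basis $\{\delta_k\}_{k\in\mathbb{N}}$; $\oplus_{\mathbb{N}}\mathbb{C}$ is the subspace of finitely supported vectors. $X$ is the symmetric operator with domain $\oplus_{\mathbb{N}}\mathbb{C}$ given by the infinite symmetric tridiagonal matrix with zero diagonal and off-diagonal entries $\sqrt{\omega_1},\sqrt{\omega_2},\dots$, i.e. $X\delta_k=\sqrt{\omega_k}\,\delta_{k-1}+\sqrt{\omega_{k+1}}\,\delta_{k+1}$ (first term absent if $k=0$); $X^*$ is its adjoint. $X_m$ is the upper-left $(m+1)\times(m+1)$ truncation of $X$, acting on $\ell_2(\{0,\dots,m\})$, and $Y^{(m)}=(i-X_m)^{-1}$, regarded as an operator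 on $\ell_2(\mathbb{N})$ by extending it by $0$ on the orthogonal complement of $\ell_2(\{0,\dots,m\})$. Property (SC): define $B_{-1}=1$, $B_0=1$, $B_m=B_{m-1}+\omega_mB_{m-2}$ for $m\ge1$; $\{\omega_m\}$ has property (SC) if $\sum_{n=1}^\infty \frac{B_{n-1}}{B_n}<\infty$. (Equivalently, the limits of the upper-left entries of $Y^{(2m)}$ and of $Y^{(2m+1)}$ as $m\to\infty$ are different.) When property (SC) holds, the sequences $\{Y^{(2m)}\}_m$ and $\{Y^{(2m+1)}\}_m$ converge in the strong operator topology; their limits are denoted $Y^{\mathrm{even}}$ and $Y^{\mathrm{odd}}$, and the images of $Y^{\mathrm{even}}$ and $Y^{\mathrm{odd}}$ are contained in $\mathrm{Dom}(X^* )$. Define $X_{\mathrm{even}}=X^*|_{\mathrm{Image}(Y^{\mathrm{even}})}$ and $X_{\mathrm{odd}}=X^*|_{\mathrm{Image}(Y^{\mathrm{odd}})}$. For a self-adjoint operator $T$ with spectral measure $E$, its moments and Jacobi sequence with respect to the state $\langle\,\cdot\,\delta_0,\delta_0\rangle$ are those of the probability measure $\langle E(\cdot)\delta_0,\delta_0\rangle$. A probability measure with infinite support and finite moments has Jacobi sequence $\{\omega_n\}_{n=1}^\infty$ if its monic orthogonal polynomials $P_0=1,P_1,\dots$ satisfy $xP_n=P_{n+1}+\omega_nP_{n-1}$ for $n\ge0$, with $P_{-1}=0$. *)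

theory Defs
  imports "HOL-Probability.Probability" "HOL-Computational_Algebra.Polynomial"
begin

type_synonym vec = "nat \<Rightarrow> complex"

definition ell2 :: "vec set" where
  "ell2 = {x. summable (\<lambda>k. (cmod (x k))\<^sup>2)}"

text \<open>The inner product is linear in the first argument. It and the norm are meaningful only
  for arguments in \<open>ell2\<close>.\<close>

definition ell2_inner :: "vec \<Rightarrow> vec \<Rightarrow> complex" where
  "ell2_inner x y = (\<Sum>k. x k * cnj (y k))"

definition ell2_norm :: "vec \<Rightarrow> real" where
  "ell2_norm x = sqrt (\<Sum>k. (cmod (x k))\<^sup>2)"

definition delta :: "nat \<Rightarrow> vec" where
  "delta n = (\<lambda>k. if k = n then 1 else 0)"

definition ell2_tendsto :: "(nat \<Rightarrow> vec) \<Rightarrow> vec \<Rightarrow> bool" where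
  "ell2_tendsto u x \<longleftrightarrow> (\<lambda>n. ell2_norm (\<lambda>k. u n k - x k)) \<longlonglongrightarrow> 0"

definition ell2_dense :: "vec set \<Rightarrow> bool" where
  "ell2_dense D \<longleftrightarrow> D \<subseteq> ell2 \<and> (\<forall>x\<in>ell2. \<forall>e>0. \<exists>d\<in>D. ell2_norm (\<lambda>k. x k - d k) < e)"

text \<open>A possibly unbounded operator is identified with its graph: \<open>(x, y) \<in> T\<close> means that \<open>x\<close>
  is in the domain of \<open>T\<close> and \<open>T x = y\<close>. Thus \<open>Domain T\<close> and \<open>Range T\<close> are the domain and the
  image of \<open>T\<close>, and \<open>S \<subseteq> T\<close> says that \<open>T\<close> is an extension of \<open>S\<close>.\<close>

type_synonym operator = "(vec \<times> vec) set"

definition linear_operator :: "operator \<Rightarrow> bool" where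
  "linear_operator T \<longleftrightarrow> T \<subseteq> ell2 \<times> ell2 \<and> single_valued T \<and> T \<noteq> {} \<and>
     (\<forall>(x, y)\<in>T. \<forall>(x', y')\<in>T. \<forall>a b.
        ((\<lambda>k. a * x k + b * x' k), (\<lambda>k. a * y k + b * y' k)) \<in> T)"

definition op_apply :: "operator \<Rightarrow> vec \<Rightarrow> vec" where
  "op_apply T x = (THE y. (x, y) \<in> T)"

definition op_restrict :: "operator \<Rightarrow> vec set \<Rightarrow> operator" where
  "op_restrict T D = {(x, y) \<in> T. x \<in> D}"

text \<open>For densely defined \<open>T\<close> this is the graph of the Hilbert space adjoint \<open>T\<^sup>*\<close>.\<close>

definition adjoint_op :: "operator \<Rightarrow> operator" where
  "adjoint_op T = {(y, z). y \<in> ell2 \<and> z \<in> ell2 \<and>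
     (\<forall>(x, w)\<in>T. ell2_inner w y = ell2_inner x z)}"

definition self_adjoint_op :: "operator \<Rightarrow> bool" where
  "self_adjoint_op T \<longleftrightarrow> linear_operator T \<and> ell2_dense (Domain T) \<and> adjoint_op T = T"

text \<open>The inverse of \<open>z - T\<close>.\<close>

definition resolvent :: "complex \<Rightarrow> operator \<Rightarrow> operator" where
  "resolvent z T = {(x, \<lambda>k. z * x k - y k) |x y. (x, y) \<in> T}\<inverse>"

definition orthogonal_projection :: "(vec \<Rightarrow> vec) \<Rightarrow> bool" where
  "orthogonal_projection P \<longleftrightarrow>
     (\<forall>x\<in>ell2. P x \<in> ell2 \<and> P (P x) = P x) \<and>
     (\<forall>x\<in>ell2. \<forall>y\<in>ell2. \<forall>a b. P (\<lambda>k. a * x k + b * y k) = (\<lambda>k. a * P x k + b * P y k)) \<and>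
     (\<forall>x\<in>ell2. \<forall>y\<in>ell2. ell2_inner (P x) y = ell2_inner x (P y))"

text \<open>Countable additivity is with respect to the strong operator topology.\<close>

definition projection_valued_measure :: "(real set \<Rightarrow> vec \<Rightarrow> vec) \<Rightarrow> bool" where
  "projection_valued_measure E \<longleftrightarrow>
     (\<forall>A\<in>sets borel. orthogonal_projection (E A)) \<and>
     (\<forall>x\<in>ell2. E UNIV x = x) \<and>
     (\<forall>A. range A \<subseteq> sets borel \<and> disjoint_family A \<longrightarrow>
        (\<forall>x\<in>ell2. ell2_tendsto (\<lambda>n k. \<Sum>j<n. E (A j) x k) (E (\<Union>j. A j) x)))"

text \<open>The measure \<open>A \<mapsto> \<langle>E(A) v, v\<rangle>\<close>; its values are real and nonnegative.\<close>

definition spectral_distribution :: "(real set \<Rightarrow> vec \<Rightarrow> vec) \<Rightarrow> vec \<Rightarrow> real measure" where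
  "spectral_distribution E v =
     measure_of UNIV (sets borel) (\<lambda>A. ennreal (Re (ell2_inner (E A v) v)))"

text \<open>\<open>T = \<integral> t dE(t)\<close>, in the usual weak sense: the domain of \<open>T\<close> consists of the \<open>x\<close> with
  \<open>\<integral> t\<^sup>2 d\<langle>E(t) x, x\<rangle> < \<infinity>\<close>, and \<open>\<langle>T x, x\<rangle> = \<integral> t d\<langle>E(t) x, x\<rangle>\<close> for those \<open>x\<close> (which determines
  \<open>T\<close> by polarization).\<close>

definition spectral_measure :: "operator \<Rightarrow> (real set \<Rightarrow> vec \<Rightarrow> vec) \<Rightarrow> bool" where
  "spectral_measure T E \<longleftrightarrow> projection_valued_measure E \<and>
     Domain T = {x \<in> ell2. integrable (spectral_distribution E x) (\<lambda>t. t\<^sup>2)} \<and>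
     (\<forall>(x, y)\<in>T. ell2_inner y x = complex_of_real (\<integral>t. t \<partial>spectral_distribution E x))"

definition finite_moments :: "real measure \<Rightarrow> bool" where
  "finite_moments \<mu> \<longleftrightarrow> (\<forall>n::nat. integrable \<mu> (\<lambda>t. t ^ n))"

definition measure_support :: "real measure \<Rightarrow> real set" where
  "measure_support \<mu> = {t. \<forall>U. open U \<and> t \<in> U \<longrightarrow> emeasure \<mu> U > 0}"

definition monic_orthogonal_polys :: "real measure \<Rightarrow> (nat \<Rightarrow> real poly) \<Rightarrow> bool" where
  "monic_orthogonal_polys \<mu> P \<longleftrightarrow>
     (\<forall>n. degree (P n) = n \<and> lead_coeff (P n) = 1) \<and>
     (\<forall>m n. m \<noteq> n \<longrightarrow> (\<integral>t. poly (P m) t * poly (P n) t \<partial>\<mu>) = 0)"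

text \<open>A Jacobi sequence \<open>\<omega>\<^sub>1, \<omega>\<^sub>2, \<dots>\<close> is represented by a function on \<open>nat\<close> whose value at \<open>0\<close>
  is irrelevant. The polynomials are indexed from \<open>0\<close>; the term with \<open>P\<^sub>-\<^sub>1 = 0\<close> is dropped.\<close>

definition has_jacobi_sequence :: "real measure \<Rightarrow> (nat \<Rightarrow> real) \<Rightarrow> bool" where
  "has_jacobi_sequence \<mu> \<omega> \<longleftrightarrow>
     prob_space \<mu> \<and> sets \<mu> = sets borel \<and> infinite (measure_support \<mu>) \<and> finite_moments \<mu> \<and>
     (\<exists>P. monic_orthogonal_polys \<mu> P \<and> P 0 = 1 \<and>
        [:0, 1:] * P 0 = P 1 \<and>
        (\<forall>n\<ge>1. [:0, 1:] * P n = P (n + 1) + smult (\<omega> n) (P (n - 1))))"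

definition jacobi_entry :: "(nat \<Rightarrow> real) \<Rightarrow> nat \<Rightarrow> nat \<Rightarrow> complex" where
  "jacobi_entry \<omega> j k =
     (if k = j + 1 then complex_of_real (sqrt (\<omega> k))
      else if j = k + 1 then complex_of_real (sqrt (\<omega> j)) else 0)"

definition jacobi_op :: "(nat \<Rightarrow> real) \<Rightarrow> operator" where
  "jacobi_op \<omega> = {(x, \<lambda>j. \<Sum>k | x k \<noteq> 0. jacobi_entry \<omega> j k * x k) |x. finite {k. x k \<noteq> 0}}"

definition truncated_jacobi :: "(nat \<Rightarrow> real) \<Rightarrow> nat \<Rightarrow> vec \<Rightarrow> vec" where
  "truncated_jacobi \<omega> m x = (\<lambda>j. if j \<le> m then \<Sum>k\<le>m. jacobi_entry \<omega> j k * x k else 0)"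

text \<open>\<open>Y\<^sup>(\<^sup>m\<^sup>)\<close>: the inverse of \<open>i - X\<^sub>m\<close> on the vectors supported in \<open>{0..m}\<close>, composed with the
  orthogonal projection onto that subspace, that is, extended by zero.\<close>

definition Y_trunc :: "(nat \<Rightarrow> real) \<Rightarrow> nat \<Rightarrow> vec \<Rightarrow> vec" where
  "Y_trunc \<omega> m x =
     inv_into {y. \<forall>k>m. y k = 0} (\<lambda>y k. \<i> * y k - truncated_jacobi \<omega> m y k)
       (\<lambda>k. if k \<le> m then x k else 0)"

text \<open>The limit of everywhere defined operators in the strong operator topology, as a graph.\<close>

definition strong_limit :: "(nat \<Rightarrow> vec \<Rightarrow> vec) \<Rightarrow> operator" where
  "strong_limit F = {(x, y). x \<in> ell2 \<and> y \<in> ell2 \<and> ell2_tendsto (\<lambda>m. F m x) y}"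

definition Y_even :: "(nat \<Rightarrow> real) \<Rightarrow> operator" where
  "Y_even \<omega> = strong_limit (\<lambda>m. Y_trunc \<omega> (2 * m))"

definition Y_odd :: "(nat \<Rightarrow> real) \<Rightarrow> operator" where
  "Y_odd \<omega> = strong_limit (\<lambda>m. Y_trunc \<omega> (2 * m + 1))"

definition X_even :: "(nat \<Rightarrow> real) \<Rightarrow> operator" where
  "X_even \<omega> = op_restrict (adjoint_op (jacobi_op \<omega>)) (Range (Y_even \<omega>))"

definition X_odd :: "(nat \<Rightarrow> real) \<Rightarrow> operator" where
  "X_odd \<omega> = op_restrict (adjoint_op (jacobi_op \<omega>)) (Range (Y_odd \<omega>))"

text \<open>The second equation is \<open>B\<^sub>1 = B\<^sub>0 + \<omega>\<^sub>1 B\<^sub>-\<^sub>1\<close> with \<open>B\<^sub>-\<^sub>1 = 1\<close>.\<close>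

fun SC_B :: "(nat \<Rightarrow> real) \<Rightarrow> nat \<Rightarrow> real" where
  "SC_B \<omega> 0 = 1"
| "SC_B \<omega> (Suc 0) = SC_B \<omega> 0 + \<omega> 1 * 1"
| "SC_B \<omega> (Suc (Suc m)) = SC_B \<omega> (Suc m) + \<omega> (Suc (Suc m)) * SC_B \<omega> m"

definition property_SC :: "(nat \<Rightarrow> real) \<Rightarrow> bool" where
  "property_SC \<omega> \<longleftrightarrow> summable (\<lambda>n. SC_B \<omega> n / SC_B \<omega> (Suc n))"

end

theory Submission
  imports Defs "HOL-Complex_Analysis.Great_Picard"
begin

text \<open>
  The inverse of \<open>i - X\<^sub>m\<close> is explicit, and everything is read off from it. Let \<open>A\<^sub>0, A\<^sub>1, \<dots>\<close> be
  the sequence \<open>B\<^sub>-\<^sub>1, B\<^sub>0, \<dots>\<close>. The vector \<open>\<pi>\<^sub>n = i\<^sup>n A\<^sub>n / \<surd>(\<omega>\<^sub>1 \<cdots> \<omega>\<^sub>n)\<close> solves the three-term recurrence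
  at the spectral parameter \<open>i\<close>, and the matrix of \<open>Y\<^sup>(\<^sup>m\<^sup>)\<close> is
  \<open>- i \<pi>\<^sub>j \<pi>\<^sub>k (\<Sum>n = max j k..m. (-1)\<^sup>n c\<^sub>n)\<close> with \<open>c\<^sub>n = \<omega>\<^sub>1 \<cdots> \<omega>\<^sub>n / (A\<^sub>n A\<^sub>n\<^sub>+\<^sub>1)\<close>
  (\<open>green_column\<close>, \<open>Y_trunc_eq\<close>). The partial sums of \<open>\<parallel>\<pi>\<parallel>\<^sup>2\<close> are \<open>1 / c\<^sub>n\<close> (\<open>sum_a_squared\<close>), and
  property (SC) is what keeps them bounded. So \<open>\<pi>\<close> is square summable and \<open>c\<^sub>n\<close> decreases to a
  positive limit. The alternating sums \<open>\<Sum>n\<le>m. (-1)\<^sup>n c\<^sub>n\<close> therefore converge along even and along odd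
  \<open>m\<close>, to different limits \<open>\<sigma>\<close> and \<open>\<tau>\<close> (\<open>even_odd_limits\<close>). Since all kernels are dominated by
  \<open>\<bar>\<pi>\<^sub>j \<pi>\<^sub>k\<bar>\<close>, the operators converge strongly and the limit \<open>Y\<close> is compact. The two Stieltjes
  transforms at \<open>i\<close> are \<open>- i \<sigma>\<close> and \<open>- i \<tau>\<close>, hence different.

  The truncations satisfy \<open>2i \<langle>Yx, Yy\<rangle> = \<langle>x, Yy\<rangle> - \<langle>Yx, y\<rangle>\<close>, and this passes to the limit. The matrix
  \<open>Y\<close> is symmetric, so \<open>Y\<^sup>*\<close> is its entrywise conjugate, and the identity gives both
  \<open>2i Y\<^sup>*Y = Y\<^sup>* - Y\<close> and \<open>2i YY\<^sup>* = Y\<^sup>* - Y\<close>. These say that \<open>2iY - 1\<close> is unitary; the operator that maps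
  \<open>Yx\<close> to \<open>iYx - x\<close> is its inverse Cayley transform and thus self-adjoint (\<open>adjoint_T\<close>). It is the
  restriction of \<open>X\<^sup>*\<close> to the image of \<open>Y\<close> (\<open>X_eq\<close>). A finitely supported \<open>x\<close> satisfies
  \<open>Y\<^sup>(\<^sup>m\<^sup>)(ix - Xx) = x\<close> for all large \<open>m\<close>, so it lies in the image of \<open>Y\<close>, which makes the operator
  an extension of \<open>X\<close>.

  The spectral measure is discrete. An eigenvector of the extension with eigenvalue \<open>t\<close> solves the
  recurrence at \<open>t\<close>, so it is a multiple of the vector \<open>p(t)\<close> of normalised orthogonal polynomials
  at \<open>t\<close>. If the \<open>p(t)\<close> of all eigenvalues did not span, then maximising \<open>\<parallel>Yx\<parallel>\<close> over the unit ball
  of their orthogonal complement, which is possible because \<open>Y\<close> is compact, would produce one more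
  eigenvector (\<open>ex_eigenvector\<close>, \<open>eigs_complete\<close>). In the resulting orthonormal basis the extension
  is diagonal, so projections onto spans of basis vectors form its spectral measure
  (\<open>spectral_measure_proj\<close>). The distribution of \<open>\<delta>\<^sub>0\<close> has mass \<open>1 / \<parallel>p(t)\<parallel>\<^sup>2\<close> at the eigenvalue \<open>t\<close>, and
  Parseval's identity for \<open>\<delta>\<^sub>j\<close> and \<open>\<delta>\<^sub>k\<close> is the orthogonality of the polynomials
  (\<open>integral_products\<close>).
\<close>

section \<open>The sequence space\<close>

lemma ell2_summable: "x \<in> ell2 \<Longrightarrow> summable (\<lambda>k. (cmod (x k))\<^sup>2)"
  by (simp add: ell2_def)

lemma ell2_mult_summable:
  assumes "x \<in> ell2" "y \<in> ell2"
  shows "summable (\<lambda>k. cmod (x k) * cmod (y k))"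
proof (rule summable_comparison_test')
  show "summable (\<lambda>k. (cmod (x k))\<^sup>2 + (cmod (y k))\<^sup>2)"
    using assms by (simp add: ell2_def summable_add)
  show "norm (cmod (x k) * cmod (y k)) \<le> (cmod (x k))\<^sup>2 + (cmod (y k))\<^sup>2" if "k \<ge> 0" for k
  proof -
    have "0 \<le> (cmod (x k) - cmod (y k))\<^sup>2" by simp
    moreover have "0 \<le> cmod (x k) * cmod (y k)" by simp
    ultimately have "cmod (x k) * cmod (y k) \<le> (cmod (x k))\<^sup>2 + (cmod (y k))\<^sup>2"
      unfolding power2_diff by linarith
    thus ?thesis by simp
  qed
qed

lemma ell2_prod_summable:
  assumes "x \<in> ell2" "y \<in> ell2"
  shows "summable (\<lambda>k. x k * y k)"
  by (rule summable_norm_cancel) (use ell2_mult_summable[OF assms] in \<open>simp add: norm_mult\<close>)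

lemma ell2_cnj: "x \<in> ell2 \<Longrightarrow> (\<lambda>k. cnj (x k)) \<in> ell2"
  by (simp add: ell2_def)

lemma ell2_inner_summable:
  assumes "x \<in> ell2" "y \<in> ell2"
  shows "summable (\<lambda>k. x k * cnj (y k))"
  using ell2_prod_summable[OF assms(1) ell2_cnj[OF assms(2)]] .

lemma ell2_lincomb:
  assumes "x \<in> ell2" "y \<in> ell2"
  shows "(\<lambda>k. a * x k + b * y k) \<in> ell2"
proof -
  have sm: "summable (\<lambda>k. 2 * (cmod a)\<^sup>2 * (cmod (x k))\<^sup>2 + 2 * (cmod b)\<^sup>2 * (cmod (y k))\<^sup>2)"
    using assms by (intro summable_add summable_mult) (auto simp: ell2_def)
  have le: "norm ((cmod (a * x k + b * y k))\<^sup>2)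
      \<le> 2 * (cmod a)\<^sup>2 * (cmod (x k))\<^sup>2 + 2 * (cmod b)\<^sup>2 * (cmod (y k))\<^sup>2" for k
  proof -
    have "cmod (a * x k + b * y k) \<le> cmod (a * x k) + cmod (b * y k)"
      by (rule norm_triangle_ineq)
    hence "(cmod (a * x k + b * y k))\<^sup>2 \<le> (cmod (a * x k) + cmod (b * y k))\<^sup>2"
      by (simp add: power_mono)
    also have "\<dots> \<le> 2 * (cmod (a * x k))\<^sup>2 + 2 * (cmod (b * y k))\<^sup>2"
      using zero_le_power2[of "cmod (a * x k) - cmod (b * y k)"]
      by (simp add: power2_diff power2_sum)
    finally show ?thesis by (simp add: norm_mult power_mult_distrib)
  qed
  show ?thesis
    unfolding ell2_def mem_Collect_eq by (rule summable_comparison_test'[OF sm le])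
qed

lemma ell2_scale: "x \<in> ell2 \<Longrightarrow> (\<lambda>k. a * x k) \<in> ell2"
  using ell2_lincomb[of x x a 0] by simp

lemma ell2_add: "x \<in> ell2 \<Longrightarrow> y \<in> ell2 \<Longrightarrow> (\<lambda>k. x k + y k) \<in> ell2"
  using ell2_lincomb[of x y 1 1] by simp

lemma ell2_diff: "x \<in> ell2 \<Longrightarrow> y \<in> ell2 \<Longrightarrow> (\<lambda>k. x k - y k) \<in> ell2"
  using ell2_lincomb[of x y 1 "-1"] by simp

lemma ell2_finite_support:
  assumes "finite {k. x k \<noteq> 0}"
  shows "x \<in> ell2"
  unfolding ell2_def mem_Collect_eq
  by (rule summable_finite[OF assms]) auto

lemma ell2_zero: "(\<lambda>k. 0) \<in> ell2"
  by (rule ell2_finite_support) simp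

lemma ell2_delta: "delta n \<in> ell2"
  by (rule ell2_finite_support) (auto simp: delta_def intro: finite_subset[of _ "{n}"])

lemma ell2_sum: "(\<And>i. i \<in> I \<Longrightarrow> u i \<in> ell2) \<Longrightarrow> (\<lambda>k. \<Sum>i\<in>I. u i k) \<in> ell2"
  by (induction I rule: infinite_finite_induct) (auto simp: ell2_zero ell2_add)

lemma ell2_comparison:
  assumes "g \<in> ell2" "\<And>k. cmod (x k) \<le> cmod (g k)"
  shows "x \<in> ell2"
  unfolding ell2_def mem_Collect_eq
  by (rule summable_comparison_test'[OF ell2_summable[OF assms(1)], where N = 0])
     (simp add: assms(2) power_mono)

lemma ell2_norm_nonneg: "x \<in> ell2 \<Longrightarrow> 0 \<le> ell2_norm x"
  by (simp add: ell2_norm_def ell2_def suminf_nonneg)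

lemma ell2_norm_power2: "x \<in> ell2 \<Longrightarrow> (ell2_norm x)\<^sup>2 = (\<Sum>k. (cmod (x k))\<^sup>2)"
  by (simp add: ell2_norm_def ell2_def suminf_nonneg)

lemma ell2_inner_self: "x \<in> ell2 \<Longrightarrow> ell2_inner x x = complex_of_real ((ell2_norm x)\<^sup>2)"
  unfolding ell2_inner_def ell2_norm_power2
  by (subst suminf_of_real[OF ell2_summable]) (auto simp: complex_norm_square[symmetric])

lemma ell2_norm_zero: "ell2_norm (\<lambda>k. 0) = 0"
  by (simp add: ell2_norm_def)

lemma ell2_norm_scale: "x \<in> ell2 \<Longrightarrow> ell2_norm (\<lambda>k. a * x k) = cmod a * ell2_norm x"
  by (simp add: ell2_norm_def norm_mult power_mult_distrib suminf_mult real_sqrt_mult ell2_summable)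

lemma ell2_norm_minus: "ell2_norm (\<lambda>k. x k - y k) = ell2_norm (\<lambda>k. y k - x k)"
  by (simp add: ell2_norm_def norm_minus_commute)

lemma ell2_norm_cnj: "ell2_norm (\<lambda>k. cnj (x k)) = ell2_norm x"
  by (simp add: ell2_norm_def)

lemma ell2_L2_set_le: "x \<in> ell2 \<Longrightarrow> L2_set (\<lambda>k. cmod (x k)) {..<n} \<le> ell2_norm x"
  unfolding ell2_norm_def L2_set_def
  by (intro real_sqrt_le_mono sum_le_suminf) (auto simp: ell2_summable)

lemma ell2_norm_leI:
  assumes "\<And>n. L2_set (\<lambda>k. cmod (x k)) {..<n} \<le> B"
  shows "x \<in> ell2" "ell2_norm x \<le> B"
proof -
  have B: "0 \<le> B" using order_trans[OF L2_set_nonneg assms[of 0]] .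
  have le: "(\<Sum>k<n. (cmod (x k))\<^sup>2) \<le> B\<^sup>2" for n
    using assms[of n] B unfolding L2_set_def by (simp add: real_sqrt_le_iff' sqrt_le_D)
  show *: "x \<in> ell2"
    unfolding ell2_def mem_Collect_eq by (rule summableI_nonneg_bounded[OF _ le]) auto
  have "(ell2_norm x)\<^sup>2 \<le> B\<^sup>2"
    unfolding ell2_norm_power2[OF *] by (rule suminf_le_const[OF ell2_summable[OF *] le])
  thus "ell2_norm x \<le> B" using B power2_le_imp_le by blast
qed

lemma ell2_triangle:
  assumes "x \<in> ell2" "y \<in> ell2"
  shows "ell2_norm (\<lambda>k. x k + y k) \<le> ell2_norm x + ell2_norm y"
proof (rule ell2_norm_leI(2))
  fix n
  have "L2_set (\<lambda>k. cmod (x k + y k)) {..<n} \<le> L2_set (\<lambda>k. cmod (x k) + cmod (y k)) {..<n}"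
    by (intro L2_set_mono norm_triangle_ineq) auto
  also have "\<dots> \<le> L2_set (\<lambda>k. cmod (x k)) {..<n} + L2_set (\<lambda>k. cmod (y k)) {..<n}"
    by (rule L2_set_triangle_ineq)
  finally show "L2_set (\<lambda>k. cmod (x k + y k)) {..<n} \<le> ell2_norm x + ell2_norm y"
    using ell2_L2_set_le[OF assms(1), of n] ell2_L2_set_le[OF assms(2), of n] by linarith
qed

lemma ell2_Cauchy_Schwarz_abs:
  assumes "x \<in> ell2" "y \<in> ell2"
  shows "(\<Sum>k. cmod (x k) * cmod (y k)) \<le> ell2_norm x * ell2_norm y"
proof (rule suminf_le_const[OF ell2_mult_summable[OF assms]])
  fix n
  have "(\<Sum>k<n. cmod (x k) * cmod (y k)) = (\<Sum>k<n. \<bar>cmod (x k)\<bar> * \<bar>cmod (y k)\<bar>)" by simp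
  also have "\<dots> \<le> L2_set (\<lambda>k. cmod (x k)) {..<n} * L2_set (\<lambda>k. cmod (y k)) {..<n}"
    by (rule L2_set_mult_ineq)
  also have "\<dots> \<le> ell2_norm x * ell2_norm y"
    by (intro mult_mono ell2_L2_set_le assms ell2_norm_nonneg L2_set_nonneg)
  finally show "(\<Sum>k<n. cmod (x k) * cmod (y k)) \<le> ell2_norm x * ell2_norm y" .
qed

lemma ell2_Cauchy_Schwarz:
  assumes "x \<in> ell2" "y \<in> ell2"
  shows "cmod (\<Sum>k. x k * y k) \<le> ell2_norm x * ell2_norm y"
proof -
  have "cmod (\<Sum>k. x k * y k) \<le> (\<Sum>k. cmod (x k * y k))"
    by (rule summable_norm) (use ell2_mult_summable[OF assms] in \<open>simp add: norm_mult\<close>)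
  also have "\<dots> \<le> ell2_norm x * ell2_norm y"
    using ell2_Cauchy_Schwarz_abs[OF assms] by (simp add: norm_mult)
  finally show ?thesis .
qed

lemma ell2_inner_Cauchy_Schwarz:
  assumes "x \<in> ell2" "y \<in> ell2"
  shows "cmod (ell2_inner x y) \<le> ell2_norm x * ell2_norm y"
  using ell2_Cauchy_Schwarz[OF assms(1) ell2_cnj[OF assms(2)]]
  by (simp add: ell2_inner_def ell2_norm_cnj)

lemma ell2_coord_le: "x \<in> ell2 \<Longrightarrow> cmod (x k) \<le> ell2_norm x"
  using ell2_L2_set_le[of x "Suc k"] member_le_L2_set[of "{..<Suc k}" k "\<lambda>k. cmod (x k)"]
  by fastforce

lemma ell2_norm_eq_0: "x \<in> ell2 \<Longrightarrow> ell2_norm x = 0 \<Longrightarrow> x = (\<lambda>k. 0)"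
  using ell2_coord_le[of x] by fastforce

lemma ell2_inner_add_left:
  "x \<in> ell2 \<Longrightarrow> y \<in> ell2 \<Longrightarrow> z \<in> ell2 \<Longrightarrow>
    ell2_inner (\<lambda>k. x k + y k) z = ell2_inner x z + ell2_inner y z"
  by (simp add: ell2_inner_def ell2_inner_summable suminf_add distrib_right)

lemma ell2_inner_diff_left:
  "x \<in> ell2 \<Longrightarrow> y \<in> ell2 \<Longrightarrow> z \<in> ell2 \<Longrightarrow>
    ell2_inner (\<lambda>k. x k - y k) z = ell2_inner x z - ell2_inner y z"
  by (simp add: ell2_inner_def ell2_inner_summable suminf_diff left_diff_distrib)

lemma ell2_inner_scale_left:
  "x \<in> ell2 \<Longrightarrow> z \<in> ell2 \<Longrightarrow> ell2_inner (\<lambda>k. a * x k) z = a * ell2_inner x z"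
  by (simp add: ell2_inner_def ell2_inner_summable suminf_mult mult.assoc)

lemma ell2_inner_commute:
  assumes "x \<in> ell2" "y \<in> ell2"
  shows "ell2_inner y x = cnj (ell2_inner x y)"
proof -
  have "(\<lambda>k. cnj (x k * cnj (y k))) sums cnj (ell2_inner x y)"
    unfolding sums_cnj ell2_inner_def
    by (rule summable_sums[OF ell2_inner_summable[OF assms]])
  thus ?thesis by (simp add: ell2_inner_def sums_iff mult.commute)
qed

lemma ell2_inner_add_right:
  "x \<in> ell2 \<Longrightarrow> y \<in> ell2 \<Longrightarrow> z \<in> ell2 \<Longrightarrow>
    ell2_inner z (\<lambda>k. x k + y k) = ell2_inner z x + ell2_inner z y"
  by (simp add: ell2_inner_def ell2_inner_summable suminf_add distrib_left)

lemma ell2_inner_diff_right: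
  "x \<in> ell2 \<Longrightarrow> y \<in> ell2 \<Longrightarrow> z \<in> ell2 \<Longrightarrow>
    ell2_inner z (\<lambda>k. x k - y k) = ell2_inner z x - ell2_inner z y"
  by (simp add: ell2_inner_def ell2_inner_summable suminf_diff right_diff_distrib)

lemma ell2_inner_scale_right:
  "x \<in> ell2 \<Longrightarrow> z \<in> ell2 \<Longrightarrow> ell2_inner z (\<lambda>k. a * x k) = cnj a * ell2_inner z x"
  using suminf_mult[OF ell2_inner_summable[of z x], of "cnj a"]
  by (simp add: ell2_inner_def mult.left_commute)

lemma ell2_inner_delta_right: "ell2_inner x (delta n) = x n"
proof -
  have "(\<lambda>k. x k * cnj (delta n k)) = (\<lambda>k. if k = n then x k else 0)"
    by (auto simp: delta_def)
  thus ?thesis using sums_single[of n x] by (simp add: ell2_inner_def sums_iff)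
qed

lemma ell2_inner_delta_left: "ell2_inner (delta n) x = cnj (x n)"
proof -
  have "(\<lambda>k. delta n k * cnj (x k)) = (\<lambda>k. if k = n then cnj (x k) else 0)"
    by (auto simp: delta_def)
  thus ?thesis using sums_single[of n "\<lambda>k. cnj (x k)"] by (simp add: ell2_inner_def sums_iff)
qed

lemma ell2_inner_sum_left:
  "finite I \<Longrightarrow> (\<And>i. i \<in> I \<Longrightarrow> u i \<in> ell2) \<Longrightarrow> y \<in> ell2 \<Longrightarrow>
    ell2_inner (\<lambda>k. \<Sum>i\<in>I. u i k) y = (\<Sum>i\<in>I. ell2_inner (u i) y)"
proof (induction I rule: finite_induct)
  case empty
  thus ?case by (simp add: ell2_inner_def)
next
  case (insert i I)
  thus ?case using ell2_inner_add_left[of "u i" "\<lambda>k. \<Sum>i\<in>I. u i k" y] by (simp add: ell2_sum)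
qed

lemma ell2_norm_lincomb:
  assumes "x \<in> ell2" "y \<in> ell2"
  shows "(ell2_norm (\<lambda>k. x k - of_real t * y k))\<^sup>2 =
    (ell2_norm x)\<^sup>2 - 2 * t * Re (ell2_inner x y) + t\<^sup>2 * (ell2_norm y)\<^sup>2"
proof -
  have z: "(\<lambda>k. x k - of_real t * y k) \<in> ell2" "(\<lambda>k. of_real t * y k) \<in> ell2"
    using assms by (auto intro: ell2_diff ell2_scale)
  have "(ell2_norm (\<lambda>k. x k - of_real t * y k))\<^sup>2
      = Re (ell2_inner (\<lambda>k. x k - of_real t * y k) (\<lambda>k. x k - of_real t * y k))"
    by (simp add: ell2_inner_self z)
  also have "\<dots> = Re (ell2_inner x x - of_real t * cnj (ell2_inner x y)
      - (of_real t * ell2_inner x y - of_real t * (of_real t * ell2_inner y y)))"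
    using assms z
    by (simp only: ell2_inner_diff_left ell2_inner_diff_right ell2_inner_scale_left
        ell2_inner_scale_right ell2_inner_commute[of x y] complex_cnj_complex_of_real)
      (simp add: algebra_simps)
  also have "\<dots> = (ell2_norm x)\<^sup>2 - 2 * t * Re (ell2_inner x y) + t\<^sup>2 * (ell2_norm y)\<^sup>2"
    by (simp add: ell2_inner_self assms power2_eq_square)
  finally show ?thesis .
qed

text \<open>Expand the square of the norm of the difference between \<open>x\<close> and its projection onto the span.\<close>

lemma ell2_Bessel:
  assumes I: "finite I" and u: "\<And>i. i \<in> I \<Longrightarrow> u i \<in> ell2"
    and orth: "\<And>i j. i \<in> I \<Longrightarrow> j \<in> I \<Longrightarrow> ell2_inner (u i) (u j) = (if i = j then 1 else 0)"
    and x: "x \<in> ell2"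
  shows "(\<Sum>i\<in>I. (cmod (ell2_inner x (u i)))\<^sup>2) \<le> (ell2_norm x)\<^sup>2"
proof -
  define b where "b i = ell2_inner x (u i)" for i
  define p where "p = (\<lambda>k. \<Sum>i\<in>I. b i * u i k)"
  define S where "S = (\<Sum>i\<in>I. (cmod (b i))\<^sup>2)"
  have p: "p \<in> ell2" unfolding p_def by (intro ell2_sum ell2_scale u)
  have p_left: "ell2_inner p y = (\<Sum>i\<in>I. b i * ell2_inner (u i) y)" if "y \<in> ell2" for y
    unfolding p_def using I u that
    by (subst ell2_inner_sum_left) (auto simp: ell2_scale ell2_inner_scale_left intro!: sum.cong)
  have "ell2_inner p x = (\<Sum>i\<in>I. b i * cnj (b i))"
    unfolding p_left[OF x] by (intro sum.cong refl) (simp add: b_def ell2_inner_commute[OF x u])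
  also have "\<dots> = of_real S" by (simp only: S_def of_real_sum complex_norm_square)
  finally have px: "ell2_inner p x = of_real S" .
  have "ell2_inner p (u j) = b j" if j: "j \<in> I" for j
  proof -
    have "ell2_inner p (u j) = (\<Sum>i\<in>I. if i = j then b i else 0)"
      unfolding p_left[OF u[OF j]] by (intro sum.cong) (auto simp: orth j)
    thus ?thesis using I j by simp
  qed
  hence "ell2_inner (u j) p = cnj (b j)" if "j \<in> I" for j
    using ell2_inner_commute[OF p u[OF that]] that by simp
  hence "ell2_inner p p = (\<Sum>i\<in>I. b i * cnj (b i))"
    unfolding p_left[OF p] by (intro sum.cong) auto
  also have "\<dots> = of_real S" by (simp only: S_def of_real_sum complex_norm_square)
  finally have "complex_of_real ((ell2_norm p)\<^sup>2) = of_real S"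
    unfolding ell2_inner_self[OF p] .
  hence pp: "(ell2_norm p)\<^sup>2 = S" by (simp only: of_real_eq_iff)
  have "Re (ell2_inner x p) = S" using ell2_inner_commute[OF p x] px by simp
  hence "(ell2_norm (\<lambda>k. x k - of_real 1 * p k))\<^sup>2 = (ell2_norm x)\<^sup>2 - S"
    unfolding ell2_norm_lincomb[OF x p] pp by simp
  hence "0 \<le> (ell2_norm x)\<^sup>2 - S"
    using zero_le_power2[of "ell2_norm (\<lambda>k. x k - of_real 1 * p k)"] by (simp only:)
  thus ?thesis by (simp add: S_def b_def)
qed

subsection \<open>Convergence\<close>

lemma ell2_tendsto_coord:
  assumes "ell2_tendsto u x" "\<And>n. u n \<in> ell2" "x \<in> ell2"
  shows "(\<lambda>n. u n k) \<longlonglongrightarrow> x k"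
proof -
  have "(\<lambda>n. cmod (u n k - x k)) \<longlonglongrightarrow> 0"
  proof (rule Lim_null_comparison)
    show "\<forall>\<^sub>F n in sequentially. norm (cmod (u n k - x k)) \<le> ell2_norm (\<lambda>k. u n k - x k)"
      using ell2_coord_le[OF ell2_diff[OF assms(2,3)]] by simp
  qed (use assms(1) in \<open>simp add: ell2_tendsto_def\<close>)
  thus ?thesis using Lim_null tendsto_norm_zero_iff by blast
qed

lemma ell2_tendsto_unique:
  assumes "ell2_tendsto u x" "ell2_tendsto u y" "\<And>n. u n \<in> ell2" "x \<in> ell2" "y \<in> ell2"
  shows "x = y"
  using LIMSEQ_unique[OF ell2_tendsto_coord[OF assms(1,3,4)] ell2_tendsto_coord[OF assms(2,3,5)]]
  by auto

lemma ell2_tendsto_inner: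
  assumes u: "ell2_tendsto u x" "\<And>n. u n \<in> ell2" "x \<in> ell2"
    and v: "ell2_tendsto v y" "\<And>n. v n \<in> ell2" "y \<in> ell2"
  shows "(\<lambda>n. ell2_inner (u n) (v n)) \<longlonglongrightarrow> ell2_inner x y"
proof -
  define d e where "d n = ell2_norm (\<lambda>k. u n k - x k)" and "e n = ell2_norm (\<lambda>k. v n k - y k)" for n
  have d: "d \<longlonglongrightarrow> 0" and e: "e \<longlonglongrightarrow> 0"
    using u v by (simp_all add: d_def[abs_def] e_def[abs_def] ell2_tendsto_def)
  have le: "norm (ell2_inner (u n) (v n) - ell2_inner x y) \<le> d n * e n + d n * ell2_norm y + ell2_norm x * e n" for n
  proof -
    have "ell2_inner (u n) (v n) - ell2_inner x y
      = ell2_inner (\<lambda>k. u n k - x k) (\<lambda>k. v n k - y k) + ell2_inner (\<lambda>k. u n k - x k) y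
        + ell2_inner x (\<lambda>k. v n k - y k)"
      using u v by (simp add: ell2_inner_diff_left ell2_inner_diff_right ell2_diff)
    also have "norm \<dots> \<le> d n * e n + d n * ell2_norm y + ell2_norm x * e n"
      unfolding d_def e_def
      by (intro norm_triangle_le add_mono ell2_inner_Cauchy_Schwarz ell2_diff u v)
    finally show ?thesis .
  qed
  have lim: "(\<lambda>n. d n * e n + d n * ell2_norm y + ell2_norm x * e n) \<longlonglongrightarrow> 0 * 0 + 0 * ell2_norm y + ell2_norm x * 0"
    by (intro tendsto_intros d e)
  have "(\<lambda>n. ell2_inner (u n) (v n) - ell2_inner x y) \<longlonglongrightarrow> 0"
    by (rule Lim_null_comparison[OF always_eventually]) (use le lim in auto)
  thus ?thesis using Lim_null by blast
qed

lemma ell2_tendsto_const: "ell2_tendsto (\<lambda>n. x) x"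
  by (simp add: ell2_tendsto_def ell2_norm_zero)

lemma ell2_tendsto_norm:
  assumes u: "ell2_tendsto u x" "\<And>n. u n \<in> ell2" "x \<in> ell2"
  shows "(\<lambda>n. (ell2_norm (u n))\<^sup>2) \<longlonglongrightarrow> (ell2_norm x)\<^sup>2"
  using tendsto_Re[OF ell2_tendsto_inner[OF u u]] u
  by (simp add: ell2_inner_self)

text \<open>Dominated convergence. All strong limits of kernels below are obtained from it, since the kernels
  share one square summable bound.\<close>

lemma ell2_tendsto_dominated:
  assumes conv: "\<And>k. (\<lambda>n. u n k) \<longlonglongrightarrow> x k"
    and g: "g \<in> ell2" and bound: "\<And>n k. cmod (u n k) \<le> cmod (g k)"
  shows "x \<in> ell2" "ell2_tendsto u x"
proof -
  have x: "cmod (x k) \<le> cmod (g k)" for k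
    using LIMSEQ_le_const2[OF tendsto_norm[OF conv[of k]]] bound by blast
  show "x \<in> ell2" by (rule ell2_comparison[OF g x])
  have "(\<lambda>n. \<Sum>k. (cmod (u n k - x k))\<^sup>2) \<longlonglongrightarrow> (\<Sum>k. (0::real))"
  proof (rule tannerys_theorem[where M = "\<lambda>k. 4 * (cmod (g k))\<^sup>2", THEN conjunct2, THEN conjunct2])
    fix k
    have "(\<lambda>n. (cmod (u n k - x k))\<^sup>2) \<longlonglongrightarrow> (cmod (x k - x k))\<^sup>2"
      by (intro tendsto_intros conv)
    thus "(\<lambda>n. (cmod (u n k - x k))\<^sup>2) \<longlonglongrightarrow> 0" by simp
  next
    have "norm ((cmod (u n k - x k))\<^sup>2) \<le> 4 * (cmod (g k))\<^sup>2" for n k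
    proof -
      have "cmod (u n k - x k) \<le> 2 * cmod (g k)"
        using norm_triangle_ineq4[of "u n k" "x k"] bound[of n k] x[of k] by linarith
      hence "(cmod (u n k - x k))\<^sup>2 \<le> (2 * cmod (g k))\<^sup>2" by (rule power_mono) simp
      thus ?thesis by (simp add: power_mult_distrib)
    qed
    thus "\<forall>\<^sub>F (k, n) in at_top \<times>\<^sub>F sequentially. norm ((cmod (u n k - x k))\<^sup>2) \<le> 4 * (cmod (g k))\<^sup>2"
      by (intro always_eventually) auto
    show "summable (\<lambda>k. 4 * (cmod (g k))\<^sup>2)" using g by (simp add: ell2_def summable_mult)
  qed auto
  hence "(\<lambda>n. sqrt (\<Sum>k. (cmod (u n k - x k))\<^sup>2)) \<longlonglongrightarrow> sqrt 0"
    by (intro tendsto_real_sqrt) simp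
  thus "ell2_tendsto u x" by (simp add: ell2_tendsto_def ell2_norm_def)
qed

text \<open>Norms of initial segments pass to the pointwise limit.\<close>

lemma ell2_Fatou:
  assumes conv: "\<And>k. (\<lambda>n. u n k) \<longlonglongrightarrow> x k"
    and u: "\<And>n. u n \<in> ell2" and bound: "\<forall>\<^sub>F n in sequentially. ell2_norm (u n) \<le> B"
  shows "x \<in> ell2" "ell2_norm x \<le> B"
proof -
  have *: "L2_set (\<lambda>k. cmod (x k)) {..<m} \<le> B" for m
  proof (rule tendsto_upperbound)
    show "(\<lambda>n. L2_set (\<lambda>k. cmod (u n k)) {..<m}) \<longlonglongrightarrow> L2_set (\<lambda>k. cmod (x k)) {..<m}"
      unfolding L2_set_def by (intro tendsto_intros conv)
    show "\<forall>\<^sub>F n in sequentially. L2_set (\<lambda>k. cmod (u n k)) {..<m} \<le> B"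
      using bound by eventually_elim (rule order_trans[OF ell2_L2_set_le[OF u]])
  qed simp
  show "x \<in> ell2" "ell2_norm x \<le> B" using ell2_norm_leI[OF *] .
qed

text \<open>On bounded sets, coordinatewise convergence is weak convergence: cut \<open>y\<close> into an initial segment,
  where finitely many coordinates converge, and a tail of small norm.\<close>

lemma ell2_weak:
  assumes conv: "\<And>k. (\<lambda>n. u n k) \<longlonglongrightarrow> x k"
    and u: "\<And>n. u n \<in> ell2" and bound: "\<And>n. ell2_norm (u n) \<le> B" and y: "y \<in> ell2"
  shows "(\<lambda>n. \<Sum>k. u n k * y k) \<longlonglongrightarrow> (\<Sum>k. x k * y k)"
proof -
  have x: "x \<in> ell2" "ell2_norm x \<le> B" using ell2_Fatou[OF conv u, of B] bound by auto
  have B: "0 \<le> B" using ell2_norm_nonneg[OF u[of 0]] bound[of 0] by linarith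
  define c where "c m = (\<lambda>k. if k < m then y k else 0)" for m
  define r where "r m = (\<lambda>k. if k < m then 0 else y k)" for m
  have ry: "cmod (r m k) \<le> cmod (y k)" for m k by (simp add: r_def)
  have rc: "(\<lambda>m. r m k) \<longlonglongrightarrow> 0" for k
    by (rule tendsto_eventually) (use eventually_gt_at_top[of k] in \<open>eventually_elim, simp add: r_def\<close>)
  have r: "r m \<in> ell2" for m by (rule ell2_comparison[OF y ry])
  have rn: "(\<lambda>m. ell2_norm (r m)) \<longlonglongrightarrow> 0"
    using ell2_tendsto_dominated(2)[OF rc y ry] by (simp add: ell2_tendsto_def)
  have "(\<lambda>n. \<Sum>k. (u n k - x k) * y k) \<longlonglongrightarrow> 0"
  proof (rule tendstoI)
    fix e :: real assume e: "e > 0"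
    have "(\<lambda>m. 2 * B * ell2_norm (r m)) \<longlonglongrightarrow> 2 * B * 0" by (intro tendsto_intros rn)
    from order_tendstoD(2)[OF this, of "e / 2"] e
    obtain m where m: "2 * B * ell2_norm (r m) < e / 2"
      by (auto simp: eventually_sequentially)
    have "(\<lambda>n. \<Sum>k<m. (u n k - x k) * y k) \<longlonglongrightarrow> (\<Sum>k<m. (x k - x k) * y k)"
      by (intro tendsto_intros conv)
    hence "(\<lambda>n. \<Sum>k<m. (u n k - x k) * y k) \<longlonglongrightarrow> 0" by simp
    from tendstoD[OF this, of "e / 2"] e
    have "\<forall>\<^sub>F n in sequentially. cmod (\<Sum>k<m. (u n k - x k) * y k) < e / 2" by simp
    thus "\<forall>\<^sub>F n in sequentially. dist (\<Sum>k. (u n k - x k) * y k) 0 < e"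
    proof eventually_elim
      case (elim n)
      have d: "(\<lambda>k. u n k - x k) \<in> ell2" by (rule ell2_diff[OF u x(1)])
      have "ell2_norm (\<lambda>k. u n k - x k) \<le> ell2_norm (u n) + ell2_norm x"
        using ell2_triangle[OF u[of n] ell2_scale[OF x(1), of "-1"]] ell2_norm_scale[OF x(1), of "-1"]
        by simp
      hence dn: "ell2_norm (\<lambda>k. u n k - x k) \<le> 2 * B" using bound[of n] x(2) by linarith
      have "(\<lambda>k. (u n k - x k) * y k) = (\<lambda>k. (if k \<in> {..<m} then (u n k - x k) * y k else 0) + (u n k - x k) * r m k)"
        by (auto simp: r_def)
      hence "(\<Sum>k. (u n k - x k) * y k) = (\<Sum>k. (if k \<in> {..<m} then (u n k - x k) * y k else 0)) + (\<Sum>k. (u n k - x k) * r m k)"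
        using suminf_add[OF summable_If_finite_set[of "{..<m}" "\<lambda>k. (u n k - x k) * y k"] ell2_prod_summable[OF d r]]
        by simp
      also have "(\<Sum>k. (if k \<in> {..<m} then (u n k - x k) * y k else 0)) = (\<Sum>k<m. (u n k - x k) * y k)"
        using sums_If_finite_set[of "{..<m}" "\<lambda>k. (u n k - x k) * y k"] by (simp add: sums_iff)
      finally have "cmod (\<Sum>k. (u n k - x k) * y k) \<le> cmod (\<Sum>k<m. (u n k - x k) * y k) + cmod (\<Sum>k. (u n k - x k) * r m k)"
        by (simp add: norm_triangle_ineq)
      also have "cmod (\<Sum>k. (u n k - x k) * r m k) \<le> ell2_norm (\<lambda>k. u n k - x k) * ell2_norm (r m)"
        by (rule ell2_Cauchy_Schwarz[OF d r])
      also have "\<dots> \<le> 2 * B * ell2_norm (r m)"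
        by (intro mult_right_mono dn ell2_norm_nonneg r)
      finally show ?case using elim m by simp
    qed
  qed
  moreover have "(\<Sum>k. (u n k - x k) * y k) = (\<Sum>k. u n k * y k) - (\<Sum>k. x k * y k)" for n
    by (simp add: left_diff_distrib suminf_diff ell2_prod_summable u x y)
  ultimately show ?thesis by (simp add: LIM_zero_iff)
qed

section \<open>Orthonormal bases and diagonal operators\<close>

locale orthonormal_basis =
  fixes e :: "nat \<Rightarrow> vec"
  assumes basis_ell2: "e n \<in> ell2"
    and orthonormal: "ell2_inner (e m) (e n) = (if m = n then 1 else 0)"
    and complete: "x \<in> ell2 \<Longrightarrow> (\<And>n. ell2_inner x (e n) = 0) \<Longrightarrow> x = (\<lambda>k. 0)"
begin

definition coeff :: "vec \<Rightarrow> vec" where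
  "coeff x = (\<lambda>n. ell2_inner x (e n))"

definition synth :: "vec \<Rightarrow> vec" where
  "synth f = (\<lambda>k. \<Sum>n. f n * e n k)"

definition partial :: "vec \<Rightarrow> nat \<Rightarrow> vec" where
  "partial f N = (\<lambda>k. \<Sum>n<N. f n * e n k)"

lemma partial_ell2: "partial f N \<in> ell2"
  unfolding partial_def by (intro ell2_sum ell2_scale basis_ell2)

lemma coeff_partial: "coeff (partial f N) n = (if n < N then f n else 0)"
proof -
  have "coeff (partial f N) n = (\<Sum>m<N. f m * ell2_inner (e m) (e n))"
    unfolding coeff_def partial_def
    by (subst ell2_inner_sum_left)
       (auto simp: ell2_scale basis_ell2 ell2_inner_scale_left)
  also have "\<dots> = (\<Sum>m<N. if m = n then f m else 0)"
    by (intro sum.cong) (auto simp: orthonormal)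
  finally show ?thesis by simp
qed

lemma inner_partial_left:
  assumes "y \<in> ell2"
  shows "ell2_inner (partial f N) y = (\<Sum>n<N. f n * cnj (coeff y n))"
  unfolding partial_def coeff_def
  by (subst ell2_inner_sum_left)
     (auto simp: ell2_scale basis_ell2 ell2_inner_scale_left assms intro!: sum.cong
       ell2_inner_commute)

text \<open>The Pythagorean theorem; it makes the partial sums of an expansion with square summable coefficients
  a Cauchy sequence.\<close>

lemma norm_partial_diff:
  assumes "N \<le> M"
  shows "(ell2_norm (\<lambda>k. partial f M k - partial f N k))\<^sup>2 = (\<Sum>n=N..<M. (cmod (f n))\<^sup>2)"
proof -
  define g where "g n = (if N \<le> n then f n else 0)" for n
  have "(\<lambda>k. partial f M k - partial f N k) = partial g M"
  proof
    fix k
    have "partial f M k = partial f N k + (\<Sum>n=N..<M. f n * e n k)"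
      unfolding partial_def lessThan_atLeast0
      using sum.atLeastLessThan_concat[of 0 N M "\<lambda>n. f n * e n k"] assms by simp
    moreover have "partial g M k = (\<Sum>n=N..<M. f n * e n k)"
      unfolding partial_def g_def by (intro sum.mono_neutral_cong_right) auto
    ultimately show "partial f M k - partial f N k = partial g M k" by simp
  qed
  moreover have "complex_of_real ((ell2_norm (partial g M))\<^sup>2) = of_real (\<Sum>n=N..<M. (cmod (f n))\<^sup>2)"
  proof -
    have "ell2_inner (partial g M) (partial g M) = (\<Sum>n<M. g n * cnj (g n))"
      by (subst inner_partial_left[OF partial_ell2]) (simp add: coeff_partial)
    also have "\<dots> = (\<Sum>n=N..<M. f n * cnj (f n))"
      unfolding g_def by (intro sum.mono_neutral_cong_right) auto
    finally show ?thesis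
      by (simp only: ell2_inner_self[OF partial_ell2] of_real_sum complex_norm_square)
  qed
  ultimately show ?thesis using of_real_eq_iff by metis
qed

lemma Bessel:
  assumes x: "x \<in> ell2"
  shows "coeff x \<in> ell2"
proof -
  have "(\<Sum>n<N. (cmod (coeff x n))\<^sup>2) \<le> (ell2_norm x)\<^sup>2" for N
    unfolding coeff_def by (rule ell2_Bessel) (auto simp: basis_ell2 orthonormal x)
  thus ?thesis unfolding ell2_def mem_Collect_eq by (intro summableI_nonneg_bounded) auto
qed

text \<open>Bessel's inequality for a standard basis vector; it makes the series defining \<open>synth\<close> converge
  in each coordinate.\<close>

lemma basis_coord_ell2: "(\<lambda>n. e n k) \<in> ell2"
  using ell2_cnj[OF Bessel[OF ell2_delta[of k]]] by (simp add: coeff_def ell2_inner_delta_left)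

lemma partial_tendsto_coord:
  assumes "f \<in> ell2"
  shows "(\<lambda>N. partial f N k) \<longlonglongrightarrow> synth f k"
  unfolding partial_def synth_def
  by (rule summable_LIMSEQ[OF ell2_prod_summable[OF assms basis_coord_ell2]])

text \<open>Riesz-Fischer. The coordinatewise sum exists, and the norm of its distance to a partial sum is
  bounded by the tail of the coefficients through Fatou's lemma.\<close>

lemma synth_ell2_tendsto:
  assumes f: "f \<in> ell2"
  shows "synth f \<in> ell2" "ell2_tendsto (partial f) (synth f)"
proof -
  define tl where "tl N = sqrt (\<Sum>n. (cmod (f (n + N)))\<^sup>2)" for N
  have sm: "summable (\<lambda>n. (cmod (f (n + N)))\<^sup>2)" for N
    by (rule summable_ignore_initial_segment[OF ell2_summable[OF f]])
  have tail: "ell2_norm (\<lambda>k. partial f M k - partial f N k) \<le> tl N" if "N \<le> M" for N M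
  proof -
    have "(\<Sum>n=N..<M. (cmod (f n))\<^sup>2) = (\<Sum>n<M-N. (cmod (f (n + N)))\<^sup>2)"
      using sum.shift_bounds_nat_ivl[of "\<lambda>n. (cmod (f n))\<^sup>2" 0 N "M-N"] that
      by (simp add: lessThan_atLeast0)
    also have "\<dots> \<le> (\<Sum>n. (cmod (f (n + N)))\<^sup>2)" by (rule sum_le_suminf[OF sm]) auto
    finally have "(ell2_norm (\<lambda>k. partial f M k - partial f N k))\<^sup>2 \<le> (\<Sum>n. (cmod (f (n + N)))\<^sup>2)"
      using norm_partial_diff[OF that, of f] by simp
    thus ?thesis unfolding tl_def by (rule real_le_rsqrt)
  qed
  have F: "(\<lambda>k. synth f k - partial f N k) \<in> ell2"
    "ell2_norm (\<lambda>k. synth f k - partial f N k) \<le> tl N" for N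
  proof -
    have c: "(\<lambda>M. partial f M k - partial f N k) \<longlonglongrightarrow> synth f k - partial f N k" for k
      by (intro tendsto_intros partial_tendsto_coord f)
    have b: "\<forall>\<^sub>F M in sequentially. ell2_norm (\<lambda>k. partial f M k - partial f N k) \<le> tl N"
      using eventually_ge_at_top[of N] by eventually_elim (rule tail)
    show "(\<lambda>k. synth f k - partial f N k) \<in> ell2"
      "ell2_norm (\<lambda>k. synth f k - partial f N k) \<le> tl N"
      using ell2_Fatou[OF c ell2_diff[OF partial_ell2 partial_ell2] b] .
  qed
  show "synth f \<in> ell2" using F(1)[of 0] by (simp add: partial_def)
  have "(\<lambda>N. \<Sum>n. (cmod (f (n + N)))\<^sup>2) \<longlonglongrightarrow> 0"
    using suminf_exist_split2[OF ell2_summable[OF f]] by simp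
  hence "tl \<longlonglongrightarrow> sqrt 0" unfolding tl_def by (rule tendsto_real_sqrt)
  hence t: "tl \<longlonglongrightarrow> 0" by simp
  show "ell2_tendsto (partial f) (synth f)"
    unfolding ell2_tendsto_def
  proof (rule Lim_null_comparison[OF always_eventually t], intro allI)
    fix N
    show "norm (ell2_norm (\<lambda>k. partial f N k - synth f k)) \<le> tl N"
      using F[of N] ell2_norm_minus[of "partial f N" "synth f"] ell2_norm_nonneg[OF F(1)[of N]] by simp
  qed
qed

lemma inner_synth_left:
  assumes f: "f \<in> ell2" and y: "y \<in> ell2"
  shows "ell2_inner (synth f) y = ell2_inner f (coeff y)"
proof (rule LIMSEQ_unique)
  show "(\<lambda>N. ell2_inner (partial f N) y) \<longlonglongrightarrow> ell2_inner (synth f) y"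
    by (intro ell2_tendsto_inner synth_ell2_tendsto f partial_ell2 ell2_tendsto_const y)
  show "(\<lambda>N. ell2_inner (partial f N) y) \<longlonglongrightarrow> ell2_inner f (coeff y)"
    unfolding inner_partial_left[OF y] unfolding ell2_inner_def
    by (rule summable_LIMSEQ[OF ell2_inner_summable[OF f Bessel[OF y]]])
qed

lemma coeff_basis: "coeff (e n) = delta n"
  by (auto simp: coeff_def orthonormal delta_def)

lemma coeff_synth:
  assumes "f \<in> ell2"
  shows "coeff (synth f) = f"
  using inner_synth_left[OF assms basis_ell2]
  by (auto simp: coeff_def coeff_basis[unfolded coeff_def] ell2_inner_delta_right)

lemma coeff_diff: "x \<in> ell2 \<Longrightarrow> y \<in> ell2 \<Longrightarrow> coeff (\<lambda>k. x k - y k) = (\<lambda>n. coeff x n - coeff y n)"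
  by (simp add: coeff_def ell2_inner_diff_left basis_ell2)

lemma coeff_lincomb:
  "x \<in> ell2 \<Longrightarrow> y \<in> ell2 \<Longrightarrow> coeff (\<lambda>k. a * x k + b * y k) = (\<lambda>n. a * coeff x n + b * coeff y n)"
  by (simp add: coeff_def ell2_inner_add_left ell2_inner_scale_left ell2_scale basis_ell2)

text \<open>Vectors are determined by their coefficients. Identities between operators that are diagonal in the
  basis are checked through this fact.\<close>

lemma coeff_eqD:
  assumes "x \<in> ell2" "y \<in> ell2" "coeff x = coeff y"
  shows "x = y"
proof -
  have "coeff (\<lambda>k. x k - y k) n = 0" for n
    using assms by (simp add: coeff_diff)
  hence "(\<lambda>k. x k - y k) = (\<lambda>k. 0)"
    by (intro complete ell2_diff assms) (simp add: coeff_def)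
  thus ?thesis by (simp add: fun_eq_iff)
qed

lemma synth_coeff: "x \<in> ell2 \<Longrightarrow> synth (coeff x) = x"
  by (rule coeff_eqD) (auto simp: coeff_synth synth_ell2_tendsto Bessel)

lemma Parseval:
  assumes "x \<in> ell2" "y \<in> ell2"
  shows "ell2_inner x y = ell2_inner (coeff x) (coeff y)"
  using inner_synth_left[OF Bessel[OF assms(1)] assms(2)] by (simp add: synth_coeff assms)

lemma Parseval_norm:
  assumes "x \<in> ell2"
  shows "ell2_norm x = ell2_norm (coeff x)"
proof -
  have "complex_of_real ((ell2_norm x)\<^sup>2) = of_real ((ell2_norm (coeff x))\<^sup>2)"
    using Parseval[OF assms assms] by (simp add: ell2_inner_self assms Bessel)
  hence "(ell2_norm x)\<^sup>2 = (ell2_norm (coeff x))\<^sup>2" using of_real_eq_iff by blast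
  thus ?thesis by (simp add: ell2_norm_nonneg assms Bessel)
qed

end

text \<open>The operator that multiplies the \<open>n\<close>-th coefficient by \<open>eigval n\<close>. Its spectral projections \<open>proj\<close> keep
  the coefficients whose eigenvalue lies in the given set, and \<open>spec x\<close> is the distribution of
  \<open>x\<close>: mass \<open>\<bar>coeff x n\<bar>\<^sup>2\<close> at \<open>eigval n\<close>.\<close>

locale diagonal_operator = orthonormal_basis +
  fixes eigval :: "nat \<Rightarrow> real"
begin

definition proj :: "real set \<Rightarrow> vec \<Rightarrow> vec" where
  "proj A x = synth (\<lambda>n. if eigval n \<in> A then coeff x n else 0)"

definition spec :: "vec \<Rightarrow> real measure" where
  "spec x = distr (density (count_space UNIV) (\<lambda>n. ennreal ((cmod (coeff x n))\<^sup>2))) borel eigval"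

lemma space_spec [simp]: "space (spec x) = UNIV"
  and sets_spec [simp]: "sets (spec x) = sets borel"
  by (simp_all add: spec_def)

lemma cut_ell2: "f \<in> ell2 \<Longrightarrow> (\<lambda>n. if eigval n \<in> A then f n else 0) \<in> ell2"
  by (erule ell2_comparison) simp

lemma proj_ell2: "x \<in> ell2 \<Longrightarrow> proj A x \<in> ell2"
  unfolding proj_def by (intro synth_ell2_tendsto cut_ell2 Bessel)

lemma coeff_proj: "x \<in> ell2 \<Longrightarrow> coeff (proj A x) = (\<lambda>n. if eigval n \<in> A then coeff x n else 0)"
  unfolding proj_def by (intro coeff_synth cut_ell2 Bessel)

lemma orthogonal_projection_proj: "orthogonal_projection (proj A)"
  unfolding orthogonal_projection_def
proof (intro conjI ballI allI)
  fix x y assume x: "x \<in> ell2" and y: "y \<in> ell2"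
  show "proj A x \<in> ell2" using x by (rule proj_ell2)
  show "proj A (proj A x) = proj A x"
    by (rule coeff_eqD) (auto simp: proj_ell2 x coeff_proj)
  show "proj A (\<lambda>k. a * x k + b * y k) = (\<lambda>k. a * proj A x k + b * proj A y k)" for a b
    by (rule coeff_eqD) (auto simp: proj_ell2 x y coeff_proj ell2_lincomb coeff_lincomb)
  show "ell2_inner (proj A x) y = ell2_inner x (proj A y)"
    unfolding Parseval[OF proj_ell2[OF x] y] Parseval[OF x proj_ell2[OF y]] coeff_proj[OF x]
      coeff_proj[OF y]
    unfolding ell2_inner_def
    by (intro suminf_cong) auto
qed

lemma emeasure_spec:
  assumes "A \<in> sets borel"
  shows "emeasure (spec x) A = (\<Sum>n. ennreal (if eigval n \<in> A then (cmod (coeff x n))\<^sup>2 else 0))"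
proof -
  have "emeasure (spec x) A = (\<integral>\<^sup>+ n. ennreal ((cmod (coeff x n))\<^sup>2) * indicator (eigval -` A) n \<partial>count_space UNIV)"
    using assms by (simp add: spec_def emeasure_distr emeasure_density)
  also have "\<dots> = (\<Sum>n. ennreal ((cmod (coeff x n))\<^sup>2) * indicator (eigval -` A) n)"
    by (rule nn_integral_count_space_nat)
  also have "\<dots> = (\<Sum>n. ennreal (if eigval n \<in> A then (cmod (coeff x n))\<^sup>2 else 0))"
    by (intro suminf_cong) (auto simp: indicator_def)
  finally show ?thesis .
qed

lemma inner_proj_self:
  assumes x: "x \<in> ell2"
  shows "ell2_inner (proj A x) x = of_real (\<Sum>n. if eigval n \<in> A then (cmod (coeff x n))\<^sup>2 else 0)"
proof -
  have s: "summable (\<lambda>n. if eigval n \<in> A then (cmod (coeff x n))\<^sup>2 else 0)"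
    using ell2_summable[OF cut_ell2[OF Bessel[OF x], of A]]
    by (rule back_subst[of summable]) auto
  show ?thesis
    unfolding Parseval[OF proj_ell2[OF x] x] coeff_proj[OF x] 
    unfolding ell2_inner_def suminf_of_real[OF s]
    by (intro suminf_cong) (auto simp: complex_norm_square simp del: of_real_power)
qed

lemma emeasure_spec_proj:
  assumes x: "x \<in> ell2" and A: "A \<in> sets borel"
  shows "emeasure (spec x) A = ennreal (Re (ell2_inner (proj A x) x))"
proof -
  have s: "summable (\<lambda>n. if eigval n \<in> A then (cmod (coeff x n))\<^sup>2 else 0)"
    using ell2_summable[OF cut_ell2[OF Bessel[OF x], of A]]
    by (rule back_subst[of summable]) auto
  show ?thesis
    unfolding emeasure_spec[OF A] inner_proj_self[OF x] Re_complex_of_real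
    by (rule suminf_ennreal2[OF _ s]) auto
qed

text \<open>Relates the spectral distribution, defined by extending a set function, to the push-forward of a
  weighted counting measure, for which the integration theory is available.\<close>

lemma spectral_distribution_proj:
  assumes x: "x \<in> ell2"
  shows "spectral_distribution proj x = spec x"
proof -
  have "spectral_distribution proj x = measure_of UNIV (sets borel) (emeasure (spec x))"
    unfolding spectral_distribution_def
    by (rule measure_of_eq) (auto simp: emeasure_spec_proj[OF x] sets.sigma_sets_eq[of borel, simplified])
  also have "\<dots> = spec x"
    using measure_of_of_measure[of "spec x"] by simp
  finally show ?thesis .
qed

lemma norm_proj:
  assumes x: "x \<in> ell2"
  shows "(ell2_norm (proj A x))\<^sup>2 = (\<Sum>n. if eigval n \<in> A then (cmod (coeff x n))\<^sup>2 else 0)"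
  unfolding Parseval_norm[OF proj_ell2[OF x]] ell2_norm_power2[OF Bessel[OF proj_ell2[OF x]]]
  by (auto simp: coeff_proj x intro!: suminf_cong)

text \<open>Countable additivity in the strong topology comes from continuity from above of the finite measure
  \<open>spec x\<close>: the squared norm of the remainder is the measure of the sets not yet covered.\<close>

lemma projection_valued_measure_proj: "projection_valued_measure proj"
  unfolding projection_valued_measure_def
proof (intro conjI ballI allI impI)
  show "orthogonal_projection (proj A)" for A by (rule orthogonal_projection_proj)
  show "proj UNIV x = x" if "x \<in> ell2" for x
    using that by (simp add: proj_def synth_coeff)
  fix A :: "nat \<Rightarrow> real set" and x
  assume "range A \<subseteq> sets borel \<and> disjoint_family A" and x: "x \<in> ell2"
  hence A: "range A \<subseteq> sets borel" and dis: "disjoint_family A" by auto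
  interpret finite_measure "spec x"
    by standard (simp add: emeasure_spec_proj[OF x])
  define s where "s n = (\<lambda>k. \<Sum>j<n. proj (A j) x k)" for n
  have s: "s n = proj (\<Union>j<n. A j) x" for n
  proof (rule coeff_eqD)
    show "s n \<in> ell2" "proj (\<Union>j<n. A j) x \<in> ell2"
      unfolding s_def by (intro ell2_sum proj_ell2 x)+
    show "coeff (s n) = coeff (proj (\<Union>j<n. A j) x)"
    proof
      fix m
      have "coeff (s n) m = (\<Sum>j<n. coeff (proj (A j) x) m)"
        unfolding coeff_def s_def by (intro ell2_inner_sum_left proj_ell2 x basis_ell2) auto
      also have "\<dots> = (\<Sum>j<n. if eigval m \<in> A j then coeff x m else 0)"
        by (simp add: coeff_proj x)
      also have "\<dots> = (if eigval m \<in> (\<Union>j<n. A j) then coeff x m else 0)"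
      proof (cases "eigval m \<in> (\<Union>j<n. A j)")
        case True
        then obtain i where i: "i < n" "eigval m \<in> A i" by blast
        have "eigval m \<in> A j \<longleftrightarrow> j = i" for j
          using i dis by (auto simp: disjoint_family_on_def)
        thus ?thesis using i True by simp
      qed auto
      also have "\<dots> = coeff (proj (\<Union>j<n. A j) x) m" by (simp add: coeff_proj x)
      finally show "coeff (s n) m = coeff (proj (\<Union>j<n. A j) x) m" .
    qed
  qed
  let ?R = "\<lambda>n. (\<Union>j. A j) - (\<Union>j<n. A j)"
  have R: "?R n \<in> sets borel" for n using A by auto
  have d: "(\<lambda>k. s n k - proj (\<Union>j. A j) x k) = (\<lambda>k. - 1 * proj (?R n) x k)" for n
  proof (rule coeff_eqD)
    show "(\<lambda>k. s n k - proj (\<Union>j. A j) x k) \<in> ell2"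
      unfolding s by (intro ell2_diff proj_ell2 x)
    show "(\<lambda>k. - 1 * proj (?R n) x k) \<in> ell2"
      by (rule ell2_scale[OF proj_ell2[OF x]])
    have "coeff (\<lambda>k. - 1 * proj (?R n) x k) = (\<lambda>m. - coeff (proj (?R n) x) m)"
      using coeff_lincomb[OF proj_ell2[OF x] ell2_zero, of "-1" "?R n" 0] by simp
    thus "coeff (\<lambda>k. s n k - proj (\<Union>j. A j) x k) = coeff (\<lambda>k. - 1 * proj (?R n) x k)"
      unfolding s by (auto simp: coeff_diff proj_ell2 x coeff_proj)
  qed
  have nrm: "(ell2_norm (\<lambda>k. s n k - proj (\<Union>j. A j) x k))\<^sup>2 = measure (spec x) (?R n)" for n
  proof -
    have "Re (ell2_inner (proj (?R n) x) x) = (ell2_norm (proj (?R n) x))\<^sup>2"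
      unfolding norm_proj[OF x] inner_proj_self[OF x] by (rule Re_complex_of_real)
    hence "measure (spec x) (?R n) = (ell2_norm (proj (?R n) x))\<^sup>2"
      unfolding measure_def emeasure_spec_proj[OF x R] by simp
    thus ?thesis
      unfolding d by (subst ell2_norm_scale[OF proj_ell2[OF x]]) simp
  qed
  have "(\<lambda>n. measure (spec x) (?R n)) \<longlonglongrightarrow> measure (spec x) (\<Inter>n. ?R n)"
    by (rule finite_Lim_measure_decseq) (use R in \<open>auto simp: decseq_def\<close>)
  moreover have inter: "(\<Inter>n. ?R n) = {}" by auto
  ultimately have "(\<lambda>n. measure (spec x) (?R n)) \<longlonglongrightarrow> 0"
    unfolding inter by simp
  hence "(\<lambda>n. (ell2_norm (\<lambda>k. s n k - proj (\<Union>j. A j) x k))\<^sup>2) \<longlonglongrightarrow> 0"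
    unfolding nrm .
  hence "(\<lambda>n. sqrt ((ell2_norm (\<lambda>k. s n k - proj (\<Union>j. A j) x k))\<^sup>2)) \<longlonglongrightarrow> sqrt 0"
    by (rule tendsto_real_sqrt)
  moreover have "0 \<le> ell2_norm (\<lambda>k. s n k - proj (\<Union>j. A j) x k)" for n
    unfolding s by (intro ell2_norm_nonneg ell2_diff proj_ell2 x)
  ultimately show "ell2_tendsto (\<lambda>n k. \<Sum>j<n. proj (A j) x k) (proj (\<Union>j. A j) x)"
    by (simp add: ell2_tendsto_def s_def)
qed

lemma integrable_spec_iff:
  assumes "f \<in> borel_measurable borel"
  shows "integrable (spec x) f \<longleftrightarrow> summable (\<lambda>n. (cmod (coeff x n))\<^sup>2 * \<bar>f (eigval n)\<bar>)"
  using assms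
  by (simp add: spec_def integrable_distr_eq integrable_density integrable_count_space_nat_iff abs_mult)

lemma integral_spec:
  fixes f :: "real \<Rightarrow> real"
  assumes f: "f \<in> borel_measurable borel" and i: "integrable (spec x) f"
  shows "(\<integral>t. f t \<partial>spec x) = (\<Sum>n. (cmod (coeff x n))\<^sup>2 * f (eigval n))"
proof -
  have "(\<integral>t. f t \<partial>spec x) = (\<integral>n. (cmod (coeff x n))\<^sup>2 * f (eigval n) \<partial>count_space UNIV)"
    using f by (simp add: spec_def integral_distr integral_density)
  also have "\<dots> = (\<Sum>n. (cmod (coeff x n))\<^sup>2 * f (eigval n))"
    by (rule integral_count_space_nat)
       (use i in \<open>simp add: integrable_spec_iff[OF f] integrable_count_space_nat_iff abs_mult\<close>)
  finally show ?thesis .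
qed

text \<open>The domain condition is square summability of the coefficients of the image, which by Riesz-Fischer
  suffices for the image to exist.\<close>

lemma spectral_measure_proj:
  assumes T: "\<And>x y. (x, y) \<in> T \<longleftrightarrow> x \<in> ell2 \<and> y \<in> ell2 \<and> coeff y = (\<lambda>n. of_real (eigval n) * coeff x n)"
  shows "spectral_measure T proj"
  unfolding spectral_measure_def
proof (intro conjI)
  show "projection_valued_measure proj" by (rule projection_valued_measure_proj)
  have int: "integrable (spectral_distribution proj x) (\<lambda>t. t\<^sup>2)
      \<longleftrightarrow> (\<lambda>n. of_real (eigval n) * coeff x n) \<in> ell2" if "x \<in> ell2" for x
    unfolding spectral_distribution_proj[OF that] ell2_def mem_Collect_eq
    by (subst integrable_spec_iff) (simp_all add: norm_mult power_mult_distrib mult.commute)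
  show "Domain T = {x \<in> ell2. integrable (spectral_distribution proj x) (\<lambda>t. t\<^sup>2)}"
  proof (intro equalityI subsetI)
    fix x assume "x \<in> Domain T"
    then obtain y where "(x, y) \<in> T" by blast
    hence x: "x \<in> ell2" "y \<in> ell2" "coeff y = (\<lambda>n. of_real (eigval n) * coeff x n)" by (auto simp: T)
    hence "(\<lambda>n. of_real (eigval n) * coeff x n) \<in> ell2" using Bessel[OF x(2)] by simp
    thus "x \<in> {x \<in> ell2. integrable (spectral_distribution proj x) (\<lambda>t. t\<^sup>2)}"
      using x int by simp
  next
    fix x assume "x \<in> {x \<in> ell2. integrable (spectral_distribution proj x) (\<lambda>t. t\<^sup>2)}"
    hence x: "x \<in> ell2" and f: "(\<lambda>n. of_real (eigval n) * coeff x n) \<in> ell2" using int by auto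
    have "(x, synth (\<lambda>n. of_real (eigval n) * coeff x n)) \<in> T"
      using x synth_ell2_tendsto(1)[OF f] coeff_synth[OF f] by (simp add: T)
    thus "x \<in> Domain T" by blast
  qed
  have "ell2_inner y x = complex_of_real (\<integral>t. t \<partial>spectral_distribution proj x)" if "(x, y) \<in> T" for x y
  proof -
    have x: "x \<in> ell2" and y: "y \<in> ell2" and c: "coeff y = (\<lambda>n. of_real (eigval n) * coeff x n)"
      using that by (auto simp: T)
    have s: "summable (\<lambda>n. (cmod (coeff x n))\<^sup>2 * eigval n)"
    proof (rule summable_norm_cancel)
      have "(\<lambda>n. norm ((cmod (coeff x n))\<^sup>2 * eigval n)) = (\<lambda>n. cmod (coeff y n) * cmod (coeff x n))"
        by (auto simp: c norm_mult abs_mult power2_eq_square)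
      thus "summable (\<lambda>n. norm ((cmod (coeff x n))\<^sup>2 * eigval n))"
        using ell2_mult_summable[OF Bessel[OF y] Bessel[OF x]] by simp
    qed
    have i: "integrable (spec x) (\<lambda>t. t)"
    proof (subst integrable_spec_iff)
      have "(\<lambda>n. (cmod (coeff x n))\<^sup>2 * \<bar>eigval n\<bar>) = (\<lambda>n. cmod (coeff y n) * cmod (coeff x n))"
        by (auto simp: c norm_mult power2_eq_square)
      thus "summable (\<lambda>n. (cmod (coeff x n))\<^sup>2 * \<bar>eigval n\<bar>)"
        using ell2_mult_summable[OF Bessel[OF y] Bessel[OF x]] by simp
    qed simp
    have "ell2_inner y x = (\<Sum>n. complex_of_real ((cmod (coeff x n))\<^sup>2 * eigval n))"
      unfolding Parseval[OF y x] c
      unfolding ell2_inner_def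
      by (intro suminf_cong) (simp only: of_real_mult complex_norm_square mult_ac)
    also have "\<dots> = complex_of_real (\<integral>t. t \<partial>spec x)"
      by (subst integral_spec[OF _ i]) (simp_all add: suminf_of_real[OF s, symmetric] del: of_real_mult of_real_power)
    finally show ?thesis by (simp add: spectral_distribution_proj x)
  qed
  thus "\<forall>(x, y)\<in>T. ell2_inner y x = complex_of_real (\<integral>t. t \<partial>spectral_distribution proj x)" by blast
qed

end

section \<open>Operators given by their resolvent at \<open>i\<close>\<close>

text \<open>Here \<open>Z\<close> is the adjoint of \<open>Y\<close>. The two identities say that \<open>2iY - 1\<close> is unitary; together with
  injectivity they characterise the operators \<open>(i - T)\<^sup>-\<^sup>1\<close> for self-adjoint \<open>T\<close>.\<close>

locale resolvent_at_i =
  fixes Y Z :: "vec \<Rightarrow> vec"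
  assumes Y_ell2: "x \<in> ell2 \<Longrightarrow> Y x \<in> ell2"
    and Z_ell2: "x \<in> ell2 \<Longrightarrow> Z x \<in> ell2"
    and Y_lincomb: "x \<in> ell2 \<Longrightarrow> y \<in> ell2 \<Longrightarrow>
          Y (\<lambda>k. a * x k + b * y k) = (\<lambda>k. a * Y x k + b * Y y k)"
    and Y_adjoint: "x \<in> ell2 \<Longrightarrow> y \<in> ell2 \<Longrightarrow> ell2_inner (Y x) y = ell2_inner x (Z y)"
    and ZY: "x \<in> ell2 \<Longrightarrow> (\<lambda>k. 2 * \<i> * Z (Y x) k) = (\<lambda>k. Z x k - Y x k)"
    and YZ: "x \<in> ell2 \<Longrightarrow> (\<lambda>k. 2 * \<i> * Y (Z x) k) = (\<lambda>k. Z x k - Y x k)"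
    and Y_inj: "x \<in> ell2 \<Longrightarrow> Y x = (\<lambda>k. 0) \<Longrightarrow> x = (\<lambda>k. 0)"
begin

definition T :: operator where
  "T = {(Y x, \<lambda>k. \<i> * Y x k - x k) |x. x \<in> ell2}"

lemma Y_diff: "x \<in> ell2 \<Longrightarrow> y \<in> ell2 \<Longrightarrow> Y (\<lambda>k. x k - y k) = (\<lambda>k. Y x k - Y y k)"
  using Y_lincomb[of x y 1 "-1"] by simp

lemma Y_scale: "x \<in> ell2 \<Longrightarrow> Y (\<lambda>k. a * x k) = (\<lambda>k. a * Y x k)"
  using Y_lincomb[of x x a 0] by simp

lemma Y_eqD:
  assumes "x \<in> ell2" "y \<in> ell2" "Y x = Y y"
  shows "x = y"
proof -
  have "(\<lambda>k. x k - y k) = (\<lambda>k. 0)"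
    by (rule Y_inj) (use assms in \<open>auto simp: Y_diff ell2_diff\<close>)
  thus ?thesis by (simp add: fun_eq_iff)
qed

lemma Y_shift_ell2: "x \<in> ell2 \<Longrightarrow> (\<lambda>k. \<i> * Y x k - x k) \<in> ell2"
  by (intro ell2_diff ell2_scale Y_ell2)

lemma mem_T_iff:
  "(x, y) \<in> T \<longleftrightarrow> x \<in> ell2 \<and> y \<in> ell2 \<and> Y (\<lambda>k. \<i> * x k - y k) = x"
proof
  assume "(x, y) \<in> T"
  then obtain u where u: "u \<in> ell2" "x = Y u" "y = (\<lambda>k. \<i> * Y u k - u k)"
    by (auto simp: T_def)
  thus "x \<in> ell2 \<and> y \<in> ell2 \<and> Y (\<lambda>k. \<i> * x k - y k) = x"
    using Y_shift_ell2[OF u(1)] by (simp add: Y_ell2)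
next
  assume *: "x \<in> ell2 \<and> y \<in> ell2 \<and> Y (\<lambda>k. \<i> * x k - y k) = x"
  show "(x, y) \<in> T"
    unfolding T_def
    by (intro CollectI exI[of _ "\<lambda>k. \<i> * x k - y k"]) (use * in \<open>simp add: ell2_diff ell2_scale\<close>)
qed

lemma linear_operator_T: "linear_operator T"
  unfolding linear_operator_def
proof (intro conjI)
  show "T \<subseteq> ell2 \<times> ell2" by (auto simp: mem_T_iff)
  show "single_valued T"
    by (rule single_valuedI) (auto simp: T_def dest: Y_eqD)
  show "T \<noteq> {}" using ell2_zero by (auto simp: T_def)
  have "(\<lambda>k. a * x k + b * x' k, \<lambda>k. a * y k + b * y' k) \<in> T"
    if "(x, y) \<in> T" "(x', y') \<in> T" for x y x' y' a b
  proof -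
    have *: "x \<in> ell2" "y \<in> ell2" "Y (\<lambda>k. \<i> * x k - y k) = x"
      "x' \<in> ell2" "y' \<in> ell2" "Y (\<lambda>k. \<i> * x' k - y' k) = x'"
      using that by (auto simp: mem_T_iff)
    have "(\<lambda>k. \<i> * (a * x k + b * x' k) - (a * y k + b * y' k))
      = (\<lambda>k. a * (\<i> * x k - y k) + b * (\<i> * x' k - y' k))" by (auto simp: algebra_simps)
    thus ?thesis
      using * Y_lincomb[of "\<lambda>k. \<i> * x k - y k" "\<lambda>k. \<i> * x' k - y' k" a b]
      by (simp add: mem_T_iff ell2_lincomb ell2_diff ell2_scale)
  qed
  thus "\<forall>(x, y)\<in>T. \<forall>(x', y')\<in>T. \<forall>a b. (\<lambda>k. a * x k + b * x' k, \<lambda>k. a * y k + b * y' k) \<in> T"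
    by blast
qed

text \<open>This is \<open>2i ZY = Z - Y\<close> tested against \<open>x\<close> and \<open>y\<close>.\<close>

lemma symmetric_T:
  assumes x: "x \<in> ell2" and y: "y \<in> ell2"
  shows "ell2_inner (\<lambda>k. \<i> * Y x k - x k) (Y y) = ell2_inner (Y x) (\<lambda>k. \<i> * Y y k - y k)"
proof -
  have "ell2_inner x (\<lambda>k. 2 * \<i> * Z (Y y) k) = ell2_inner x (\<lambda>k. Z y k - Y y k)"
    by (simp add: ZY y)
  hence "- 2 * \<i> * ell2_inner x (Z (Y y)) = ell2_inner x (Z y) - ell2_inner x (Y y)"
    using x y by (simp add: ell2_inner_scale_right ell2_inner_diff_right Z_ell2 Y_ell2)
  hence "\<i> * ell2_inner x (Z (Y y)) + \<i> * ell2_inner x (Z (Y y)) = ell2_inner x (Y y) - ell2_inner x (Z y)"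
    by (simp add: algebra_simps)
  thus ?thesis
    using x y by (simp add: ell2_inner_scale_right ell2_inner_diff_right ell2_inner_scale_left
       ell2_inner_diff_left Z_ell2 Y_ell2 ell2_scale Y_adjoint algebra_simps)
qed

text \<open>For one inclusion \<open>T\<close> is symmetric. For the other, the adjoint condition on \<open>(y, z)\<close> says
  \<open>Z (z + i y) = - y\<close>, and \<open>2i YZ = Z - Y\<close> rewrites this as \<open>Y (i y - z) = y\<close>.\<close>

lemma adjoint_T: "adjoint_op T = T"
proof (intro equalityI subrelI)
  fix y z assume "(y, z) \<in> adjoint_op T"
  hence y: "y \<in> ell2" and z: "z \<in> ell2"
    and "\<forall>x\<in>ell2. ell2_inner (\<lambda>k. \<i> * Y x k - x k) y = ell2_inner (Y x) z"
    by (auto simp: adjoint_op_def T_def)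
  hence adj: "ell2_inner (\<lambda>k. \<i> * Y x k - x k) y = ell2_inner (Y x) z" if "x \<in> ell2" for x
    using that by blast
  define u where "u = (\<lambda>k. 1 * z k + \<i> * y k)"
  have u: "u \<in> ell2" unfolding u_def using y z by (intro ell2_lincomb)
  have inner_u: "ell2_inner (Y x) u = - ell2_inner x y" if x: "x \<in> ell2" for x
  proof -
    have "ell2_inner (Y x) u = ell2_inner (Y x) z + cnj \<i> * ell2_inner (Y x) y"
      unfolding u_def using x y z
      by (simp add: ell2_inner_add_right ell2_inner_scale_right ell2_scale Y_ell2)
    also have "ell2_inner (Y x) z = \<i> * ell2_inner (Y x) y - ell2_inner x y"
      unfolding adj[OF x, symmetric] using x y
      by (simp add: ell2_inner_diff_left ell2_inner_scale_left ell2_scale Y_ell2)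
    finally show ?thesis by simp
  qed
  have Zu: "Z u = (\<lambda>k. - y k)"
  proof
    fix k
    have "cnj (Z u k) = ell2_inner (Y (delta k)) u"
      by (simp add: Y_adjoint ell2_delta u ell2_inner_delta_left)
    also have "\<dots> = cnj (- y k)"
      by (simp add: inner_u ell2_delta ell2_inner_delta_left)
    finally show "Z u k = - y k" by (simp only: complex_cnj_cancel_iff)
  qed
  have "Y (\<lambda>k. - y k) = (\<lambda>k. - Y y k)" using Y_scale[OF y, of "-1"] by simp
  with YZ[OF u] have "2 * \<i> * (- Y y k) = - y k - Y u k" for k
    unfolding Zu by (metis (no_types))
  hence "y k = 2 * \<i> * Y y k - 1 * Y u k" for k by (simp add: algebra_simps)
  moreover have "Y (\<lambda>k. 2 * \<i> * y k + (-1) * u k) = (\<lambda>k. 2 * \<i> * Y y k + (-1) * Y u k)"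
    by (rule Y_lincomb[OF y u])
  moreover have "(\<lambda>k. 2 * \<i> * y k + (-1) * u k) = (\<lambda>k. \<i> * y k - z k)"
    by (auto simp: u_def algebra_simps)
  ultimately have "Y (\<lambda>k. \<i> * y k - z k) = y" by auto
  thus "(y, z) \<in> T" using y z by (simp add: mem_T_iff)
next
  fix y z assume *: "(y, z) \<in> T"
  then obtain u where "u \<in> ell2" "y = Y u" "z = (\<lambda>k. \<i> * Y u k - u k)" by (auto simp: T_def)
  thus "(y, z) \<in> adjoint_op T"
    using * by (auto simp: adjoint_op_def T_def symmetric_T Y_ell2 Y_shift_ell2)
qed

lemma resolvent_T:
  assumes "x \<in> ell2"
  shows "op_apply (resolvent \<i> T) x = Y x"
proof -
  have "(Y x, \<lambda>k. \<i> * Y x k - x k) \<in> T" unfolding T_def using assms by blast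
  hence "(x, Y x) \<in> resolvent \<i> T" unfolding resolvent_def by force
  moreover have "v = Y x" if "(x, v) \<in> resolvent \<i> T" for v
    using that by (auto simp: resolvent_def T_def)
  ultimately show ?thesis unfolding op_apply_def by blast
qed

text \<open>From \<open>2i \<parallel>Yx\<parallel>\<^sup>2 = \<langle>x, Yx\<rangle> - \<langle>Yx, x\<rangle>\<close> and the Cauchy-Schwarz inequality.\<close>

lemma norm_Y_le:
  assumes x: "x \<in> ell2"
  shows "ell2_norm (Y x) \<le> ell2_norm x"
proof -
  let ?n = "ell2_norm x" and ?m = "ell2_norm (Y x)"
  have m: "0 \<le> ?m" by (intro ell2_norm_nonneg Y_ell2 x)
  have "- 2 * \<i> * ell2_inner (Y x) (Y x) = ell2_inner x (\<lambda>k. 2 * \<i> * Z (Y x) k)"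
    using x by (simp add: ell2_inner_scale_right Y_adjoint Z_ell2 Y_ell2)
  also have "\<dots> = ell2_inner (Y x) x - ell2_inner x (Y x)"
    unfolding ZY[OF x] using x by (simp add: ell2_inner_diff_right Y_adjoint Z_ell2 Y_ell2)
  finally have "cmod (- 2 * \<i> * ell2_inner (Y x) (Y x)) \<le> cmod (ell2_inner (Y x) x) + cmod (ell2_inner x (Y x))"
    by (simp add: norm_triangle_ineq4)
  also have "\<dots> \<le> ?m * ?n + ?n * ?m"
    by (intro add_mono ell2_inner_Cauchy_Schwarz x Y_ell2)
  finally have "?m * ?m \<le> ?m * ?n"
    using x by (simp add: norm_mult ell2_inner_self Y_ell2 power2_eq_square abs_mult mult.commute)
  thus ?thesis
    using m ell2_norm_nonneg[OF x] by (cases "?m = 0") auto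
qed

end

text \<open>Compactness is stated sequentially, with coordinatewise convergence in place of weak convergence.\<close>

locale compact_resolvent_at_i = resolvent_at_i +
  assumes Y_compact: "(\<And>n. u n \<in> ell2) \<Longrightarrow> (\<And>n. ell2_norm (u n) \<le> 1) \<Longrightarrow>
    (\<And>k. (\<lambda>n. u n k) \<longlonglongrightarrow> x k) \<Longrightarrow> ell2_tendsto (\<lambda>n. Y (u n)) (Y x)"
begin

text \<open>A maximising sequence has a coordinatewise convergent subsequence. The limit stays in the unit ball by
  Fatou's lemma and in the orthogonal complement by weak convergence, and \<open>Y\<close> turns weak convergence
  into norm convergence.\<close>

lemma norm_Y_attains_max:
  assumes F: "F \<subseteq> ell2"
  defines "M \<equiv> {x \<in> ell2. \<forall>f\<in>F. ell2_inner x f = 0}"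
  obtains v where "v \<in> M" "ell2_norm v \<le> 1"
    "\<And>x. x \<in> M \<Longrightarrow> ell2_norm x \<le> 1 \<Longrightarrow> (ell2_norm (Y x))\<^sup>2 \<le> (ell2_norm (Y v))\<^sup>2"
proof -
  define K where "K = {x \<in> M. ell2_norm x \<le> 1}"
  define \<Phi> where "\<Phi> x = (ell2_norm (Y x))\<^sup>2" for x
  have K: "x \<in> ell2" "ell2_norm x \<le> 1" if "x \<in> K" for x
    using that by (auto simp: K_def M_def)
  have "\<Phi> x \<le> 1" if "x \<in> K" for x
  proof -
    have "ell2_norm (Y x) \<le> 1" "0 \<le> ell2_norm (Y x)"
      using norm_Y_le[of x] K[OF that] by (auto intro: ell2_norm_nonneg Y_ell2)
    thus ?thesis by (simp add: \<Phi>_def power_le_one)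
  qed
  hence bdd: "bdd_above (\<Phi> ` K)" by (auto simp: bdd_above_def)
  have "(\<lambda>k. 0) \<in> K" by (auto simp: K_def M_def ell2_zero ell2_norm_zero ell2_inner_def)
  hence ne: "\<Phi> ` K \<noteq> {}" by blast
  define S where "S = Sup (\<Phi> ` K)"
  have "\<exists>x\<in>K. S - inverse (real (Suc n)) < \<Phi> x" for n
    using less_cSup_iff[OF ne bdd, of "S - inverse (real (Suc n))"] by (auto simp: S_def)
  then obtain u where u: "\<And>n. u n \<in> K" "\<And>n. S - inverse (real (Suc n)) < \<Phi> (u n)" by metis
  have u1: "norm (u n k) \<le> 1" for n k using ell2_coord_le[of "u n" k] K[OF u(1)[of n]] by linarith
  obtain r :: "nat \<Rightarrow> nat" where r: "strict_mono r" "\<And>k. \<exists>l. (\<lambda>n. u (r n) k) \<longlonglongrightarrow> l"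
    by (rule function_convergent_subsequence[of "UNIV :: nat set" u "1 :: real"]) (use u1 in auto)
  then obtain v where v: "\<And>k. (\<lambda>n. u (r n) k) \<longlonglongrightarrow> v k" by metis
  have v_ell2: "v \<in> ell2" and v_norm: "ell2_norm v \<le> 1"
    using ell2_Fatou[OF v, where B = 1] K u(1) by auto
  have "ell2_inner v f = 0" if f: "f \<in> F" for f
  proof -
    have "(\<lambda>n. ell2_inner (u (r n)) f) \<longlonglongrightarrow> ell2_inner v f"
      unfolding ell2_inner_def
      by (rule ell2_weak[OF v]) (use K u(1) f F ell2_cnj in auto)
    moreover have "ell2_inner (u (r n)) f = 0" for n
      using u(1)[of "r n"] f by (simp add: K_def M_def)
    ultimately show ?thesis by (simp add: LIMSEQ_const_iff)
  qed
  hence vM: "v \<in> M" using v_ell2 by (simp add: M_def)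
  have "(\<lambda>n. \<Phi> (u (r n))) \<longlonglongrightarrow> \<Phi> v"
    unfolding \<Phi>_def
    by (intro ell2_tendsto_norm Y_compact v) (use K u(1) v_ell2 Y_ell2 in auto)
  moreover have "(\<lambda>n. S - inverse (real (Suc (r n)))) \<longlonglongrightarrow> S - 0"
    by (intro tendsto_diff tendsto_const
      LIMSEQ_subseq_LIMSEQ[OF LIMSEQ_inverse_real_of_nat r(1), unfolded o_def])
  ultimately have "S \<le> \<Phi> v"
    using LIMSEQ_le[of "\<lambda>n. S - inverse (real (Suc (r n)))" "S - 0" "\<lambda>n. \<Phi> (u (r n))" "\<Phi> v"] u(2)
    by (auto intro: less_imp_le)
  hence "\<Phi> x \<le> \<Phi> v" if "x \<in> K" for x
    using cSup_upper[OF imageI[OF that] bdd] by (simp add: S_def)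
  thus ?thesis using that[OF vM v_norm] by (simp add: K_def \<Phi>_def)
qed

text \<open>The quadratic form \<open>s \<parallel>x\<parallel>\<^sup>2 - \<parallel>Yx\<parallel>\<^sup>2\<close>, with \<open>s\<close> the maximum, is nonnegative on the invariant subspace
  and vanishes at the maximiser \<open>v\<close>. Its first variation at \<open>v\<close> in the direction
  \<open>w = s v - Z (Y v)\<close> must vanish, and it is \<open>2 \<parallel>w\<parallel>\<^sup>2\<close>.\<close>

lemma ex_eigenvector_ZY:
  assumes F: "F \<subseteq> ell2"
  defines "M \<equiv> {x \<in> ell2. \<forall>f\<in>F. ell2_inner x f = 0}"
  assumes YM: "\<And>x. x \<in> M \<Longrightarrow> Y x \<in> M" and ZM: "\<And>x. x \<in> M \<Longrightarrow> Z x \<in> M"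
    and x0: "x0 \<in> M" "x0 \<noteq> (\<lambda>k. 0)"
  obtains v s where "v \<in> M" "v \<noteq> (\<lambda>k. 0)" "s > 0" "Z (Y v) = (\<lambda>k. complex_of_real s * v k)"
proof -
  have M: "x \<in> ell2" if "x \<in> M" for x using that by (simp add: M_def)
  have M_diff: "(\<lambda>k. x k - a * y k) \<in> M" if "x \<in> M" "y \<in> M" for x y a
    using that F by (auto simp: M_def ell2_diff ell2_scale ell2_inner_diff_left ell2_inner_scale_left subset_iff)
  have M_scale: "(\<lambda>k. a * x k) \<in> M" if "x \<in> M" for x a
    using that F by (auto simp: M_def ell2_scale ell2_inner_scale_left subset_iff)
  obtain v where v: "v \<in> M" "ell2_norm v \<le> 1"
    and max: "\<And>x. x \<in> M \<Longrightarrow> ell2_norm x \<le> 1 \<Longrightarrow> (ell2_norm (Y x))\<^sup>2 \<le> (ell2_norm (Y v))\<^sup>2"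
    by (rule norm_Y_attains_max[OF F, folded M_def]) blast
  define s where "s = (ell2_norm (Y v))\<^sup>2"
  have le: "(ell2_norm (Y x))\<^sup>2 \<le> s * (ell2_norm x)\<^sup>2" if x: "x \<in> M" for x
  proof (cases "ell2_norm x = 0")
    case True
    hence "x = (\<lambda>k. 0 * x k)" using ell2_norm_eq_0[OF M[OF x]] by simp
    hence "Y x = (\<lambda>k. 0)" using Y_scale[OF M[OF x], of 0] by simp
    thus ?thesis by (simp add: ell2_norm_zero True)
  next
    case False
    hence n: "ell2_norm x > 0" using ell2_norm_nonneg[OF M[OF x]] by simp
    let ?c = "complex_of_real (1 / ell2_norm x)"
    have c: "cmod ?c = 1 / ell2_norm x" using n by (simp add: norm_divide)
    have "(\<lambda>k. ?c * x k) \<in> M" by (rule M_scale[OF x])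
    moreover have "ell2_norm (\<lambda>k. ?c * x k) \<le> 1"
      using n by (subst ell2_norm_scale[OF M[OF x]]) (simp only: c, simp)
    ultimately have "(ell2_norm (Y (\<lambda>k. ?c * x k)))\<^sup>2 \<le> s" unfolding s_def by (rule max)
    also have "Y (\<lambda>k. ?c * x k) = (\<lambda>k. ?c * Y x k)" by (rule Y_scale[OF M[OF x]])
    also have "ell2_norm \<dots> = (1 / ell2_norm x) * ell2_norm (Y x)"
      by (subst ell2_norm_scale[OF Y_ell2[OF M[OF x]]]) (simp only: c)
    finally show ?thesis using n by (simp add: field_simps)
  qed
  have s: "s > 0"
  proof (rule ccontr)
    assume "\<not> s > 0"
    hence "s * (ell2_norm x0)\<^sup>2 \<le> 0" by (intro mult_nonpos_nonneg) auto
    with le[OF x0(1)] have "(ell2_norm (Y x0))\<^sup>2 \<le> 0" by linarith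
    hence "ell2_norm (Y x0) = 0" by simp
    hence "Y x0 = (\<lambda>k. 0)" by (intro ell2_norm_eq_0 Y_ell2 M x0)
    thus False using Y_inj[OF M[OF x0(1)]] x0(2) by blast
  qed
  have Yv: "Y v \<in> ell2" "Z (Y v) \<in> ell2" "v \<in> ell2" "Z (Y v) \<in> M"
    using v by (auto intro: Y_ell2 Z_ell2 M YM ZM)
  have v0: "v \<noteq> (\<lambda>k. 0)"
  proof
    assume "v = (\<lambda>k. 0)"
    hence "ell2_norm v = 0" by (simp add: ell2_norm_zero)
    thus False using le[OF v(1)] s by (simp add: s_def)
  qed
  define w where "w = (\<lambda>k. of_real s * v k - Z (Y v) k)"
  have wM: "w \<in> M"
  proof -
    have "(\<lambda>k. of_real s * v k) \<in> M" by (rule M_scale[OF v(1)])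
    from M_diff[OF this Yv(4), of 1] show ?thesis by (simp add: w_def)
  qed
  have w: "w \<in> ell2" "Y w \<in> ell2" using wM by (auto intro: M Y_ell2)
  \<comment> \<open>the minimiser of the bound \<open>- 2 t \<parallel>w\<parallel>\<^sup>2 + t\<^sup>2 s \<parallel>w\<parallel>\<^sup>2\<close> for the form at \<open>v - t w\<close>\<close>
  define t where "t = 1 / s"
  have "(ell2_norm (Y (\<lambda>k. v k - of_real t * w k)))\<^sup>2 \<le> s * (ell2_norm (\<lambda>k. v k - of_real t * w k))\<^sup>2"
    by (rule le[OF M_diff[OF v(1) wM]])
  also have "Y (\<lambda>k. v k - of_real t * w k) = (\<lambda>k. Y v k - of_real t * Y w k)"
    using Y_lincomb[OF Yv(3) w(1), of 1 "- of_real t"] by simp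
  finally have ineq: "s - 2 * t * Re (ell2_inner (Y v) (Y w)) + t\<^sup>2 * (ell2_norm (Y w))\<^sup>2
      \<le> s * ((ell2_norm v)\<^sup>2 - 2 * t * Re (ell2_inner v w) + t\<^sup>2 * (ell2_norm w)\<^sup>2)"
    using Yv w by (simp add: ell2_norm_lincomb s_def)
  have "Re (ell2_inner (Y v) (Y w)) = Re (ell2_inner (Y w) (Y v))"
    by (simp add: ell2_inner_commute[OF w(2) Yv(1)])
  also have "\<dots> = Re (ell2_inner (Z (Y v)) w)"
    by (simp add: Y_adjoint[OF w(1) Yv(1)] ell2_inner_commute[OF w(1) Yv(2)])
  finally have "Re (ell2_inner (Y v) (Y w)) = Re (ell2_inner (Z (Y v)) w)" .
  moreover have "ell2_inner w w = of_real s * ell2_inner v w - ell2_inner (Z (Y v)) w"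
    using Yv w ell2_inner_diff_left[of "\<lambda>k. of_real s * v k" "Z (Y v)" w]
    by (simp add: ell2_inner_scale_left ell2_scale w_def[symmetric])
  ultimately have "s * Re (ell2_inner v w) - Re (ell2_inner (Y v) (Y w)) = Re (ell2_inner w w)"
    by simp
  hence e: "s * Re (ell2_inner v w) - Re (ell2_inner (Y v) (Y w)) = (ell2_norm w)\<^sup>2"
    by (simp add: ell2_inner_self w)
  have "s * (ell2_norm v)\<^sup>2 \<le> s"
    using v s ell2_norm_nonneg[OF Yv(3)] by (simp add: power_le_one)
  hence "0 \<le> - 2 * t * (ell2_norm w)\<^sup>2 + t\<^sup>2 * (s * (ell2_norm w)\<^sup>2) - t\<^sup>2 * (ell2_norm (Y w))\<^sup>2"
    using ineq unfolding e[symmetric] by (simp add: algebra_simps)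
  moreover have "t\<^sup>2 * (s * (ell2_norm w)\<^sup>2) = t * (ell2_norm w)\<^sup>2"
    using s by (simp add: t_def power2_eq_square)
  moreover have "0 \<le> t\<^sup>2 * (ell2_norm (Y w))\<^sup>2" by simp
  ultimately have "0 \<le> - t * (ell2_norm w)\<^sup>2" by linarith
  hence "(ell2_norm w)\<^sup>2 \<le> 0" using s by (simp add: t_def divide_le_0_iff)
  hence "w = (\<lambda>k. 0)" using ell2_norm_eq_0[OF w(1)] by simp
  hence "Z (Y v) = (\<lambda>k. of_real s * v k)" by (auto simp: w_def fun_eq_iff)
  thus ?thesis using that v(1) v0 s by blast
qed

text \<open>Testing \<open>2i ZY = Z - Y\<close> on the eigenvector gives \<open>Im (1 / \<gamma>) = 1\<close>.\<close>

lemma eigenvalue_Y: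
  assumes w: "w \<in> ell2" "w \<noteq> (\<lambda>k. 0)" and Yw: "Y w = (\<lambda>k. \<gamma> * w k)" and \<gamma>: "\<gamma> \<noteq> 0"
  obtains l :: real where "\<gamma> = 1 / (\<i> - of_real l)"
proof -
  define n where "n = (ell2_norm w)\<^sup>2"
  have "ell2_norm w \<noteq> 0" using ell2_norm_eq_0[OF w(1)] w(2) by blast
  hence n: "n \<noteq> 0" by (simp add: n_def)
  have Zw: "ell2_inner (Y w) w = ell2_inner w (Z w)" by (rule Y_adjoint[OF w(1) w(1)])
  have "ell2_inner w (\<lambda>k. 2 * \<i> * Z (Y w) k) = - 2 * \<i> * ell2_inner (Y w) (Y w)"
    using w by (simp add: ell2_inner_scale_right Y_adjoint Z_ell2 Y_ell2)
  moreover have "ell2_inner w (\<lambda>k. 2 * \<i> * Z (Y w) k) = ell2_inner (Y w) w - ell2_inner w (Y w)"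
    unfolding ZY[OF w(1)] using w by (simp add: ell2_inner_diff_right Y_adjoint Z_ell2 Y_ell2)
  ultimately have "- 2 * \<i> * (\<gamma> * cnj \<gamma> * of_real n) = \<gamma> * of_real n - cnj \<gamma> * of_real n"
    using w unfolding Yw n_def
    by (simp add: ell2_inner_scale_left ell2_inner_scale_right ell2_scale ell2_inner_self)
  hence "(- 2 * \<i> * (\<gamma> * cnj \<gamma>)) * of_real n = (\<gamma> - cnj \<gamma>) * of_real n"
    by (simp add: algebra_simps)
  hence "- 2 * \<i> * (\<gamma> * cnj \<gamma>) = \<gamma> - cnj \<gamma>"
    using n mult_right_cancel[of "complex_of_real n"] by (metis of_real_eq_0_iff)
  hence "- 2 * \<i> = 1 / cnj \<gamma> - 1 / \<gamma>" using \<gamma> by (simp add: field_simps)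
  moreover have "1 / cnj \<gamma> = cnj (1 / \<gamma>)" by simp
  ultimately have "Im (- 2 * \<i>) = Im (cnj (1 / \<gamma>) - 1 / \<gamma>)" by metis
  also have "Im (cnj w - w) = - 2 * Im w" for w by simp
  finally have "Im (1 / \<gamma>) = 1" by simp
  hence "1 / \<gamma> = \<i> - of_real (- Re (1 / \<gamma>))" by (simp add: complex_eq_iff)
  hence "\<gamma> = 1 / (\<i> - of_real (- Re (1 / \<gamma>)))" using \<gamma> by (metis inverse_eq_divide inverse_inverse_eq)
  thus ?thesis using that by blast
qed

text \<open>Let \<open>v\<close> be an eigenvector of \<open>ZY\<close> for \<open>s > 0\<close>. The two resolvent identities give
  \<open>Y\<^sup>2 v + 2is Y v - s v = 0\<close>. Factor this as \<open>(Y - a)(Y - b) v = 0\<close>: either \<open>v\<close> or \<open>(Y - b) v\<close> is an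
  eigenvector of \<open>Y\<close>, with a nonzero eigenvalue because \<open>a b = - s\<close>.\<close>

lemma ex_eigenvector:
  assumes F: "F \<subseteq> ell2"
  defines "M \<equiv> {x \<in> ell2. \<forall>f\<in>F. ell2_inner x f = 0}"
  assumes YM: "\<And>x. x \<in> M \<Longrightarrow> Y x \<in> M" and ZM: "\<And>x. x \<in> M \<Longrightarrow> Z x \<in> M"
    and x0: "x0 \<in> M" "x0 \<noteq> (\<lambda>k. 0)"
  obtains w l where "w \<in> M" "w \<noteq> (\<lambda>k. 0)" "Y w = (\<lambda>k. 1 / (\<i> - of_real l) * w k)"
proof -
  obtain v s where v: "v \<in> M" "v \<noteq> (\<lambda>k. 0)" "s > 0" "Z (Y v) = (\<lambda>k. complex_of_real s * v k)"
    by (rule ex_eigenvector_ZY[OF F, folded M_def, OF YM ZM x0]) blast+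
  have M: "x \<in> ell2" if "x \<in> M" for x using that by (simp add: M_def)
  have M_diff: "(\<lambda>k. x k - a * y k) \<in> M" if "x \<in> M" "y \<in> M" for x y a
    using that F by (auto simp: M_def ell2_diff ell2_scale ell2_inner_diff_left ell2_inner_scale_left subset_iff)
  have e: "v \<in> ell2" "Y v \<in> ell2" "Z v \<in> ell2" "Y (Y v) \<in> ell2" "Y v \<in> M"
    using v by (auto intro: M Y_ell2 Z_ell2 YM)
  have Zv: "Z v = (\<lambda>k. 1 * Y v k + 2 * \<i> * of_real s * v k)"
    using ZY[OF e(1)] unfolding v(4) fun_eq_iff by (simp add: algebra_simps)
  have "2 * \<i> * Y (Z v) k = 2 * \<i> * (of_real s * v k)" for k
    using YZ[OF e(1)] ZY[OF e(1)] unfolding v(4) fun_eq_iff by metis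
  hence "Y (Z v) k = of_real s * v k" for k by simp
  moreover have "Y (Z v) = (\<lambda>k. 1 * Y (Y v) k + 2 * \<i> * of_real s * Y v k)"
    unfolding Zv by (rule Y_lincomb[OF e(2) e(1)])
  ultimately have YYv: "Y (Y v) k = of_real s * v k - 2 * \<i> * of_real s * Y v k" for k
    by (simp add: algebra_simps fun_eq_iff)
  \<comment> \<open>\<open>a\<close> and \<open>b\<close> below are the roots of \<open>z\<^sup>2 + 2is z - s\<close>\<close>
  define D where "D = csqrt (of_real s - of_real s * of_real s)"
  define a b where "a = - \<i> * of_real s + D" and "b = - \<i> * of_real s - D"
  have DD: "D * D = of_real s - of_real s * of_real s"
    unfolding D_def by (metis power2_csqrt power2_eq_square)
  have ab: "a * b = - of_real s" "a + b = - 2 * \<i> * of_real s"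
  proof -
    have "a * b = (\<i> * of_real s) * (\<i> * of_real s) - D * D" by (simp add: a_def b_def algebra_simps)
    also have "(\<i> * of_real s) * (\<i> * of_real s) = (\<i> * \<i>) * (complex_of_real s * of_real s)"
      by (simp only: mult_ac)
    also have "\<dots> - D * D = - of_real s" by (simp add: DD)
    finally show "a * b = - of_real s" .
    show "a + b = - 2 * \<i> * of_real s" by (simp add: a_def b_def)
  qed
  hence ab0: "a \<noteq> 0" "b \<noteq> 0" using v(3) by auto
  define w1 where "w1 = (\<lambda>k. Y v k - b * v k)"
  have "\<exists>w \<gamma>. w \<in> M \<and> w \<noteq> (\<lambda>k. 0) \<and> \<gamma> \<noteq> 0 \<and> Y w = (\<lambda>k. \<gamma> * w k)"
  proof (cases "w1 = (\<lambda>k. 0)")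
    case True
    hence "Y v = (\<lambda>k. b * v k)" by (auto simp: w1_def fun_eq_iff)
    thus ?thesis using v ab0 by blast
  next
    case False
    have "w1 \<in> M" unfolding w1_def by (rule M_diff[OF e(5) v(1)])
    moreover have "Y w1 = (\<lambda>k. a * w1 k)"
    proof -
      have "Y w1 = (\<lambda>k. Y (Y v) k - b * Y v k)"
        unfolding w1_def using Y_lincomb[OF e(2) e(1), of 1 "- b"] by simp
      also have "\<dots> = (\<lambda>k. a * w1 k)"
      proof
        fix k
        have "a * Y v k = - 2 * \<i> * of_real s * Y v k - b * Y v k"
          using ab(2) by (metis add_diff_cancel_right' left_diff_distrib)
        moreover have "a * w1 k = a * Y v k - (a * b) * v k" by (simp add: w1_def algebra_simps)
        ultimately show "Y (Y v) k - b * Y v k = a * w1 k"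
          unfolding ab(1) YYv by simp
      qed
      finally show ?thesis .
    qed
    ultimately show ?thesis using False ab0 by blast
  qed
  then obtain w \<gamma> where w: "w \<in> M" "w \<noteq> (\<lambda>k. 0)" "\<gamma> \<noteq> 0" "Y w = (\<lambda>k. \<gamma> * w k)" by blast
  obtain l where "\<gamma> = 1 / (\<i> - of_real l)" by (rule eigenvalue_Y[OF M[OF w(1)] w(2,4,3)])
  thus ?thesis using that w by blast
qed

end

section \<open>The Jacobi matrix at the point \<open>i\<close>\<close>

locale jacobi_SC =
  fixes \<omega> :: "nat \<Rightarrow> real"
  assumes pos: "m \<ge> 1 \<Longrightarrow> \<omega> m > 0"
    and SC: "property_SC \<omega>"
begin

text \<open>\<open>A n\<close> is \<open>B\<^sub>n\<^sub>-\<^sub>1\<close>, \<open>W n\<close> is \<open>\<omega>\<^sub>1 \<cdots> \<omega>\<^sub>n\<close>, the \<open>s n\<close> are the off-diagonal entries, and \<open>a n\<close> is the modulus of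
  the orthonormal polynomial of degree \<open>n\<close> at \<open>i\<close>. The number \<open>c n\<close> is the size of the difference of
  consecutive convergents of the continued fraction at \<open>i\<close>.\<close>

definition A :: "nat \<Rightarrow> real" where
  "A n = (case n of 0 \<Rightarrow> 1 | Suc m \<Rightarrow> SC_B \<omega> m)"

definition W :: "nat \<Rightarrow> real" where
  "W n = (\<Prod>k=1..n. \<omega> k)"

definition s :: "nat \<Rightarrow> real" where
  "s n = sqrt (\<omega> n)"

definition a :: "nat \<Rightarrow> real" where
  "a n = A n / sqrt (W n)"

definition c :: "nat \<Rightarrow> real" where
  "c n = W n / (A n * A (Suc n))"

lemma A_0 [simp]: "A 0 = 1" and A_1 [simp]: "A (Suc 0) = 1"
  by (simp_all add: A_def)

lemma A_Suc_Suc: "A (Suc (Suc n)) = A (Suc n) + \<omega> (Suc n) * A n"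
  by (cases n) (simp_all add: A_def)

lemma A_pos: "A n > 0"
proof -
  have "A n > 0 \<and> A (Suc n) > 0"
    by (induction n) (auto simp: A_Suc_Suc pos intro!: add_pos_pos)
  thus ?thesis ..
qed

lemma W_0 [simp]: "W 0 = 1" and W_Suc: "W (Suc n) = W n * \<omega> (Suc n)"
  by (simp_all add: W_def)

lemma W_pos: "W n > 0"
  unfolding W_def by (rule prod_pos) (simp add: pos)

lemma s_pos: "s (Suc n) > 0"
  by (simp add: s_def pos)

lemma sqrt_W_Suc: "sqrt (W (Suc n)) = sqrt (W n) * s (Suc n)"
  by (simp add: W_Suc s_def real_sqrt_mult)

lemma a_pos: "a n > 0"
  by (simp add: a_def A_pos W_pos)

lemma s_a_Suc: "s (Suc n) * a (Suc n) = A (Suc n) / sqrt (W n)"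
  using s_pos[of n] by (simp add: a_def sqrt_W_Suc)

lemma a_1: "s (Suc 0) * a (Suc 0) = a 0"
  unfolding s_a_Suc by (simp add: a_def)

lemma a_recurrence: "s (Suc (Suc n)) * a (Suc (Suc n)) = a (Suc n) + s (Suc n) * a n"
proof -
  have "s (Suc n) * a n = \<omega> (Suc n) * A n / sqrt (W (Suc n))"
    using s_pos[of n] W_pos[of n] pos[of "Suc n"]
    by (simp add: a_def sqrt_W_Suc s_def field_simps flip: power2_eq_square)
  thus ?thesis unfolding s_a_Suc by (simp add: A_Suc_Suc add_divide_distrib a_def)
qed

lemma s_a_a_c: "s (Suc n) * a (Suc n) * a n * c n = 1"
proof -
  have "s (Suc n) * a (Suc n) * a n = A (Suc n) * A n / W n"
    unfolding s_a_Suc using W_pos[of n] by (simp add: a_def flip: power2_eq_square)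
  thus ?thesis using A_pos[of n] A_pos[of "Suc n"] W_pos[of n] by (simp add: c_def)
qed

lemma c_pos: "c n > 0"
  by (simp add: c_def A_pos W_pos)

text \<open>The Christoffel-Darboux sum at \<open>i\<close>, which has a closed form because \<open>A\<^sub>n\<^sub>+\<^sub>2 = A\<^sub>n\<^sub>+\<^sub>1 + \<omega>\<^sub>n\<^sub>+\<^sub>1 A\<^sub>n\<close>.\<close>

lemma sum_a_squared: "(\<Sum>k\<le>n. (a k)\<^sup>2) = 1 / c n"
proof (induction n)
  case 0
  show ?case by (simp add: a_def c_def)
next
  case (Suc n)
  have "(a (Suc n))\<^sup>2 = (A (Suc n))\<^sup>2 / W (Suc n)"
    using W_pos[of "Suc n"] by (simp add: a_def power_divide)
  moreover have "1 / c n = A n * A (Suc n) * \<omega> (Suc n) / W (Suc n)"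
    using pos[of "Suc n"] by (simp add: c_def W_Suc)
  moreover have "1 / c (Suc n) = A (Suc n) * (A (Suc n) + \<omega> (Suc n) * A n) / W (Suc n)"
    by (simp add: c_def A_Suc_Suc)
  ultimately show ?case
    using Suc by (simp add: add_divide_distrib[symmetric] algebra_simps power2_eq_square)
qed

lemma c_antimono: "m \<le> n \<Longrightarrow> c n \<le> c m"
proof -
  assume "m \<le> n"
  hence "1 / c m \<le> 1 / c n" unfolding sum_a_squared[symmetric] by (intro sum_mono2) auto
  thus ?thesis using c_pos[of m] c_pos[of n] by (simp add: field_simps)
qed

lemma c_le_1: "c n \<le> 1"
  using c_antimono[of 0 n] by (simp add: c_def)

text \<open>Exactly, \<open>(a k)\<^sup>2\<close> is the ratio \<open>A\<^sub>k / A\<^sub>k\<^sub>+\<^sub>1\<close> of property (SC) times the partial sum up to \<open>k\<close>.\<close>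

lemma a_squared_le: "k \<le> n \<Longrightarrow> (a k)\<^sup>2 \<le> A k / A (Suc k) * (1 / c n)"
proof -
  assume "k \<le> n"
  have "(a k)\<^sup>2 = A k / A (Suc k) * (1 / c k)"
    using A_pos[of k] A_pos[of "Suc k"] W_pos[of k]
    by (simp add: a_def c_def power_divide power2_eq_square)
  also have "1 / c k \<le> 1 / c n"
    using c_antimono[OF \<open>k \<le> n\<close>] c_pos[of n] c_pos[of k] by (simp add: field_simps)
  hence "A k / A (Suc k) * (1 / c k) \<le> A k / A (Suc k) * (1 / c n)"
    using A_pos[of k] A_pos[of "Suc k"] by (intro mult_left_mono) auto
  finally show ?thesis .
qed

text \<open>Choose \<open>N\<close> such that the ratios \<open>A\<^sub>k / A\<^sub>k\<^sub>+\<^sub>1\<close> with \<open>k \<ge> N\<close> sum to less than \<open>1/2\<close>. The terms from \<open>N\<close> on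
  then contribute at most half of any partial sum, so partial sums are at most twice the sum
  of the first \<open>N\<close> terms.\<close>

lemma summable_a_squared: "summable (\<lambda>k. (a k)\<^sup>2)"
proof -
  define r where "r k = A k / A (Suc k)" for k
  have "(\<lambda>k. r (Suc k)) = (\<lambda>n. SC_B \<omega> n / SC_B \<omega> (Suc n))"
    by (simp add: r_def A_def)
  hence "summable (\<lambda>k. r (Suc k))" using SC by (simp add: property_SC_def)
  hence r: "summable r" by (simp only: summable_Suc_iff)
  have r_nonneg: "0 \<le> r k" for k using A_pos[of k] A_pos[of "Suc k"] by (simp add: r_def)
  obtain N where "\<forall>n\<ge>N. norm (\<Sum>k. r (k + n)) < 1 / 2"
    using suminf_exist_split[of "1/2" r] r by auto
  hence "\<bar>\<Sum>k. r (k + N)\<bar> < 1 / 2" by simp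
  hence N: "(\<Sum>k. r (k + N)) < 1 / 2" by linarith
  have "1 / c n \<le> 2 * (\<Sum>k<N. (a k)\<^sup>2)" if "n \<ge> N" for n
  proof -
    have rN: "summable (\<lambda>k. r (k + N))" by (rule summable_ignore_initial_segment[OF r])
    have "1 / c n = (\<Sum>k<N. (a k)\<^sup>2) + (\<Sum>k=N..n. (a k)\<^sup>2)"
      unfolding sum_a_squared[symmetric]
      using that by (subst sum.union_disjoint[symmetric]) (auto intro!: sum.cong)
    also have "(\<Sum>k=N..n. (a k)\<^sup>2) \<le> (\<Sum>k=N..n. r k * (1 / c n))"
      unfolding r_def by (intro sum_mono a_squared_le) auto
    also have "\<dots> = (\<Sum>k=N..n. r k) * (1 / c n)" by (simp add: sum_divide_distrib)
    also have "(\<Sum>k=N..n. r k) = (\<Sum>k<Suc n - N. r (k + N))"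
      using that sum.shift_bounds_nat_ivl[of r 0 N "Suc n - N"]
      by (simp add: lessThan_atLeast0 atLeastLessThanSuc_atLeastAtMost)
    also have "\<dots> \<le> (\<Sum>k. r (k + N))" by (rule sum_le_suminf[OF rN]) (auto simp: r_nonneg)
    hence "(\<Sum>k<Suc n - N. r (k + N)) * (1 / c n) \<le> 1 / 2 * (1 / c n)"
      using N c_pos[of n] by (intro mult_right_mono) auto
    finally show ?thesis by simp
  qed
  hence b: "1 / c n \<le> 2 * (\<Sum>k<N. (a k)\<^sup>2)" if "n \<ge> N" for n using that by blast
  have "(\<Sum>k<n. (a k)\<^sup>2) \<le> 2 * (\<Sum>k<N. (a k)\<^sup>2)" for n
  proof -
    have "(\<Sum>k<n. (a k)\<^sup>2) \<le> (\<Sum>k\<le>max n N. (a k)\<^sup>2)" by (intro sum_mono2) auto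
    also have "\<dots> \<le> 2 * (\<Sum>k<N. (a k)\<^sup>2)" unfolding sum_a_squared by (rule b) simp
    finally show ?thesis .
  qed
  thus ?thesis by (intro summableI_nonneg_bounded) auto
qed

lemma c_lower_bound:
  obtains C where "C > 0" "\<And>n. C \<le> c n"
proof
  let ?S = "\<Sum>k. (a k)\<^sup>2"
  have S: "?S > 0"
    by (rule suminf_pos[OF summable_a_squared]) (use a_pos in \<open>simp add: less_imp_neq[symmetric]\<close>)
  thus "1 / ?S > 0" by simp
  show "1 / ?S \<le> c n" for n
  proof -
    have "1 / c n \<le> ?S" unfolding sum_a_squared[symmetric]
      by (rule sum_le_suminf[OF summable_a_squared]) auto
    thus ?thesis using S c_pos[of n] by (simp add: field_simps)
  qed
qed

subsection \<open>The three-term recurrence operator\<close>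

text \<open>The formal action of the matrix on arbitrary sequences. Both \<open>X\<close> and \<open>X\<^sup>*\<close> are restrictions of it.\<close>

definition jac :: "vec \<Rightarrow> vec" where
  "jac x j = (if j = 0 then 0 else of_real (s j) * x (j - 1)) + of_real (s (Suc j)) * x (Suc j)"

lemma sum_jacobi_entry:
  assumes S: "finite S" and x: "\<And>k. k \<notin> S \<Longrightarrow> x k = 0"
  shows "(\<Sum>k\<in>S. jacobi_entry \<omega> j k * x k) = jac x j"
proof -
  have "(\<Sum>k\<in>S. jacobi_entry \<omega> j k * x k) =
    (\<Sum>k\<in>S. (if k = Suc j then of_real (s (Suc j)) * x (Suc j) else 0)
      + (if k = j - 1 then if j = 0 then 0 else of_real (s j) * x (j - 1) else 0))"
    by (intro sum.cong) (auto simp: jacobi_entry_def s_def)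
  also have "\<dots> = jac x j"
    using x[of "Suc j"] x[of "j - 1"] S by (auto simp: sum.distrib jac_def)
  finally show ?thesis .
qed

lemma jacobi_op_eq: "jacobi_op \<omega> = {(x, jac x) |x. finite {k. x k \<noteq> 0}}"
proof -
  have "(\<lambda>j. \<Sum>k | x k \<noteq> 0. jacobi_entry \<omega> j k * x k) = jac x" if "finite {k. x k \<noteq> 0}" for x
    using that by (intro ext sum_jacobi_entry) auto
  thus ?thesis unfolding jacobi_op_def by (smt (verit, best) Collect_cong)
qed

lemma truncated_jacobi_eq:
  assumes "\<And>k. k > m \<Longrightarrow> y k = 0"
  shows "truncated_jacobi \<omega> m y j = (if j \<le> m then jac y j else 0)"
  using sum_jacobi_entry[of "{..m}" y j] assms by (simp add: truncated_jacobi_def)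

lemma jac_cnj: "jac (\<lambda>k. cnj (x k)) j = cnj (jac x j)"
  by (simp add: jac_def)

lemma jac_lincomb: "jac (\<lambda>k. \<alpha> * x k + \<beta> * y k) j = \<alpha> * jac x j + \<beta> * jac y j"
  by (simp add: jac_def algebra_simps)

text \<open>Summation by parts; the boundary term is the discrete Wronskian.\<close>

lemma jac_Green:
  "(\<Sum>k\<le>n. jac u k * v k - u k * jac v k) = of_real (s (Suc n)) * (u (Suc n) * v n - u n * v (Suc n))"
  by (induction n) (simp_all add: jac_def algebra_simps)

lemma jac_symmetric:
  assumes "\<And>k. k > n \<Longrightarrow> u k = 0" "\<And>k. k > n \<Longrightarrow> v k = 0"
  shows "(\<Sum>k\<le>n. jac u k * v k) = (\<Sum>k\<le>n. u k * jac v k)"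
  using jac_Green[of u v n] assms by (simp add: sum_subtractf)

lemma finite_support_jac:
  assumes "finite {k. x k \<noteq> 0}"
  shows "finite {k. jac x k \<noteq> 0}"
proof (rule finite_subset)
  show "{k. jac x k \<noteq> 0} \<subseteq> Suc ` {k. x k \<noteq> 0} \<union> {k. x (Suc k) \<noteq> 0}"
  proof
    fix k assume "k \<in> {k. jac x k \<noteq> 0}"
    thus "k \<in> Suc ` {k. x k \<noteq> 0} \<union> {k. x (Suc k) \<noteq> 0}"
      by (cases k) (auto simp: jac_def)
  qed
  have "{k. x (Suc k) \<noteq> 0} = Suc -` {k. x k \<noteq> 0}" by auto
  thus "finite (Suc ` {k. x k \<noteq> 0} \<union> {k. x (Suc k) \<noteq> 0})"
    using assms finite_vimageI[OF assms, of Suc] by simp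
qed

text \<open>Testing with the standard basis vectors shows that the adjoint acts by the recurrence; the converse is
  Green's formula for a finitely supported vector, where the boundary term vanishes.\<close>

lemma adjoint_jacobi_op: "adjoint_op (jacobi_op \<omega>) = {(y, jac y) |y. y \<in> ell2 \<and> jac y \<in> ell2}"
proof (intro equalityI subrelI)
  fix y z assume yz: "(y, z) \<in> adjoint_op (jacobi_op \<omega>)"
  hence ell2: "y \<in> ell2" "z \<in> ell2" by (auto simp: adjoint_op_def)
  have "z k = jac y k" for k
  proof -
    have "(delta k, jac (delta k)) \<in> jacobi_op \<omega>"
      by (auto simp: jacobi_op_eq delta_def intro: finite_subset[of _ "{k}"])
    hence "ell2_inner (jac (delta k)) y = ell2_inner (delta k) z"
      using yz by (auto simp: adjoint_op_def)
    moreover have "jac (delta k) = (\<lambda>j. (if k = 0 then 0 else of_real (s k)) * delta (k - 1) j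
        + of_real (s (Suc k)) * delta (Suc k) j)"
    proof
      fix j
      show "jac (delta k) j = (if k = 0 then 0 else of_real (s k)) * delta (k - 1) j
          + of_real (s (Suc k)) * delta (Suc k) j"
        by (cases j; cases k) (auto simp: jac_def delta_def)
    qed
    ultimately have "cnj (z k) = cnj (jac y k)"
      using ell2 by (cases k) (simp_all add: ell2_inner_add_left ell2_inner_scale_left ell2_scale
          ell2_delta ell2_inner_delta_left jac_def)
    thus ?thesis by (simp only: complex_cnj_cancel_iff)
  qed
  hence "z = jac y" by auto
  thus "(y, z) \<in> {(y, jac y) |y. y \<in> ell2 \<and> jac y \<in> ell2}" using ell2 by blast
next
  fix y z assume "(y, z) \<in> {(y, jac y) |y. y \<in> ell2 \<and> jac y \<in> ell2}"
  hence ell2: "y \<in> ell2" "jac y \<in> ell2" and z: "z = jac y" by auto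
  have "ell2_inner (jac x) y = ell2_inner x (jac y)" if fin: "finite {k. x k \<noteq> 0}" for x
  proof -
    obtain n where "\<forall>k\<in>{k. x k \<noteq> 0}. k < n" using finite_nat_set_iff_bounded fin by metis
    hence n: "x k = 0" if "k \<ge> n" for k using that by force
    have jn: "jac x k = 0" if "k > n" for k using n[of "k - 1"] n[of "Suc k"] that by (auto simp: jac_def)
    have "(\<Sum>k\<le>n. jac x k * cnj (y k)) = (\<Sum>k\<le>n. x k * cnj (jac y k))"
      using jac_Green[of x "\<lambda>k. cnj (y k)" n] n[of n] n[of "Suc n"]
      by (simp add: sum_subtractf jac_cnj)
    moreover have "ell2_inner (jac x) y = (\<Sum>k\<le>n. jac x k * cnj (y k))"
      unfolding ell2_inner_def by (rule suminf_finite) (auto simp: jn)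
    moreover have "ell2_inner x (jac y) = (\<Sum>k\<le>n. x k * cnj (jac y k))"
      unfolding ell2_inner_def by (rule suminf_finite) (auto simp: n)
    ultimately show ?thesis by simp
  qed
  thus "(y, z) \<in> adjoint_op (jacobi_op \<omega>)"
    using ell2 z by (auto simp: adjoint_op_def jacobi_op_eq)
qed

subsection \<open>Green kernels\<close>

text \<open>\<open>\<pi>\<close> is the vector of orthonormal polynomials at \<open>i\<close>. For a function \<open>h\<close> with increments
  \<open>h n - h (n + 1) = d n\<close> the sequence \<open>- i \<pi>\<^sub>k h k\<close> solves the same recurrence from the second row on, and \<open>green h\<close> is the
  Green kernel built from the two. The choice of \<open>h\<close> is the choice of a boundary condition at
  infinity.\<close>

definition d :: "nat \<Rightarrow> real" where
  "d n = (- 1) ^ n * c n"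

definition \<pi> :: vec where
  "\<pi> n = \<i> ^ n * of_real (a n)"

definition green :: "(nat \<Rightarrow> real) \<Rightarrow> nat \<Rightarrow> vec" where
  "green h j k = - \<i> * \<pi> j * \<pi> k * of_real (h (max j k))"

definition green_op :: "(nat \<Rightarrow> real) \<Rightarrow> vec \<Rightarrow> vec" where
  "green_op h x j = (\<Sum>k. green h j k * x k)"

lemma norm_\<pi>: "cmod (\<pi> n) = a n"
  using a_pos[of n] by (simp add: \<pi>_def norm_mult norm_power)

lemma \<pi>_ell2: "\<pi> \<in> ell2"
  using summable_a_squared by (simp add: ell2_def norm_\<pi>)

text \<open>The powers of \<open>i\<close> factor out and leave a real identity. Off the diagonal it is the recurrence for
  \<open>a\<close>, where for \<open>j > k\<close> the increments of \<open>h\<close> cancel; on the diagonal the increment \<open>d j\<close> contributes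
  the Wronskian \<open>s (j + 1) a (j + 1) a j c j = 1\<close>.\<close>

lemma green_column:
  assumes h: "\<And>n. n \<le> m \<Longrightarrow> h n - h (Suc n) = d n" and j: "j \<le> m"
  shows "\<i> * green h j k - jac (\<lambda>j. green h j k) j = (if j = k then 1 else 0)"
proof -
  define g where "g j = a j * a k * h (max j k)" for j
  have h_Suc: "h (Suc n) = h n - d n" if "n \<le> m" for n using h[OF that] by simp
  have sd: "s (Suc n) * a (Suc n) * d n = (- 1) ^ n / a n" for n
    using s_a_a_c[of n] a_pos[of n] by (simp add: d_def field_simps)
  have sd': "s (Suc n) * a n * d n = (- 1) ^ n / a (Suc n)" for n
    using s_a_a_c[of n] a_pos[of "Suc n"] by (simp add: d_def field_simps)
  have real: "g j + (if j = 0 then 0 else s j * g (j - 1)) - s (Suc j) * g (Suc j)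
      = (if j = k then (- 1) ^ j else 0)"
  proof (cases j)
    case 0
    have *: "g 0 - s (Suc 0) * g (Suc 0) = (if 0 = k then 1 else 0)"
    proof (cases "k = 0")
      case True
      have "g 0 - s (Suc 0) * g (Suc 0) = a 0 * (a 0 * h 0 - s (Suc 0) * a (Suc 0) * (h 0 - d 0))"
        by (simp add: g_def True h_Suc[of 0] algebra_simps)
      also have "\<dots> = a 0 * ((a 0 - s (Suc 0) * a (Suc 0)) * h 0 + s (Suc 0) * a (Suc 0) * d 0)"
        by (simp add: algebra_simps)
      also have "\<dots> = 1" unfolding sd unfolding a_1 using a_pos[of 0] by simp
      finally show ?thesis by (simp add: True)
    next
      case False
      hence "max 0 k = k" "max (Suc 0) k = k" by auto
      hence "g 0 - s (Suc 0) * g (Suc 0) = a k * h k * (a 0 - s (Suc 0) * a (Suc 0))"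
        by (simp add: g_def algebra_simps)
      thus ?thesis using False by (simp add: a_1)
    qed
    thus ?thesis using 0 by simp
  next
    case (Suc i)
    have rec: "a j + s j * a i - s (Suc j) * a (Suc j) = 0"
      using a_recurrence[of i] Suc by simp
    consider "j < k" | "j = k" | "j > k" by linarith
    hence "g j + s j * g i - s (Suc j) * g (Suc j) = (if j = k then (- 1) ^ j else 0)"
    proof cases
      case 1
      hence "g j + s j * g i - s (Suc j) * g (Suc j) = a k * h k * (a j + s j * a i - s (Suc j) * a (Suc j))"
        using Suc by (simp add: g_def max_def algebra_simps)
      thus ?thesis using 1 rec by simp
    next
      case 2
      have "g j = a j * a j * h j" "g i = a i * a j * h j" "g (Suc j) = a (Suc j) * a j * (h j - d j)"
        using 2 Suc h_Suc[OF j] by (simp_all add: g_def max_def)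
      hence "g j + s j * g i - s (Suc j) * g (Suc j)
          = a j * (h j * (a j + s j * a i - s (Suc j) * a (Suc j)) + s (Suc j) * a (Suc j) * d j)"
        by (simp only:) (simp add: algebra_simps)
      also have "\<dots> = (- 1) ^ j" unfolding rec sd using a_pos[of j] by simp
      finally show ?thesis using 2 by simp
    next
      case 3
      have "h i = h j + d i" using h_Suc[of i] j Suc by simp
      hence "g j = a j * a k * h j" "g i = a i * a k * (h j + d i)" "g (Suc j) = a (Suc j) * a k * (h j - d j)"
        using 3 Suc h_Suc[OF j] by (simp_all add: g_def max_absorb1)
      hence "g j + s j * g i - s (Suc j) * g (Suc j)
          = a k * (h j * (a j + s j * a i - s (Suc j) * a (Suc j)) + s j * a i * d i + s (Suc j) * a (Suc j) * d j)"
        by (simp only:) (simp add: algebra_simps)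
      also have "\<dots> = 0" unfolding rec sd using sd'[of i] Suc by simp
      finally show ?thesis using 3 by simp
    qed
    thus ?thesis using Suc by simp
  qed
  have G: "green h j k = - \<i> * \<i> ^ (j + k) * of_real (g j)" for j
    by (simp add: green_def \<pi>_def g_def power_add)
  have "\<i> * green h j k - jac (\<lambda>j. green h j k) j = \<i> ^ (j + k) *
     of_real (g j + (if j = 0 then 0 else s j * g (j - 1)) - s (Suc j) * g (Suc j))"
    unfolding jac_def G by (cases j) (simp_all add: algebra_simps)
  also have "\<dots> = (if j = k then 1 else 0)"
    unfolding real by (auto simp: mult_2[symmetric] power_mult power_mult_distrib[symmetric])
  finally show ?thesis .
qed

lemma norm_green_le:
  assumes "\<And>n. \<bar>h n\<bar> \<le> 1"
  shows "cmod (green h j k) \<le> cmod (\<pi> j * \<pi> k)"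
  using assms[of "max j k"] by (simp add: green_def norm_mult mult_left_le)

lemma green_row_ell2:
  assumes "\<And>n. \<bar>h n\<bar> \<le> 1"
  shows "green h j \<in> ell2"
  using ell2_comparison[OF ell2_scale[OF \<pi>_ell2, of "\<pi> j"] norm_green_le[OF assms]] .

lemma norm_green_op_le:
  assumes h: "\<And>n. \<bar>h n\<bar> \<le> 1" and x: "x \<in> ell2"
  shows "cmod (green_op h x j) \<le> cmod (of_real (ell2_norm \<pi> * ell2_norm x) * \<pi> j)"
proof -
  have "cmod (green_op h x j) \<le> (\<Sum>k. cmod (green h j k * x k))"
    unfolding green_op_def
    by (rule summable_norm)
       (use ell2_mult_summable[OF green_row_ell2[OF h] x] in \<open>simp add: norm_mult\<close>)
  also have "\<dots> \<le> (\<Sum>k. cmod (\<pi> j) * (cmod (\<pi> k) * cmod (x k)))"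
  proof (rule suminf_le)
    show "cmod (green h j k * x k) \<le> cmod (\<pi> j) * (cmod (\<pi> k) * cmod (x k))" for k
      using mult_right_mono[OF norm_green_le[of h j k, OF h], of "cmod (x k)"] by (simp add: norm_mult mult.assoc)
    show "summable (\<lambda>k. cmod (green h j k * x k))"
      using ell2_mult_summable[OF green_row_ell2[OF h] x] by (simp add: norm_mult)
    show "summable (\<lambda>k. cmod (\<pi> j) * (cmod (\<pi> k) * cmod (x k)))"
      by (intro summable_mult ell2_mult_summable \<pi>_ell2 x)
  qed
  also have "\<dots> = cmod (\<pi> j) * (\<Sum>k. cmod (\<pi> k) * cmod (x k))"
    by (rule suminf_mult[OF ell2_mult_summable[OF \<pi>_ell2 x]])
  also have "\<dots> \<le> cmod (\<pi> j) * (ell2_norm \<pi> * ell2_norm x)"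
    by (intro mult_left_mono ell2_Cauchy_Schwarz_abs \<pi>_ell2 x) simp
  finally show ?thesis
    using ell2_norm_nonneg[OF \<pi>_ell2] ell2_norm_nonneg[OF x] by (simp add: norm_mult mult_ac)
qed

lemma green_op_ell2:
  assumes "\<And>n. \<bar>h n\<bar> \<le> 1" "x \<in> ell2"
  shows "green_op h x \<in> ell2"
  by (rule ell2_comparison[OF ell2_scale[OF \<pi>_ell2] norm_green_op_le[OF assms]])

lemma green_op_lincomb:
  assumes h: "\<And>n. \<bar>h n\<bar> \<le> 1" and x: "x \<in> ell2" and y: "y \<in> ell2"
  shows "green_op h (\<lambda>k. \<alpha> * x k + \<beta> * y k) = (\<lambda>k. \<alpha> * green_op h x k + \<beta> * green_op h y k)"
proof
  fix j
  have s: "summable (\<lambda>k. green h j k * x k)" "summable (\<lambda>k. green h j k * y k)"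
    by (intro ell2_prod_summable green_row_ell2 h x y)+
  have "green_op h (\<lambda>k. \<alpha> * x k + \<beta> * y k) j = (\<Sum>k. \<alpha> * (green h j k * x k) + \<beta> * (green h j k * y k))"
    unfolding green_op_def by (intro suminf_cong) (simp add: algebra_simps)
  also have "\<dots> = \<alpha> * green_op h x j + \<beta> * green_op h y j"
    using s by (simp add: green_op_def suminf_add[symmetric] suminf_mult summable_mult)
  finally show "green_op h (\<lambda>k. \<alpha> * x k + \<beta> * y k) j = \<alpha> * green_op h x j + \<beta> * green_op h y j" .
qed

lemma green_op_solves:
  assumes h: "\<And>n. n \<le> m \<Longrightarrow> h n - h (Suc n) = d n" and j: "j \<le> m"
    and bound: "\<And>n. \<bar>h n\<bar> \<le> 1" and x: "x \<in> ell2"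
  shows "jac (green_op h x) j = \<i> * green_op h x j - x j"
proof -
  have s: "(\<lambda>k. green h i k * x k) sums green_op h x i" for i
    unfolding green_op_def by (intro summable_sums ell2_prod_summable green_row_ell2 bound x)
  have "(\<lambda>k. \<i> * (green h j k * x k) - ((if j = 0 then 0 else of_real (s j) * (green h (j - 1) k * x k))
        + of_real (s (Suc j)) * (green h (Suc j) k * x k))) sums (\<i> * green_op h x j - jac (green_op h x) j)"
    unfolding jac_def
    by (cases "j = 0") (auto intro!: sums_diff sums_add sums_mult s)
  also have "(\<lambda>k. \<i> * (green h j k * x k) - ((if j = 0 then 0 else of_real (s j) * (green h (j - 1) k * x k))
        + of_real (s (Suc j)) * (green h (Suc j) k * x k)))
      = (\<lambda>k. (\<i> * green h j k - jac (\<lambda>j. green h j k) j) * x k)"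
    by (auto simp: jac_def algebra_simps)
  also have "\<dots> = (\<lambda>k. if k = j then x k else 0)"
    by (auto simp: green_column[OF h j])
  finally have "\<i> * green_op h x j - jac (green_op h x) j = x j"
    using sums_single[of j x] sums_unique2 by blast
  thus ?thesis by (simp add: algebra_simps)
qed

text \<open>The rows of the kernel are square summable, so the coordinates converge weakly; the common bound
  by a multiple of \<open>\<pi>\<close> upgrades this to convergence in norm.\<close>

lemma green_op_compact:
  assumes h: "\<And>n. \<bar>h n\<bar> \<le> 1" and u: "\<And>n. u n \<in> ell2" "\<And>n. ell2_norm (u n) \<le> 1"
    and conv: "\<And>k. (\<lambda>n. u n k) \<longlonglongrightarrow> x k"
  shows "ell2_tendsto (\<lambda>n. green_op h (u n)) (green_op h x)"
proof (rule ell2_tendsto_dominated(2))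
  show "(\<lambda>n. green_op h (u n) k) \<longlonglongrightarrow> green_op h x k" for k
    using ell2_weak[OF conv u green_row_ell2[OF h]] by (simp add: green_op_def mult.commute)
  show "(\<lambda>j. of_real (ell2_norm \<pi>) * \<pi> j) \<in> ell2" by (rule ell2_scale[OF \<pi>_ell2])
  show "cmod (green_op h (u n) k) \<le> cmod (of_real (ell2_norm \<pi>) * \<pi> k)" for n k
  proof -
    have "ell2_norm \<pi> * ell2_norm (u n) \<le> ell2_norm \<pi>"
      by (intro mult_left_le u ell2_norm_nonneg \<pi>_ell2)
    hence "cmod (of_real (ell2_norm \<pi> * ell2_norm (u n)) * \<pi> k) \<le> cmod (of_real (ell2_norm \<pi>) * \<pi> k)"
      using ell2_norm_nonneg[OF \<pi>_ell2] ell2_norm_nonneg[OF u(1)[of n]]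
      by (simp add: norm_mult mult_right_mono)
    thus ?thesis using norm_green_op_le[of h "u n" k, OF h u(1)] by linarith
  qed
qed

lemma green_op_tendsto:
  assumes hm: "\<And>m n. \<bar>hm m n\<bar> \<le> 1" and conv: "\<And>n. (\<lambda>m. hm m n) \<longlonglongrightarrow> h n"
    and x: "x \<in> ell2"
  shows "ell2_tendsto (\<lambda>m. green_op (hm m) x) (green_op h x)"
proof (rule ell2_tendsto_dominated(2))
  show "(\<lambda>m. green_op (hm m) x j) \<longlonglongrightarrow> green_op h x j" for j
  proof -
    have g: "(\<lambda>m. green (hm m) j k) \<longlonglongrightarrow> green h j k" for k
      unfolding green_def by (intro tendsto_intros conv)
    have b: "cmod (green (hm m) j k) \<le> cmod (\<pi> j * \<pi> k)" for m k
      by (rule norm_green_le[OF hm])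
    note row = ell2_tendsto_dominated[OF g ell2_scale[OF \<pi>_ell2] b]
    have "(\<lambda>m. ell2_inner (green (hm m) j) (\<lambda>k. cnj (x k))) \<longlonglongrightarrow> ell2_inner (green h j) (\<lambda>k. cnj (x k))"
      by (intro ell2_tendsto_inner row ell2_tendsto_const ell2_cnj x green_row_ell2 hm)
    thus ?thesis by (simp add: green_op_def ell2_inner_def)
  qed
  show "(\<lambda>j. of_real (ell2_norm \<pi> * ell2_norm x) * \<pi> j) \<in> ell2" by (rule ell2_scale[OF \<pi>_ell2])
  show "cmod (green_op (hm m) x k) \<le> cmod (of_real (ell2_norm \<pi> * ell2_norm x) * \<pi> k)" for m k
    by (rule norm_green_op_le[OF hm x])
qed

subsection \<open>The truncated resolvents\<close>

text \<open>The solution of \<open>h n - h (n + 1) = d n\<close> for \<open>n \<le> m\<close> that vanishes beyond \<open>m\<close>; its Green kernel is the matrix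
  of \<open>Y\<^sup>(\<^sup>m\<^sup>)\<close>.\<close>

definition h_trunc :: "nat \<Rightarrow> nat \<Rightarrow> real" where
  "h_trunc m k = (\<Sum>n=k..m. d n)"

lemma h_trunc_step: "n \<le> m \<Longrightarrow> h_trunc m n - h_trunc m (Suc n) = d n"
  by (simp add: h_trunc_def sum.atLeast_Suc_atMost)

text \<open>Tails of an alternating sum with decreasing terms lie between zero and their first term.\<close>

lemma h_trunc_alternating: "0 \<le> (- 1) ^ k * h_trunc m k \<and> (- 1) ^ k * h_trunc m k \<le> c k"
proof (induction "Suc m - k" arbitrary: k)
  case 0
  thus ?case using c_pos[of k] by (simp add: h_trunc_def)
next
  case (Suc i)
  hence "k \<le> m" by simp
  have "(- 1) ^ k * h_trunc m k = (- 1) ^ k * d k - (- 1) ^ Suc k * h_trunc m (Suc k)"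
    using h_trunc_step[OF \<open>k \<le> m\<close>] by (simp add: algebra_simps flip: distrib_left)
  also have "(- 1) ^ k * d k = c k" by (simp add: d_def mult.assoc[symmetric] flip: power_mult_distrib)
  finally show ?case
    using Suc(1)[of "Suc k"] Suc(2) c_antimono[of k "Suc k"] by force
qed

lemma h_trunc_bound: "\<bar>h_trunc m k\<bar> \<le> 1"
proof -
  have "\<bar>h_trunc m k\<bar> = \<bar>(- 1) ^ k * h_trunc m k\<bar>" by (simp add: abs_mult)
  thus ?thesis using h_trunc_alternating[of k m] c_le_1[of k] by linarith
qed

lemma green_op_trunc_vanishes: "k > m \<Longrightarrow> green_op (h_trunc m) x k = 0"
  by (simp add: green_op_def green_def h_trunc_def)

text \<open>A kernel vector \<open>u\<close> satisfies \<open>X\<^sub>m u = i u\<close>, so \<open>i \<parallel>u\<parallel>\<^sup>2 = - i \<parallel>u\<parallel>\<^sup>2\<close> by symmetry.\<close>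

lemma truncated_inj:
  "inj_on (\<lambda>y k. \<i> * y k - truncated_jacobi \<omega> m y k) {y. \<forall>k>m. y k = 0}"
proof (rule inj_onI)
  fix y z assume y: "y \<in> {y. \<forall>k>m. y k = 0}" and z: "z \<in> {y. \<forall>k>m. y k = 0}"
    and eq: "(\<lambda>k. \<i> * y k - truncated_jacobi \<omega> m y k) = (\<lambda>k. \<i> * z k - truncated_jacobi \<omega> m z k)"
  define u where "u = (\<lambda>k. 1 * y k + (- 1) * z k)"
  have u: "u k = 0" if "k > m" for k using that y z by (simp add: u_def)
  have ju: "jac u k = \<i> * u k" if "k \<le> m" for k
  proof -
    have "\<i> * y k - jac y k = \<i> * z k - jac z k"
      using fun_cong[OF eq, of k] y z that by (simp add: truncated_jacobi_eq)
    thus ?thesis unfolding u_def jac_lincomb by (simp add: algebra_simps)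
  qed
  have "(\<Sum>k\<le>m. jac u k * cnj (u k)) = (\<Sum>k\<le>m. u k * jac (\<lambda>k. cnj (u k)) k)"
    by (rule jac_symmetric) (auto simp: u)
  moreover have "(\<Sum>k\<le>m. jac u k * cnj (u k)) = (\<Sum>k\<le>m. \<i> * (u k * cnj (u k)))"
    by (intro sum.cong) (simp_all add: ju)
  moreover have "(\<Sum>k\<le>m. u k * jac (\<lambda>k. cnj (u k)) k) = (\<Sum>k\<le>m. - \<i> * (u k * cnj (u k)))"
    by (intro sum.cong) (simp_all add: ju jac_cnj)
  ultimately have "(\<Sum>k\<le>m. \<i> * (u k * cnj (u k))) = (\<Sum>k\<le>m. - \<i> * (u k * cnj (u k)))"
    by simp
  hence "(\<Sum>k\<le>m. u k * cnj (u k)) = 0"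
    by (simp add: sum_distrib_left[symmetric] sum_negf)
  hence "(\<Sum>k\<le>m. (cmod (u k))\<^sup>2) = 0"
    unfolding complex_norm_square[symmetric] of_real_sum[symmetric] by (simp only: of_real_eq_0_iff)
  hence "u k = 0" if "k \<le> m" for k using that by (subst (asm) sum_nonneg_eq_0_iff) auto
  hence "u k = 0" for k using u by (cases "k \<le> m") auto
  thus "y = z" by (auto simp: u_def fun_eq_iff)
qed

lemma Y_trunc_eqI:
  assumes "\<And>k. k > m \<Longrightarrow> y k = 0" "\<And>k. k \<le> m \<Longrightarrow> \<i> * y k - jac y k = x k"
  shows "Y_trunc \<omega> m x = y"
  unfolding Y_trunc_def
  by (rule inv_into_f_eq[OF truncated_inj]) (use assms in \<open>auto simp: truncated_jacobi_eq\<close>)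

lemma Y_trunc_eq:
  assumes "x \<in> ell2"
  shows "Y_trunc \<omega> m x = green_op (h_trunc m) x"
  by (rule Y_trunc_eqI)
     (auto simp: green_op_trunc_vanishes green_op_solves[OF h_trunc_step _ h_trunc_bound assms])

text \<open>The matrix of the truncated resolvent is symmetric, without complex conjugation.\<close>

lemma trunc_bilinear:
  assumes x: "x \<in> ell2" and v: "v \<in> ell2"
  shows "(\<Sum>k. green_op (h_trunc m) x k * v k) = (\<Sum>k. x k * green_op (h_trunc m) v k)"
proof -
  let ?u = "green_op (h_trunc m) x" and ?w = "green_op (h_trunc m) v"
  have "(\<Sum>k\<le>m. jac ?u k * ?w k) = (\<Sum>k\<le>m. ?u k * jac ?w k)"
    by (rule jac_symmetric) (simp_all add: green_op_trunc_vanishes)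
  moreover have "(\<Sum>k\<le>m. jac ?u k * ?w k) = (\<Sum>k\<le>m. \<i> * (?u k * ?w k) - x k * ?w k)"
    by (intro sum.cong) (simp_all add: green_op_solves[OF h_trunc_step _ h_trunc_bound] x algebra_simps)
  moreover have "(\<Sum>k\<le>m. ?u k * jac ?w k) = (\<Sum>k\<le>m. \<i> * (?u k * ?w k) - ?u k * v k)"
    by (intro sum.cong) (simp_all add: green_op_solves[OF h_trunc_step _ h_trunc_bound] v algebra_simps)
  ultimately have "(\<Sum>k\<le>m. \<i> * (?u k * ?w k) - x k * ?w k) = (\<Sum>k\<le>m. \<i> * (?u k * ?w k) - ?u k * v k)"
    by simp
  hence "(\<Sum>k\<le>m. x k * ?w k) = (\<Sum>k\<le>m. ?u k * v k)" by (simp add: sum_subtractf)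
  moreover have "(\<Sum>k. ?u k * v k) = (\<Sum>k\<le>m. ?u k * v k)"
    by (rule suminf_finite) (auto simp: green_op_trunc_vanishes)
  moreover have "(\<Sum>k. x k * ?w k) = (\<Sum>k\<le>m. x k * ?w k)"
    by (rule suminf_finite) (auto simp: green_op_trunc_vanishes)
  ultimately show ?thesis by simp
qed

text \<open>Green's formula for \<open>Y\<^sup>(\<^sup>m\<^sup>)x\<close> and the conjugate of \<open>Y\<^sup>(\<^sup>m\<^sup>)y\<close>, where the boundary term vanishes.\<close>

lemma trunc_resolvent_identity:
  assumes x: "x \<in> ell2" and y: "y \<in> ell2"
  shows "2 * \<i> * ell2_inner (green_op (h_trunc m) x) (green_op (h_trunc m) y)
    = ell2_inner x (green_op (h_trunc m) y) - ell2_inner (green_op (h_trunc m) x) y"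
proof -
  let ?u = "green_op (h_trunc m) x" and ?w = "green_op (h_trunc m) y"
  have "(\<Sum>k\<le>m. jac ?u k * cnj (?w k)) = (\<Sum>k\<le>m. ?u k * jac (\<lambda>k. cnj (?w k)) k)"
    by (rule jac_symmetric) (simp_all add: green_op_trunc_vanishes)
  moreover have "(\<Sum>k\<le>m. jac ?u k * cnj (?w k)) = (\<Sum>k\<le>m. \<i> * (?u k * cnj (?w k)) - x k * cnj (?w k))"
    by (intro sum.cong) (simp_all add: green_op_solves[OF h_trunc_step _ h_trunc_bound] x algebra_simps)
  moreover have "(\<Sum>k\<le>m. ?u k * jac (\<lambda>k. cnj (?w k)) k)
      = (\<Sum>k\<le>m. - \<i> * (?u k * cnj (?w k)) - ?u k * cnj (y k))"
    by (intro sum.cong)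
       (simp_all add: jac_cnj green_op_solves[OF h_trunc_step _ h_trunc_bound] y algebra_simps)
  ultimately have "(\<Sum>k\<le>m. \<i> * (?u k * cnj (?w k)) - x k * cnj (?w k))
      = (\<Sum>k\<le>m. - \<i> * (?u k * cnj (?w k)) - ?u k * cnj (y k))"
    by simp
  hence "2 * \<i> * (\<Sum>k\<le>m. ?u k * cnj (?w k)) = (\<Sum>k\<le>m. x k * cnj (?w k)) - (\<Sum>k\<le>m. ?u k * cnj (y k))"
    by (simp add: sum_subtractf sum_negf sum_distrib_left[symmetric] algebra_simps)
  moreover have "ell2_inner ?u ?w = (\<Sum>k\<le>m. ?u k * cnj (?w k))"
    unfolding ell2_inner_def by (rule suminf_finite) (auto simp: green_op_trunc_vanishes)
  moreover have "ell2_inner ?u y = (\<Sum>k\<le>m. ?u k * cnj (y k))"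
    unfolding ell2_inner_def by (rule suminf_finite) (auto simp: green_op_trunc_vanishes)
  moreover have "ell2_inner x ?w = (\<Sum>k\<le>m. x k * cnj (?w k))"
    unfolding ell2_inner_def by (rule suminf_finite) (auto simp: green_op_trunc_vanishes)
  ultimately show ?thesis by simp
qed

end

section \<open>Orthogonal polynomials and eigenvectors\<close>

fun monic_poly :: "(nat \<Rightarrow> real) \<Rightarrow> nat \<Rightarrow> real poly" where
  "monic_poly \<omega> 0 = 1"
| "monic_poly \<omega> (Suc 0) = [:0, 1:]"
| "monic_poly \<omega> (Suc (Suc n)) = [:0, 1:] * monic_poly \<omega> (Suc n) - smult (\<omega> (Suc n)) (monic_poly \<omega> n)"

lemma coeff_monic_poly:
  "poly.coeff (monic_poly \<omega> n) n = 1 \<and> (\<forall>k>n. poly.coeff (monic_poly \<omega> n) k = 0)"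
proof (induction \<omega> n rule: monic_poly.induct)
  case (3 \<omega> n)
  thus ?case by (auto simp: coeff_pCons split: nat.splits)
qed (auto simp: coeff_pCons split: nat.splits)

lemma degree_monic_poly: "degree (monic_poly \<omega> n) = n"
  and lead_coeff_monic_poly: "lead_coeff (monic_poly \<omega> n) = 1"
proof -
  show d: "degree (monic_poly \<omega> n) = n"
    using coeff_monic_poly[of \<omega> n]
    by (intro antisym degree_le le_degree) auto
  show "lead_coeff (monic_poly \<omega> n) = 1"
    unfolding d using coeff_monic_poly by blast
qed

context jacobi_SC
begin

text \<open>The formal eigenvector at \<open>t\<close>: the orthonormal polynomials, normalised by \<open>\<parallel>P\<^sub>n\<parallel>\<^sup>2 = \<omega>\<^sub>1 \<cdots> \<omega>\<^sub>n\<close>.\<close>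

definition poly_vec :: "real \<Rightarrow> vec" where
  "poly_vec t n = of_real (poly (monic_poly \<omega> n) t / sqrt (W n))"

lemma poly_vec_0: "poly_vec t 0 = 1"
  by (simp add: poly_vec_def)

lemma cnj_poly_vec: "cnj (poly_vec t n) = poly_vec t n"
  by (simp add: poly_vec_def)

lemma s_poly_vec_Suc: "of_real (s (Suc n)) * poly_vec t (Suc n) = of_real (poly (monic_poly \<omega> (Suc n)) t / sqrt (W n))"
  using s_pos[of n] by (simp add: poly_vec_def sqrt_W_Suc)

lemma jac_poly_vec: "jac (poly_vec t) = (\<lambda>n. of_real t * poly_vec t n)"
proof
  fix n
  show "jac (poly_vec t) n = of_real t * poly_vec t n"
  proof (cases n)
    case 0
    thus ?thesis using s_poly_vec_Suc[of 0 t] by (simp add: jac_def poly_vec_0)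
  next
    case (Suc m)
    have "s (Suc m) * (poly (monic_poly \<omega> m) t / sqrt (W m))
        = \<omega> (Suc m) * poly (monic_poly \<omega> m) t / sqrt (W (Suc m))"
      using s_pos[of m] W_pos[of m] pos[of "Suc m"]
      by (simp add: sqrt_W_Suc s_def field_simps flip: power2_eq_square)
    hence "of_real (s (Suc m)) * poly_vec t m
        = complex_of_real (\<omega> (Suc m) * poly (monic_poly \<omega> m) t / sqrt (W (Suc m)))"
      unfolding poly_vec_def of_real_mult[symmetric] by simp
    thus ?thesis
      unfolding Suc jac_def s_poly_vec_Suc
      by (simp add: poly_vec_def diff_divide_distrib)
  qed
qed

text \<open>The recurrence determines all coordinates from the first one.\<close>

lemma jac_eigenvector_unique:
  assumes "jac w = (\<lambda>n. of_real t * w n)"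
  shows "w n = w 0 * poly_vec t n"
proof -
  have rec: "of_real (s (Suc n)) * w (Suc n) = of_real t * w n - (if n = 0 then 0 else of_real (s n) * w (n - 1))" for n
    using fun_cong[OF assms, of n] by (simp add: jac_def algebra_simps)
  have recp: "of_real (s (Suc n)) * poly_vec t (Suc n) = of_real t * poly_vec t n - (if n = 0 then 0 else of_real (s n) * poly_vec t (n - 1))" for n
    using fun_cong[OF jac_poly_vec, of t n] by (simp add: jac_def algebra_simps)
  have "w n = w 0 * poly_vec t n \<and> w (Suc n) = w 0 * poly_vec t (Suc n)"
  proof (induction n)
    case 0
    have "of_real (s (Suc 0)) * w (Suc 0) = of_real (s (Suc 0)) * (w 0 * poly_vec t (Suc 0))"
      using rec[of 0] recp[of 0] by (simp add: poly_vec_0 mult.left_commute)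
    thus ?case using s_pos[of 0] by (simp add: poly_vec_0)
  next
    case (Suc n)
    have "of_real (s (Suc (Suc n))) * w (Suc (Suc n))
        = w 0 * (of_real t * poly_vec t (Suc n) - of_real (s (Suc n)) * poly_vec t n)"
      using rec[of "Suc n"] Suc by (simp add: algebra_simps)
    also have "\<dots> = of_real (s (Suc (Suc n))) * (w 0 * poly_vec t (Suc (Suc n)))"
      using recp[of "Suc n"] by (simp add: mult.left_commute)
    finally show ?case using Suc s_pos[of "Suc n"] by simp
  qed
  thus ?thesis ..
qed

text \<open>Apply the product of the operators \<open>X - t\<close>, \<open>t \<in> F\<close>, to the first basis vector. Each factor moves the
  last nonzero coordinate one step up, so the result is nonzero, and the factor for \<open>t\<close> makes it
  orthogonal to the eigenvector at \<open>t\<close>. It is the reason why the set of eigenvalues is infinite.\<close>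

lemma ex_finite_orthogonal:
  assumes "finite F"
  shows "\<exists>u. finite {k. u k \<noteq> 0} \<and> u \<noteq> (\<lambda>k. 0) \<and> (\<forall>t\<in>F. poly_vec t \<in> ell2 \<longrightarrow> ell2_inner u (poly_vec t) = 0)"
  using assms
proof (induction F rule: finite_induct)
  case empty
  have "finite {k. delta 0 k \<noteq> 0}" by (auto simp: delta_def intro: finite_subset[of _ "{0}"])
  moreover have "delta 0 \<noteq> (\<lambda>k. 0)" by (auto simp: delta_def fun_eq_iff)
  ultimately show ?case by blast
next
  case (insert l F)
  then obtain u where u: "finite {k. u k \<noteq> 0}" "u \<noteq> (\<lambda>k. 0)"
    "\<forall>t\<in>F. poly_vec t \<in> ell2 \<longrightarrow> ell2_inner u (poly_vec t) = 0" by blast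
  define v where "v = (\<lambda>k. jac u k - of_real l * u k)"
  have "{k. v k \<noteq> 0} \<subseteq> {k. jac u k \<noteq> 0} \<union> {k. u k \<noteq> 0}" by (auto simp: v_def)
  hence v_fin: "finite {k. v k \<noteq> 0}"
    using u(1) finite_support_jac[OF u(1)] by (meson finite_Un finite_subset)
  define n where "n = Max {k. u k \<noteq> 0}"
  have "{k. u k \<noteq> 0} \<noteq> {}" using u(2) by auto
  hence "u n \<noteq> 0" using Max_in[OF u(1)] by (simp add: n_def)
  moreover have "u k = 0" if "k > n" for k
    using Max_ge[OF u(1), of k] that by (force simp: n_def)
  ultimately have "v (Suc n) \<noteq> 0" using s_pos[of n] by (simp add: v_def jac_def)
  hence v0: "v \<noteq> (\<lambda>k. 0)" by auto
  have ell2: "u \<in> ell2" "jac u \<in> ell2"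
    using u(1) finite_support_jac by (auto intro: ell2_finite_support)
  have "ell2_inner v (poly_vec t) = 0" if t: "t \<in> insert l F" "poly_vec t \<in> ell2" for t
  proof -
    have "(u, jac u) \<in> jacobi_op \<omega>" using u(1) by (auto simp: jacobi_op_eq)
    moreover have "(poly_vec t, jac (poly_vec t)) \<in> adjoint_op (jacobi_op \<omega>)"
      using t(2) by (auto simp: adjoint_jacobi_op jac_poly_vec ell2_scale)
    ultimately have "ell2_inner (jac u) (poly_vec t) = ell2_inner u (jac (poly_vec t))"
      by (auto simp: adjoint_op_def)
    hence "ell2_inner v (poly_vec t) = (of_real t - of_real l) * ell2_inner u (poly_vec t)"
      using ell2 t(2) unfolding v_def
      by (simp add: jac_poly_vec ell2_inner_diff_left ell2_inner_scale_left ell2_inner_scale_right ell2_scale algebra_simps)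
    thus ?thesis using t u(3) by auto
  qed
  thus ?case using v_fin v0 by blast
qed

end

section \<open>The self-adjoint extension attached to a limit of truncations\<close>

lemma i_minus_real_nonzero: "\<i> - complex_of_real t \<noteq> 0"
  by (simp add: complex_eq_iff)

text \<open>A subsequence \<open>N\<close> of truncations along which the upper left entries of the resolvents converge. The
  even and the odd truncations are the two instances used.\<close>

locale jacobi_limit = jacobi_SC +
  fixes \<sigma> :: real and N :: "nat \<Rightarrow> nat"
  assumes N: "filterlim N at_top sequentially"
    and conv: "(\<lambda>i. \<Sum>n\<le>N i. d n) \<longlonglongrightarrow> \<sigma>"
begin

definition h :: "nat \<Rightarrow> real" where
  "h k = \<sigma> - (\<Sum>n<k. d n)"

lemma h_step: "h n - h (Suc n) = d n"
  by (simp add: h_def)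

lemma h_trunc_tendsto: "(\<lambda>i. h_trunc (N i) k) \<longlonglongrightarrow> h k"
proof -
  have "\<forall>\<^sub>F i in sequentially. k \<le> N i"
    using N by (auto simp: filterlim_at_top)
  hence "\<forall>\<^sub>F i in sequentially. (\<Sum>n\<le>N i. d n) - (\<Sum>n<k. d n) = h_trunc (N i) k"
  proof eventually_elim
    case (elim i)
    have "(\<Sum>n\<le>N i. d n) = (\<Sum>n<k. d n) + (\<Sum>n=k..N i. d n)"
      using elim by (subst sum.union_disjoint[symmetric]) (auto intro!: sum.cong)
    thus ?case by (simp add: h_trunc_def)
  qed
  moreover have "(\<lambda>i. (\<Sum>n\<le>N i. d n) - (\<Sum>n<k. d n)) \<longlonglongrightarrow> h k"
    unfolding h_def by (intro tendsto_intros conv)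
  ultimately show ?thesis by (rule Lim_transform_eventually[rotated])
qed

lemma h_bound: "\<bar>h k\<bar> \<le> 1"
  by (rule LIMSEQ_le_const2[OF tendsto_rabs[OF h_trunc_tendsto]]) (use h_trunc_bound in auto)

definition Y :: "vec \<Rightarrow> vec" where
  "Y = green_op h"

text \<open>The adjoint of \<open>Y\<close>; since the kernel is symmetric, it is the entrywise conjugate.\<close>

definition Z :: "vec \<Rightarrow> vec" where
  "Z y = (\<lambda>k. cnj (Y (\<lambda>k. cnj (y k)) k))"

definition X :: operator where
  "X = op_restrict (adjoint_op (jacobi_op \<omega>)) (Range (strong_limit (\<lambda>i. Y_trunc \<omega> (N i))))"

lemma trunc_tendsto: "x \<in> ell2 \<Longrightarrow> ell2_tendsto (\<lambda>i. green_op (h_trunc (N i)) x) (Y x)"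
  unfolding Y_def by (rule green_op_tendsto[OF h_trunc_bound h_trunc_tendsto])

lemma trunc_ell2: "x \<in> ell2 \<Longrightarrow> green_op (h_trunc m) x \<in> ell2"
  by (rule green_op_ell2[OF h_trunc_bound])

lemma Y_ell2: "x \<in> ell2 \<Longrightarrow> Y x \<in> ell2"
  unfolding Y_def by (rule green_op_ell2[OF h_bound])

lemma Z_ell2: "x \<in> ell2 \<Longrightarrow> Z x \<in> ell2"
  unfolding Z_def by (intro ell2_cnj Y_ell2)

lemma jac_Y: "x \<in> ell2 \<Longrightarrow> jac (Y x) = (\<lambda>j. \<i> * Y x j - x j)"
  unfolding Y_def by (rule ext) (rule green_op_solves[OF h_step order_refl h_bound])

lemma Y_adjoint:
  assumes x: "x \<in> ell2" and y: "y \<in> ell2"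
  shows "ell2_inner (Y x) y = ell2_inner x (Z y)"
proof (rule LIMSEQ_unique)
  note lims = trunc_tendsto trunc_ell2 Y_ell2 ell2_tendsto_const ell2_cnj x y
  show "(\<lambda>i. ell2_inner (green_op (h_trunc (N i)) x) y) \<longlonglongrightarrow> ell2_inner (Y x) y"
    by (intro ell2_tendsto_inner lims)
  have "(\<lambda>i. ell2_inner (green_op (h_trunc (N i)) (\<lambda>k. cnj (y k))) (\<lambda>k. cnj (x k)))
      \<longlonglongrightarrow> ell2_inner (Y (\<lambda>k. cnj (y k))) (\<lambda>k. cnj (x k))"
    by (intro ell2_tendsto_inner lims)
  moreover have "ell2_inner (green_op (h_trunc m) (\<lambda>k. cnj (y k))) (\<lambda>k. cnj (x k)) = ell2_inner (green_op (h_trunc m) x) y" for m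
    using trunc_bilinear[OF ell2_cnj[OF y] x, of m] by (simp add: ell2_inner_def mult.commute)
  moreover have "ell2_inner (Y (\<lambda>k. cnj (y k))) (\<lambda>k. cnj (x k)) = ell2_inner x (Z y)"
    by (simp add: ell2_inner_def Z_def mult.commute)
  ultimately show "(\<lambda>i. ell2_inner (green_op (h_trunc (N i)) x) y) \<longlonglongrightarrow> ell2_inner x (Z y)"
    by simp
qed

lemma resolvent_identity:
  assumes x: "x \<in> ell2" and y: "y \<in> ell2"
  shows "2 * \<i> * ell2_inner (Y x) (Y y) = ell2_inner x (Y y) - ell2_inner (Y x) y"
proof (rule LIMSEQ_unique)
  note lims = tendsto_intros ell2_tendsto_inner trunc_tendsto trunc_ell2 Y_ell2 ell2_tendsto_const x y
  show "(\<lambda>i. 2 * \<i> * ell2_inner (green_op (h_trunc (N i)) x) (green_op (h_trunc (N i)) y))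
      \<longlonglongrightarrow> 2 * \<i> * ell2_inner (Y x) (Y y)"
    by (intro lims)
  show "(\<lambda>i. 2 * \<i> * ell2_inner (green_op (h_trunc (N i)) x) (green_op (h_trunc (N i)) y))
      \<longlonglongrightarrow> ell2_inner x (Y y) - ell2_inner (Y x) y"
    unfolding trunc_resolvent_identity[OF x y] by (intro lims)
qed

lemma ZY: assumes x: "x \<in> ell2" shows "2 * \<i> * Z (Y x) k = Z x k - Y x k"
proof -
  have "2 * \<i> * ell2_inner (Y (delta k)) (Y x) = ell2_inner (delta k) (Y x) - ell2_inner (Y (delta k)) x"
    by (rule resolvent_identity[OF ell2_delta x])
  hence "2 * \<i> * cnj (Z (Y x) k) = cnj (Y x k) - cnj (Z x k)"
    using x by (simp add: Y_adjoint ell2_delta Y_ell2 ell2_inner_delta_left)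
  hence "cnj (2 * \<i> * cnj (Z (Y x) k)) = cnj (cnj (Y x k) - cnj (Z x k))" by simp
  thus ?thesis by (simp add: algebra_simps)
qed

text \<open>Conjugate the previous identity: \<open>Z\<close> is \<open>Y\<close> conjugated by entrywise complex conjugation.\<close>

lemma YZ: assumes x: "x \<in> ell2" shows "2 * \<i> * Y (Z x) k = Z x k - Y x k"
proof -
  have "2 * \<i> * Z (Y (\<lambda>k. cnj (x k))) k = Z (\<lambda>k. cnj (x k)) k - Y (\<lambda>k. cnj (x k)) k"
    by (rule ZY[OF ell2_cnj[OF x]])
  hence "2 * \<i> * cnj (Y (Z x) k) = cnj (Y x k) - cnj (Z x k)"
    by (simp add: Z_def)
  hence "cnj (2 * \<i> * cnj (Y (Z x) k)) = cnj (cnj (Y x k) - cnj (Z x k))" by simp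
  thus ?thesis by (simp add: algebra_simps)
qed

sublocale R: compact_resolvent_at_i Y Z
proof
  show "x = (\<lambda>k. 0)" if "x \<in> ell2" "Y x = (\<lambda>k. 0)" for x
  proof -
    have "jac (Y x) k = 0" for k unfolding that(2) by (simp add: jac_def)
    moreover have "Y x k = 0" for k using that(2) by simp
    ultimately have "x k = 0" for k using fun_cong[OF jac_Y[OF that(1)], of k] by simp
    thus ?thesis by auto
  qed
  show "Y (\<lambda>k. a * x k + b * y k) = (\<lambda>k. a * Y x k + b * Y y k)" if "x \<in> ell2" "y \<in> ell2" for x y a b
    unfolding Y_def by (rule green_op_lincomb[OF h_bound that])
  show "ell2_tendsto (\<lambda>n. Y (u n)) (Y x)"
    if "\<And>n. u n \<in> ell2" "\<And>n. ell2_norm (u n) \<le> 1" "\<And>k. (\<lambda>n. u n k) \<longlonglongrightarrow> x k" for u x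
    unfolding Y_def by (rule green_op_compact[OF h_bound that])
qed (auto simp: Y_ell2 Z_ell2 Y_adjoint ZY YZ)

lemma strong_limit_eq: "strong_limit (\<lambda>i. Y_trunc \<omega> (N i)) = {(x, Y x) |x. x \<in> ell2}"
proof (intro equalityI subrelI)
  fix x y assume "(x, y) \<in> strong_limit (\<lambda>i. Y_trunc \<omega> (N i))"
  hence x: "x \<in> ell2" and y: "y \<in> ell2" and "ell2_tendsto (\<lambda>i. green_op (h_trunc (N i)) x) y"
    by (auto simp: strong_limit_def Y_trunc_eq)
  hence "y = Y x"
    using ell2_tendsto_unique[OF _ trunc_tendsto[OF x] trunc_ell2[OF x] y Y_ell2[OF x]] by blast
  thus "(x, y) \<in> {(x, Y x) |x. x \<in> ell2}" using x by blast
next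
  fix x y assume "(x, y) \<in> {(x, Y x) |x. x \<in> ell2}"
  thus "(x, y) \<in> strong_limit (\<lambda>i. Y_trunc \<omega> (N i))"
    by (auto simp: strong_limit_def Y_trunc_eq Y_ell2 trunc_tendsto)
qed

lemma X_eq: "X = R.T"
  unfolding X_def R.T_def op_restrict_def adjoint_jacobi_op strong_limit_eq
  by (auto simp: jac_Y R.Y_shift_ell2 Y_ell2)

text \<open>The truncated resolvent of \<open>i x - X x\<close> equals \<open>x\<close> as soon as the truncation contains the support.\<close>

lemma jacobi_op_subset_X: "jacobi_op \<omega> \<subseteq> X"
proof (rule subrelI)
  fix x y assume "(x, y) \<in> jacobi_op \<omega>"
  hence fin: "finite {k. x k \<noteq> 0}" and y: "y = jac x" by (auto simp: jacobi_op_eq)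
  have ell2: "x \<in> ell2" "jac x \<in> ell2"
    using fin finite_support_jac by (auto intro: ell2_finite_support)
  define z where "z = (\<lambda>k. \<i> * x k - jac x k)"
  have z: "z \<in> ell2" unfolding z_def by (intro ell2_diff ell2_scale ell2)
  obtain n where "\<forall>k\<in>{k. x k \<noteq> 0}. k < n" using finite_nat_set_iff_bounded fin by metis
  hence n: "x k = 0" if "k \<ge> n" for k using that by force
  have "\<forall>\<^sub>F i in sequentially. n \<le> N i" using N by (auto simp: filterlim_at_top)
  hence "\<forall>\<^sub>F i in sequentially. ell2_norm (\<lambda>k. green_op (h_trunc (N i)) z k - x k) = 0"
  proof eventually_elim
    case (elim i)
    have "Y_trunc \<omega> (N i) z = x"
      by (rule Y_trunc_eqI) (use n elim in \<open>auto simp: z_def\<close>)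
    thus ?case by (simp add: Y_trunc_eq z ell2_norm_zero)
  qed
  hence "ell2_tendsto (\<lambda>i. green_op (h_trunc (N i)) z) x"
    unfolding ell2_tendsto_def by (rule tendsto_eventually)
  hence "Y z = x"
    using ell2_tendsto_unique[OF trunc_tendsto[OF z] _ trunc_ell2[OF z] Y_ell2[OF z] ell2(1)] by blast
  thus "(x, y) \<in> X" using ell2 by (simp add: X_eq R.mem_T_iff y z_def)
qed

lemma self_adjoint_X: "self_adjoint_op X"
  unfolding self_adjoint_op_def
proof (intro conjI)
  show "linear_operator X" "adjoint_op X = X"
    unfolding X_eq by (rule R.linear_operator_T, rule R.adjoint_T)
  show "ell2_dense (Domain X)"
    unfolding ell2_dense_def
  proof (intro conjI ballI allI impI)
    show "Domain X \<subseteq> ell2" by (auto simp: X_eq R.mem_T_iff)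
    fix x e assume x: "x \<in> ell2" and e: "(e::real) > 0"
    define u where "u n = (\<lambda>k. if k < n then x k else 0)" for n
    have "(\<lambda>n. u n k) \<longlonglongrightarrow> x k" for k
      by (rule tendsto_eventually) (use eventually_gt_at_top[of k] in \<open>eventually_elim, simp add: u_def\<close>)
    hence "ell2_tendsto u x"
      by (rule ell2_tendsto_dominated(2)[OF _ x]) (simp add: u_def)
    hence "\<forall>\<^sub>F n in sequentially. ell2_norm (\<lambda>k. u n k - x k) < e"
      unfolding ell2_tendsto_def using e by (rule order_tendstoD(2))
    then obtain n where n: "ell2_norm (\<lambda>k. u n k - x k) < e"
      by (auto simp: eventually_sequentially)
    have "finite {k. u n k \<noteq> 0}" by (rule finite_subset[of _ "{..<n}"]) (auto simp: u_def)
    hence "u n \<in> Domain X" using jacobi_op_subset_X by (auto simp: jacobi_op_eq)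
    thus "\<exists>d\<in>Domain X. ell2_norm (\<lambda>k. x k - d k) < e"
      using n ell2_norm_minus[of x "u n"] by (intro bexI[of _ "u n"]) auto
  qed
qed

text \<open>The upper left entry of the Green kernel.\<close>

lemma Stieltjes_transform_X:
  "ell2_inner (op_apply (resolvent \<i> X) (delta 0)) (delta 0) = - \<i> * of_real \<sigma>"
proof -
  have "Y (delta 0) 0 = green h 0 0"
  proof -
    have "(\<lambda>k. green h 0 k * delta 0 k) = (\<lambda>k. if k = 0 then green h 0 k else 0)"
      by (auto simp: delta_def)
    thus ?thesis using sums_single[of 0 "green h 0"] by (simp add: Y_def green_op_def sums_iff)
  qed
  also have "\<dots> = - \<i> * of_real \<sigma>"
    by (simp add: green_def \<pi>_def a_def h_def)
  finally show ?thesis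
    by (simp add: X_eq R.resolvent_T ell2_delta ell2_inner_delta_right)
qed

subsection \<open>Eigenvectors\<close>

text \<open>The eigenvalues of \<open>X\<close>: an eigenvalue \<open>t\<close> of \<open>X\<close> is an eigenvalue \<open>1 / (i - t)\<close> of \<open>Y\<close>, and the
  formal eigenvector at \<open>t\<close> is the only candidate.\<close>

definition eigs :: "real set" where
  "eigs = {t. poly_vec t \<in> ell2 \<and> Y (poly_vec t) = (\<lambda>k. 1 / (\<i> - of_real t) * poly_vec t k)}"

lemma eigs_ell2: "t \<in> eigs \<Longrightarrow> poly_vec t \<in> ell2"
  by (simp add: eigs_def)

lemma inner_Y_poly_vec:
  assumes x: "x \<in> ell2" and t: "t \<in> eigs"
  shows "ell2_inner (Y x) (poly_vec t) = 1 / (\<i> - of_real t) * ell2_inner x (poly_vec t)"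
proof -
  have "Z (poly_vec t) = (\<lambda>k. cnj (1 / (\<i> - of_real t)) * poly_vec t k)"
    using t unfolding Z_def eigs_def by (auto simp: cnj_poly_vec)
  thus ?thesis
    using x eigs_ell2[OF t] by (simp only: Y_adjoint ell2_inner_scale_right complex_cnj_cnj)
qed

lemma inner_Z_poly_vec:
  assumes x: "x \<in> ell2" and t: "t \<in> eigs"
  shows "ell2_inner (Z x) (poly_vec t) = cnj (1 / (\<i> - of_real t)) * ell2_inner x (poly_vec t)"
proof -
  have p: "poly_vec t \<in> ell2" by (rule eigs_ell2[OF t])
  have "ell2_inner (Z x) (poly_vec t) = cnj (ell2_inner (Y (poly_vec t)) x)"
    by (simp add: Y_adjoint[OF p x] ell2_inner_commute[OF p Z_ell2[OF x]])
  also have "Y (poly_vec t) = (\<lambda>k. 1 / (\<i> - of_real t) * poly_vec t k)" using t by (simp add: eigs_def)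
  finally show ?thesis
    by (simp only: ell2_inner_scale_left[OF p x] complex_cnj_mult ell2_inner_commute[OF p x])
qed

lemma poly_vec_orthogonal:
  assumes t: "t \<in> eigs" and u: "u \<in> eigs" and "t \<noteq> u"
  shows "ell2_inner (poly_vec t) (poly_vec u) = 0"
proof -
  note p = eigs_ell2[OF t] eigs_ell2[OF u]
  have "ell2_inner (Y (poly_vec t)) (poly_vec u) = 1 / (\<i> - of_real t) * ell2_inner (poly_vec t) (poly_vec u)"
    using t p by (simp only: eigs_def mem_Collect_eq ell2_inner_scale_left)
  hence "1 / (\<i> - of_real t) * ell2_inner (poly_vec t) (poly_vec u) = 1 / (\<i> - of_real u) * ell2_inner (poly_vec t) (poly_vec u)"
    using inner_Y_poly_vec[OF p(1) u] by (simp only:)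
  moreover have "1 / (\<i> - complex_of_real t) \<noteq> 1 / (\<i> - complex_of_real u)"
    using \<open>t \<noteq> u\<close> by simp
  ultimately show ?thesis by (metis mult_right_cancel)
qed

lemma norm_poly_vec_pos: "t \<in> eigs \<Longrightarrow> ell2_norm (poly_vec t) > 0"
  using ell2_coord_le[OF eigs_ell2, of t 0] by (simp add: poly_vec_0)

text \<open>The orthogonal complement of all eigenvectors \<open>p(t)\<close> is invariant under \<open>Y\<close> and \<open>Z\<close>. If it were
  nonzero, it would contain an eigenvector, which is a nonzero multiple of some \<open>p(t)\<close>.\<close>

lemma eigs_complete:
  assumes x: "x \<in> ell2" and orth: "\<And>t. t \<in> eigs \<Longrightarrow> ell2_inner x (poly_vec t) = 0"
  shows "x = (\<lambda>k. 0)"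
proof (rule ccontr)
  assume x0: "x \<noteq> (\<lambda>k. 0)"
  define M where "M = {x \<in> ell2. \<forall>f\<in>poly_vec ` eigs. ell2_inner x f = 0}"
  have YM: "Y v \<in> M" and ZM: "Z v \<in> M" if "v \<in> M" for v
    using that by (auto simp: M_def Y_ell2 Z_ell2 inner_Y_poly_vec inner_Z_poly_vec)
  have "x \<in> M" using x orth by (auto simp: M_def)
  have "poly_vec ` eigs \<subseteq> ell2" using eigs_ell2 by blast
  obtain w l where w: "w \<in> M" "w \<noteq> (\<lambda>k. 0)" "Y w = (\<lambda>k. 1 / (\<i> - of_real l) * w k)"
    by (rule R.ex_eigenvector[OF \<open>poly_vec ` eigs \<subseteq> ell2\<close>, folded M_def, OF YM ZM \<open>x \<in> M\<close> x0]) blast+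
  have w_ell2: "w \<in> ell2" using w(1) by (simp add: M_def)
  have "jac w k = of_real l * w k" for k
  proof -
    define \<gamma> where "\<gamma> = 1 / (\<i> - complex_of_real l)"
    have \<gamma>: "\<gamma> * (\<i> - of_real l) = 1" "\<gamma> \<noteq> 0"
      using i_minus_real_nonzero[of l] by (simp_all add: \<gamma>_def)
    have Yw: "Y w = (\<lambda>k. \<gamma> * w k)" using w(3) by (simp only: \<gamma>_def)
    have "\<gamma> * jac w k = jac (Y w) k"
      unfolding Yw by (simp add: jac_def algebra_simps)
    also have "\<dots> = \<i> * (\<gamma> * w k) - (\<gamma> * (\<i> - of_real l)) * w k"
      unfolding jac_Y[OF w_ell2] unfolding Yw \<gamma>(1) by simp
    also have "\<dots> = \<gamma> * (of_real l * w k)" by (simp add: algebra_simps)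
    finally show ?thesis using \<gamma>(2) by simp
  qed
  hence weq: "w n = w 0 * poly_vec l n" for n by (intro jac_eigenvector_unique) auto
  have w0: "w 0 \<noteq> 0"
  proof
    assume "w 0 = 0"
    hence "w = (\<lambda>k. 0)" by (intro ext) (subst weq, simp)
    thus False using w(2) by blast
  qed
  have poly_vec: "poly_vec l = (\<lambda>k. (1 / w 0) * w k)"
  proof
    fix k
    show "poly_vec l k = (1 / w 0) * w k" using weq[of k] w0 by simp
  qed
  have "poly_vec l \<in> ell2" unfolding poly_vec by (rule ell2_scale[OF w_ell2])
  moreover have "Y (poly_vec l) = (\<lambda>k. 1 / (\<i> - of_real l) * poly_vec l k)"
    unfolding poly_vec R.Y_scale[OF w_ell2] w(3) by (auto simp: mult_ac)
  ultimately have l: "l \<in> eigs" by (simp add: eigs_def)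
  have "0 = ell2_inner w (poly_vec l)" using w(1) l by (auto simp: M_def)
  also have "\<dots> = w 0 * ell2_inner (poly_vec l) (poly_vec l)"
  proof -
    have "w = (\<lambda>n. w 0 * poly_vec l n)" by (rule ext) (rule weq)
    hence "ell2_inner w (poly_vec l) = ell2_inner (\<lambda>n. w 0 * poly_vec l n) (poly_vec l)" by (rule arg_cong)
    thus ?thesis using ell2_inner_scale_left[OF eigs_ell2[OF l] eigs_ell2[OF l]] by simp
  qed
  finally show False
    using w0 norm_poly_vec_pos[OF l] by (simp add: ell2_inner_self eigs_ell2[OF l])
qed

lemma infinite_eigs: "infinite eigs"
proof
  assume "finite eigs"
  then obtain u where u: "finite {k. u k \<noteq> 0}" "u \<noteq> (\<lambda>k. 0)"
    "\<forall>t\<in>eigs. poly_vec t \<in> ell2 \<longrightarrow> ell2_inner u (poly_vec t) = 0"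
    using ex_finite_orthogonal by blast
  have "u = (\<lambda>k. 0)"
    by (rule eigs_complete) (use u eigs_ell2 ell2_finite_support in auto)
  thus False using u(2) by blast
qed

definition unit_poly_vec :: "real \<Rightarrow> vec" where
  "unit_poly_vec t = (\<lambda>k. of_real (1 / ell2_norm (poly_vec t)) * poly_vec t k)"

lemma unit_poly_vec_ell2: "t \<in> eigs \<Longrightarrow> unit_poly_vec t \<in> ell2"
  unfolding unit_poly_vec_def by (intro ell2_scale eigs_ell2)

lemma unit_poly_vec_orthonormal:
  assumes t: "t \<in> eigs" and u: "u \<in> eigs"
  shows "ell2_inner (unit_poly_vec t) (unit_poly_vec u) = (if t = u then 1 else 0)"
proof -
  note p = eigs_ell2[OF t] eigs_ell2[OF u]
  have "ell2_inner (unit_poly_vec t) (unit_poly_vec u) =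
      of_real (1 / ell2_norm (poly_vec t)) * (of_real (1 / ell2_norm (poly_vec u)) * ell2_inner (poly_vec t) (poly_vec u))"
    unfolding unit_poly_vec_def using p
    by (simp only: ell2_inner_scale_left ell2_inner_scale_right ell2_scale complex_cnj_complex_of_real)
  thus ?thesis
    using norm_poly_vec_pos[OF t] poly_vec_orthogonal[OF t u] p
    by (auto simp: ell2_inner_self power2_eq_square)
qed

text \<open>By Bessel's inequality for \<open>\<delta>\<^sub>0\<close>, whose component along each normalised \<open>p(t)\<close> is nonzero.\<close>

lemma countable_eigs: "countable eigs"
proof -
  define g where "g t = (1 / ell2_norm (poly_vec t))\<^sup>2" for t
  have "sum g F \<le> (ell2_norm (delta 0))\<^sup>2" if F: "finite F" "F \<subseteq> eigs" for F
  proof -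
    have "(\<Sum>t\<in>F. (cmod (ell2_inner (delta 0) (unit_poly_vec t)))\<^sup>2) \<le> (ell2_norm (delta 0))\<^sup>2"
      by (rule ell2_Bessel[OF F(1)]) (use F in \<open>auto simp: unit_poly_vec_ell2 unit_poly_vec_orthonormal ell2_delta subset_iff\<close>)
    also have "(\<Sum>t\<in>F. (cmod (ell2_inner (delta 0) (unit_poly_vec t)))\<^sup>2) = sum g F"
      by (intro sum.cong)
         (auto simp: g_def ell2_inner_delta_left unit_poly_vec_def poly_vec_0 norm_divide power_divide)
    finally show ?thesis .
  qed
  hence "g summable_on eigs"
    by (intro nonneg_bdd_above_summable_on bdd_aboveI) (auto simp: g_def)
  hence "countable {t \<in> eigs. g t \<noteq> 0}" by (rule summable_countable_real)
  moreover have "g t \<noteq> 0" if "t \<in> eigs" for t using norm_poly_vec_pos[OF that] by (simp add: g_def)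
  hence "{t \<in> eigs. g t \<noteq> 0} = eigs" by blast
  ultimately show ?thesis by simp
qed

definition eigval :: "nat \<Rightarrow> real" where
  "eigval = from_nat_into eigs"

definition e :: "nat \<Rightarrow> vec" where
  "e n = unit_poly_vec (eigval n)"

lemma eigval_bij: "bij_betw eigval UNIV eigs"
  unfolding eigval_def by (rule bij_betw_from_nat_into[OF countable_eigs infinite_eigs])

lemma eigval_eigs: "eigval n \<in> eigs"
  using eigval_bij by (auto simp: bij_betw_def)

lemma inj_eigval: "inj eigval"
  using eigval_bij by (simp add: bij_betw_def)

sublocale D: diagonal_operator e eigval
proof
  show "e n \<in> ell2" for n unfolding e_def by (rule unit_poly_vec_ell2[OF eigval_eigs])
  show "ell2_inner (e m) (e n) = (if m = n then 1 else 0)" for m n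
    using inj_eigval by (auto simp: e_def unit_poly_vec_orthonormal[OF eigval_eigs eigval_eigs] inj_eq)
  show "x = (\<lambda>k. 0)" if x: "x \<in> ell2" and o: "\<And>n. ell2_inner x (e n) = 0" for x
  proof (rule eigs_complete[OF x])
    fix t assume t: "t \<in> eigs"
    then obtain n where n: "t = eigval n" using eigval_bij by (auto simp: bij_betw_def)
    have "0 = cnj (of_real (1 / ell2_norm (poly_vec t))) * ell2_inner x (poly_vec t)"
      unfolding n
      by (rule trans[OF o[of n, unfolded e_def unit_poly_vec_def, symmetric]
            ell2_inner_scale_right[OF eigs_ell2[OF eigval_eigs] x]])
    thus "ell2_inner x (poly_vec t) = 0" using norm_poly_vec_pos[OF t] by simp
  qed
qed

lemma coeff_Y:
  assumes "x \<in> ell2"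
  shows "D.coeff (Y x) n = D.coeff x n / (\<i> - of_real (eigval n))"
  unfolding D.coeff_def e_def unit_poly_vec_def
    ell2_inner_scale_right[OF eigs_ell2[OF eigval_eigs] Y_ell2[OF assms]]
    ell2_inner_scale_right[OF eigs_ell2[OF eigval_eigs] assms] inner_Y_poly_vec[OF assms eigval_eigs]
  by simp

lemma spectral_measure_X: "spectral_measure X D.proj"
proof (rule D.spectral_measure_proj)
  fix x y
  show "(x, y) \<in> X \<longleftrightarrow> x \<in> ell2 \<and> y \<in> ell2 \<and> D.coeff y = (\<lambda>n. of_real (eigval n) * D.coeff x n)"
  proof (cases "x \<in> ell2 \<and> y \<in> ell2")
    case True
    hence x: "x \<in> ell2" and y: "y \<in> ell2" by auto
    have z: "(\<lambda>k. \<i> * x k - y k) \<in> ell2" by (intro ell2_diff ell2_scale x y)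
    have cz: "D.coeff (\<lambda>k. \<i> * x k - y k) n = \<i> * D.coeff x n - D.coeff y n" for n
      using D.coeff_lincomb[OF x y, of \<i> "-1"] by simp
    have "(x, y) \<in> X \<longleftrightarrow> Y (\<lambda>k. \<i> * x k - y k) = x" using True by (simp add: X_eq R.mem_T_iff)
    also have "\<dots> \<longleftrightarrow> D.coeff (Y (\<lambda>k. \<i> * x k - y k)) = D.coeff x"
      using D.coeff_eqD[OF Y_ell2[OF z] x] by auto
    also have "\<dots> \<longleftrightarrow> (\<forall>n. (\<i> * D.coeff x n - D.coeff y n) / (\<i> - of_real (eigval n)) = D.coeff x n)"
      by (simp add: fun_eq_iff coeff_Y[OF z] cz)
    also have "\<dots> \<longleftrightarrow> (\<forall>n. D.coeff y n = of_real (eigval n) * D.coeff x n)"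
      using i_minus_real_nonzero by (auto simp: divide_eq_eq algebra_simps)
    finally show ?thesis using True by (simp add: fun_eq_iff)
  next
    case False
    thus ?thesis by (auto simp: X_eq R.mem_T_iff)
  qed
qed

lemma coeff_delta:
  "D.coeff (delta k) n = of_real (poly (monic_poly \<omega> k) (eigval n) / sqrt (W k) / ell2_norm (poly_vec (eigval n)))"
  by (simp add: D.coeff_def ell2_inner_delta_left e_def unit_poly_vec_def poly_vec_def)

definition \<mu> :: "real measure" where
  "\<mu> = spectral_distribution D.proj (delta 0)"

lemma \<mu>_eq: "\<mu> = D.spec (delta 0)"
  unfolding \<mu>_def by (rule D.spectral_distribution_proj[OF ell2_delta])

lemma \<mu>_weight: "(cmod (D.coeff (delta 0) n))\<^sup>2 = 1 / (ell2_norm (poly_vec (eigval n)))\<^sup>2"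
  by (simp add: coeff_delta norm_divide power_divide)

text \<open>The coefficient of \<open>\<delta>\<^sub>k\<close> at the eigenvalue \<open>t\<close> is \<open>p\<^sub>k(t) / \<parallel>p(t)\<parallel>\<close>, so products of polynomials weighted by
  \<open>1 / \<parallel>p(t)\<parallel>\<^sup>2\<close> are products of coefficients.\<close>

lemma weighted_products:
  "(cmod (D.coeff (delta 0) n))\<^sup>2 * (poly (monic_poly \<omega> j) (eigval n) * poly (monic_poly \<omega> k) (eigval n))
    = sqrt (W j) * sqrt (W k) * Re (D.coeff (delta j) n * cnj (D.coeff (delta k) n))"
  using W_pos[of j] W_pos[of k] unfolding \<mu>_weight unfolding coeff_delta
  by (simp add: power2_eq_square)

lemma summable_products:
  "summable (\<lambda>n. (cmod (D.coeff (delta 0) n))\<^sup>2 * \<bar>poly (monic_poly \<omega> j) (eigval n) * poly (monic_poly \<omega> k) (eigval n)\<bar>)"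
proof -
  have "summable (\<lambda>n. sqrt (W j) * sqrt (W k) * (cmod (D.coeff (delta j) n) * cmod (D.coeff (delta k) n)))"
    by (intro summable_mult ell2_mult_summable D.Bessel ell2_delta)
  also have "(\<lambda>n. sqrt (W j) * sqrt (W k) * (cmod (D.coeff (delta j) n) * cmod (D.coeff (delta k) n)))
     = (\<lambda>n. (cmod (D.coeff (delta 0) n))\<^sup>2 * \<bar>poly (monic_poly \<omega> j) (eigval n) * poly (monic_poly \<omega> k) (eigval n)\<bar>)"
    using W_pos[of j] W_pos[of k] unfolding \<mu>_weight unfolding coeff_delta
    by (auto simp: power2_eq_square norm_divide norm_mult abs_mult)
  finally show ?thesis .
qed

lemma measurable_products [measurable]:
  "(\<lambda>t. poly (monic_poly \<omega> j) t * poly (monic_poly \<omega> k) t) \<in> borel_measurable borel"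
  by (intro borel_measurable_continuous_onI continuous_intros)

lemma integrable_products: "integrable \<mu> (\<lambda>t. poly (monic_poly \<omega> j) t * poly (monic_poly \<omega> k) t)"
  unfolding \<mu>_eq
  using summable_products by (simp add: D.integrable_spec_iff)

lemma integral_products:
  "(\<integral>t. poly (monic_poly \<omega> j) t * poly (monic_poly \<omega> k) t \<partial>\<mu>) = (if j = k then W j else 0)"
proof -
  have i: "integrable (D.spec (delta 0)) (\<lambda>t. poly (monic_poly \<omega> j) t * poly (monic_poly \<omega> k) t)"
    using integrable_products[of j k] by (simp add: \<mu>_eq)
  have s: "summable (\<lambda>n. D.coeff (delta j) n * cnj (D.coeff (delta k) n))"
    by (intro ell2_inner_summable D.Bessel ell2_delta)
  have "(\<integral>t. poly (monic_poly \<omega> j) t * poly (monic_poly \<omega> k) t \<partial>\<mu>)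
    = (\<Sum>n. sqrt (W j) * sqrt (W k) * Re (D.coeff (delta j) n * cnj (D.coeff (delta k) n)))"
    unfolding \<mu>_eq
    by (subst D.integral_spec[OF measurable_products i]) (simp only: weighted_products)
  also have "\<dots> = sqrt (W j) * sqrt (W k) * Re (ell2_inner (D.coeff (delta j)) (D.coeff (delta k)))"
    unfolding ell2_inner_def Re_suminf[OF s] by (rule suminf_mult[OF summable_Re[OF s]])
  also have "ell2_inner (D.coeff (delta j)) (D.coeff (delta k)) = delta j k"
    using D.Parseval[OF ell2_delta ell2_delta, of j k] by (simp add: ell2_inner_delta_right)
  finally show ?thesis using W_pos[of j] by (auto simp: delta_def)
qed

text \<open>Products with a polynomial \<open>P\<^sub>k\<close> are integrable, and multiplication by \<open>t\<close> maps \<open>P\<^sub>k\<close> to a combination of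
  \<open>P\<^sub>k\<^sub>+\<^sub>1\<close> and \<open>P\<^sub>k\<^sub>-\<^sub>1\<close>; this gives all powers by induction.\<close>

lemma finite_moments_\<mu>: "finite_moments \<mu>"
proof -
  have "integrable \<mu> (\<lambda>t. t ^ n * poly (monic_poly \<omega> k) t)" for n k
  proof (induction n arbitrary: k)
    case 0
    show ?case using integrable_products[of k 0] by simp
  next
    case (Suc n)
    show ?case
    proof (cases k)
      case 0
      thus ?thesis using Suc[of "Suc 0"] by (simp add: mult.commute)
    next
      case (Suc m)
      have "(\<lambda>t. t ^ Suc n * poly (monic_poly \<omega> k) t) = (\<lambda>t. t ^ n * poly (monic_poly \<omega> (Suc k)) t
          + \<omega> k * (t ^ n * poly (monic_poly \<omega> m) t))"
        by (auto simp: Suc algebra_simps)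
      thus ?thesis using Suc.IH[of "Suc k"] Suc.IH[of m] by simp
    qed
  qed
  from this[of _ 0] show ?thesis by (simp add: finite_moments_def)
qed

lemma has_jacobi_sequence_\<mu>: "has_jacobi_sequence \<mu> \<omega>"
  unfolding has_jacobi_sequence_def
proof (intro conjI exI[of _ "monic_poly \<omega>"])
  show "prob_space \<mu>"
  proof
    have "ell2_inner (delta 0) (delta 0) = 1"
      by (simp add: ell2_inner_delta_right) (simp add: delta_def)
    moreover have "D.proj UNIV (delta 0) = delta 0"
      using D.projection_valued_measure_proj ell2_delta by (auto simp: projection_valued_measure_def)
    ultimately show "emeasure \<mu> (space \<mu>) = 1"
      by (simp add: \<mu>_eq D.emeasure_spec_proj[OF ell2_delta])
  qed
  show "sets \<mu> = sets borel" by (simp add: \<mu>_eq)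
  \<comment> \<open>each eigenvalue carries positive mass, so the support contains all of them\<close>
  have "range eigval \<subseteq> measure_support \<mu>"
  proof
    fix t assume "t \<in> range eigval"
    then obtain n where t: "t = eigval n" by blast
    have "emeasure \<mu> U > 0" if U: "open U" "t \<in> U" for U
    proof -
      have "0 < ennreal ((cmod (D.coeff (delta 0) n))\<^sup>2)"
        unfolding \<mu>_weight using norm_poly_vec_pos[OF eigval_eigs[of n]] by simp
      also have "\<dots> = (\<Sum>m\<in>{n}. ennreal (if eigval m \<in> U then (cmod (D.coeff (delta 0) m))\<^sup>2 else 0))"
        using U t by simp
      also have "\<dots> \<le> (\<Sum>m. ennreal (if eigval m \<in> U then (cmod (D.coeff (delta 0) m))\<^sup>2 else 0))"
        by (rule sum_le_suminf) auto
      also have "\<dots> = emeasure \<mu> U"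
        unfolding \<mu>_eq by (rule D.emeasure_spec[symmetric]) (use U in auto)
      finally show ?thesis .
    qed
    thus "t \<in> measure_support \<mu>" by (simp add: measure_support_def)
  qed
  moreover have "infinite (range eigval)" using inj_eigval by (simp add: finite_image_iff)
  ultimately show "infinite (measure_support \<mu>)" using finite_subset by blast
  show "finite_moments \<mu>" by (rule finite_moments_\<mu>)
  show "monic_orthogonal_polys \<mu> (monic_poly \<omega>)"
    unfolding monic_orthogonal_polys_def
    using degree_monic_poly lead_coeff_monic_poly integral_products by auto
  show "monic_poly \<omega> 0 = 1" by simp
  show "[:0, 1:] * monic_poly \<omega> 0 = monic_poly \<omega> 1" by simp
  show "\<forall>n\<ge>1. [:0, 1:] * monic_poly \<omega> n = monic_poly \<omega> (n + 1) + smult (\<omega> n) (monic_poly \<omega> (n - 1))"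
  proof (intro allI impI)
    fix n :: nat assume "n \<ge> 1"
    then obtain m where "n = Suc m" by (cases n) auto
    thus "[:0, 1:] * monic_poly \<omega> n = monic_poly \<omega> (n + 1) + smult (\<omega> n) (monic_poly \<omega> (n - 1))"
      by simp
  qed
qed

end

section \<open>The even and the odd limit\<close>

context jacobi_SC
begin

text \<open>Consecutive partial sums of \<open>d\<close> differ by \<open>c\<^sub>n\<close>, which stays away from zero.\<close>

lemma even_odd_limits:
  obtains \<sigma> \<tau> where "(\<lambda>m. \<Sum>n\<le>2 * m. d n) \<longlonglongrightarrow> \<sigma>" "(\<lambda>m. \<Sum>n\<le>2 * m + 1. d n) \<longlonglongrightarrow> \<tau>" "\<sigma> \<noteq> \<tau>"
proof -
  obtain C where C: "C > 0" "\<And>n. C \<le> c n" using c_lower_bound by blast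
  have "decseq c" using c_antimono by (simp add: decseq_def)
  then obtain L where L: "c \<longlonglongrightarrow> L" "\<And>n. L \<le> c n"
    using decseq_convergent[of c C] C(2) by blast
  have "C \<le> L" using LIMSEQ_le_const[OF L(1)] C(2) by blast
  let ?S = "\<lambda>m. \<Sum>n\<le>2 * m. d n"
  \<comment> \<open>consecutive even sums differ by \<open>c\<^sub>2\<^sub>m\<^sub>+\<^sub>2 - c\<^sub>2\<^sub>m\<^sub>+\<^sub>1\<close>\<close>
  have "decseq ?S"
  proof (rule decseq_SucI)
    fix m
    have "?S (Suc m) = ?S m - c (Suc (2 * m)) + c (Suc (Suc (2 * m)))" by (simp add: d_def)
    thus "?S (Suc m) \<le> ?S m" using c_antimono[of "Suc (2 * m)" "Suc (Suc (2 * m))"] by simp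
  qed
  moreover have "0 \<le> ?S m" for m
    using h_trunc_alternating[of 0 "2 * m"] by (simp add: h_trunc_def atMost_atLeast0)
  ultimately obtain \<sigma> where \<sigma>: "?S \<longlonglongrightarrow> \<sigma>" using decseq_convergent[of ?S 0] by blast
  have "(\<lambda>m. c (Suc (2 * m))) \<longlonglongrightarrow> L"
    using LIMSEQ_subseq_LIMSEQ[OF L(1), of "\<lambda>m. Suc (2 * m)"] by (simp add: strict_mono_def o_def)
  hence "(\<lambda>m. ?S m - c (Suc (2 * m))) \<longlonglongrightarrow> \<sigma> - L" by (intro tendsto_diff \<sigma>)
  moreover have "(\<Sum>n\<le>2 * m + 1. d n) = ?S m - c (Suc (2 * m))" for m by (simp add: d_def)
  ultimately have "(\<lambda>m. \<Sum>n\<le>2 * m + 1. d n) \<longlonglongrightarrow> \<sigma> - L" by simp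
  moreover have "\<sigma> \<noteq> \<sigma> - L" using \<open>C \<le> L\<close> C(1) by simp
  ultimately show ?thesis using that \<sigma> by blast
qed

end

theorem proposition3p11:
  fixes \<omega> :: "nat \<Rightarrow> real"
  assumes "\<And>m. m \<ge> 1 \<Longrightarrow> \<omega> m > 0"
    and "property_SC \<omega>"
  shows "(jacobi_op \<omega> \<subseteq> X_even \<omega> \<and> jacobi_op \<omega> \<subseteq> X_odd \<omega>) \<and>
    (self_adjoint_op (X_even \<omega>) \<and> self_adjoint_op (X_odd \<omega>)) \<and>
    ((\<exists>E. spectral_measure (X_even \<omega>) E \<and>
          finite_moments (spectral_distribution E (delta 0)) \<and>
          has_jacobi_sequence (spectral_distribution E (delta 0)) \<omega>) \<and>
     (\<exists>E. spectral_measure (X_odd \<omega>) E \<and>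
          finite_moments (spectral_distribution E (delta 0)) \<and>
          has_jacobi_sequence (spectral_distribution E (delta 0)) \<omega>)) \<and>
    ell2_inner (op_apply (resolvent \<i> (X_even \<omega>)) (delta 0)) (delta 0) \<noteq>
    ell2_inner (op_apply (resolvent \<i> (X_odd \<omega>)) (delta 0)) (delta 0)"
proof -
  interpret J: jacobi_SC \<omega>
    by standard (use assms in auto)
  obtain \<sigma> \<tau> where lim: "(\<lambda>m. \<Sum>n\<le>2 * m. J.d n) \<longlonglongrightarrow> \<sigma>" "(\<lambda>m. \<Sum>n\<le>2 * m + 1. J.d n) \<longlonglongrightarrow> \<tau>"
    and ne: "\<sigma> \<noteq> \<tau>"
    by (rule J.even_odd_limits)
  have "filterlim (\<lambda>m::nat. 2 * m) at_top sequentially" "filterlim (\<lambda>m::nat. 2 * m + 1) at_top sequentially"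
    by (intro filterlim_subseq; simp add: strict_mono_def)+
  then interpret Ev: jacobi_limit \<omega> \<sigma> "\<lambda>m. 2 * m" + Od: jacobi_limit \<omega> \<tau> "\<lambda>m. 2 * m + 1"
    using lim by unfold_locales auto
  have X: "X_even \<omega> = Ev.X" "X_odd \<omega> = Od.X"
    unfolding X_even_def X_odd_def Y_even_def Y_odd_def Ev.X_def Od.X_def by (rule refl)+
  have "\<exists>E. spectral_measure Ev.X E \<and> finite_moments (spectral_distribution E (delta 0)) \<and>
      has_jacobi_sequence (spectral_distribution E (delta 0)) \<omega>"
    using Ev.spectral_measure_X Ev.finite_moments_\<mu> Ev.has_jacobi_sequence_\<mu> unfolding Ev.\<mu>_def by blast
  moreover have "\<exists>E. spectral_measure Od.X E \<and> finite_moments (spectral_distribution E (delta 0)) \<and>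
      has_jacobi_sequence (spectral_distribution E (delta 0)) \<omega>"
    using Od.spectral_measure_X Od.finite_moments_\<mu> Od.has_jacobi_sequence_\<mu> unfolding Od.\<mu>_def by blast
  ultimately show ?thesis
    unfolding X Ev.Stieltjes_transform_X Od.Stieltjes_transform_X
    using Ev.jacobi_op_subset_X Od.jacobi_op_subset_X Ev.self_adjoint_X Od.self_adjoint_X ne
    by auto
qed

end
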